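(* Let $K$ be an algebraically closed field of characteristic zero and let $I\subset R=K[x_1,x_2,x_3,x_4]$ be an ideal that is minimally generated by four quadrics (homogeneous forms of degree $2$). If the generic initial ideal of $I$ with respect to the lexicographic order contains $x_1^2,\ x_1x_2,\ x_1x_3,\ x_2^2$, then, up to a linear change of coordinates, one of the following must be true: (i) $I=(x_1x_3,\,x_1x_4,\,x_2x_3,\,x_2x_4)$; (ii) $I=(x_1^2,\,x_2^2,\,x_3^2,\,x_1x_2+x_1x_3+x_2x_3)$; (iii) $I=(x_1^2,\,x_2^2,\,x_3^2,\,x_1x_3+x_2x_3)$; (iv) $I=(x_1^2,\,x_1x_2,\,x_1x_3-x_2^2,\,x_3^2)$; (v) $I=(x_1^2,\,x_1x_2,\,x_1x_3-x_2^2,\,x_2x_3)$; (vi) $I=(x_1^2,\,x_1x_3,\,x_2^2,\,x_2x_3)$; (vii) $I=(x_1^2,\,x_1x_2,\,x_1x_3,\,x_2x_3)$; (viii) $I=(x_1^2,\,x_1x_2,\,x_2^2,\,q)$, where $q=x_3x_4$, $q=x_3^2+x_2x_4$ or $q=x_3^2$; (ix) $I=(x_1^2,\,x_1x_2,\,x_2^2,\,x_1x_4-x_2x_3)$; (x) $I=(x_1^2,\,x_1x_2,\,x_2^2,\,x_1x_3)$. Furthermore, the Hilbert function of $R/I$, $j\mapsto\dim_K[R/I]_j$ for $j=0,1,2,\dots$, is - $(1,4,6,6,6,\dots)$ in cases (ii), (iii), (iv) and (viii) (value $6$ for all $j\ge 2$), - $(1,4,6,7,8,9,\dots)$ in cases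 (v) and (vi) (value $j+4$ for all $j\ge 2$), and - $(1,4,6,8,10,\dots)$ in cases (i), (vii), (ix) and (x) (value $2j+2$ for all $j\ge 1$).
   Context: The lexicographic order is taken with $x_1>x_2>x_3>x_4$. The generic initial ideal of $I$ with respect to this order is the initial ideal of $g\cdot I$ for $g$ in a nonempty Zariski open subset of $GL_4(K)$ acting on $R$ by linear changes of coordinates (this initial ideal is the same for all such general $g$). *)

theory Defs
  imports
    "HOL-Analysis.Analysis"
    "HOL-Library.Poly_Mapping"
    "HOL-Computational_Algebra.Computational_Algebra"
begin

section \<open>The polynomial ring in four variables\<close>

text \<open>
  The variable called $x_{i+1}$ in mathematical notation has index \<^term>\<open>i\<close>, where
  \<^term>\<open>i\<close> ranges over the elements 0, 1, 2, 3 of the library type \<^typ>\<open>4\<close>. (The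
  numeral 4 of this type denotes 0, so the indices 1 to 4 are deliberately avoided.)
\<close>

type_synonym ('v, 'k) mpol = "('v \<Rightarrow>\<^sub>0 nat) \<Rightarrow>\<^sub>0 'k"

type_synonym 'k pol4 = "(4, 'k) mpol"

definition const :: "'k::zero \<Rightarrow> ('v, 'k) mpol"
  where "const c = Poly_Mapping.single 0 c"

definition var :: "'v \<Rightarrow> ('v, 'k::zero_neq_one) mpol"
  where "var i = Poly_Mapping.single (Poly_Mapping.single i 1) 1"

abbreviation x1 :: "'k::field pol4" where "x1 \<equiv> var 0"
abbreviation x2 :: "'k::field pol4" where "x2 \<equiv> var 1"
abbreviation x3 :: "'k::field pol4" where "x3 \<equiv> var 2"
abbreviation x4 :: "'k::field pol4" where "x4 \<equiv> var 3"

text \<open>Image of a polynomial under the ring homomorphism that acts as \<^term>\<open>h\<close> on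
  coefficients and sends the variable with index \<^term>\<open>i\<close> to \<^term>\<open>a i\<close>.\<close>

definition mp_eval ::
    "('k::zero \<Rightarrow> 'r::comm_ring_1) \<Rightarrow> ('v::finite \<Rightarrow> 'r) \<Rightarrow> ('v, 'k) mpol \<Rightarrow> 'r"
  where "mp_eval h a p =
    (\<Sum>m\<in>Poly_Mapping.keys p. h (Poly_Mapping.lookup p m) * (\<Prod>i\<in>UNIV. a i ^ Poly_Mapping.lookup m i))"

definition homogeneous :: "nat \<Rightarrow> ('v::finite, 'k::zero) mpol \<Rightarrow> bool"
  where "homogeneous d p \<longleftrightarrow> (\<forall>m\<in>Poly_Mapping.keys p. (\<Sum>i\<in>UNIV. Poly_Mapping.lookup m i) = d)"


section \<open>Ideals\<close>

lemma module_times: "module ((*) :: 'r::comm_ring_1 \<Rightarrow> 'r \<Rightarrow> 'r)"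
  by (simp add: module_def algebra_simps)

text \<open>Ideals of a commutative ring are its submodules when it is viewed as a module over
  itself.\<close>

definition ideal_gen :: "'r::comm_ring_1 set \<Rightarrow> 'r set"
  where "ideal_gen F = module.span (*) F"

definition minimally_generates :: "'r::comm_ring_1 set \<Rightarrow> 'r set \<Rightarrow> bool"
  where "minimally_generates F I \<longleftrightarrow> ideal_gen F = I \<and> (\<forall>G. G \<subset> F \<longrightarrow> ideal_gen G \<noteq> I)"

definition min_gen_by_four_quadrics :: "'k::field pol4 set \<Rightarrow> bool"
  where "min_gen_by_four_quadrics I \<longleftrightarrow>
    (\<exists>F. card F = 4 \<and> (\<forall>f\<in>F. homogeneous 2 f) \<and> minimally_generates F I)"


section \<open>Linear changes of coordinates\<close>

text \<open>The matrix \<^term>\<open>g\<close> sends the \<open>i\<close>-th variable to the linear form whose coefficients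
  are the \<open>i\<close>-th column of \<^term>\<open>g\<close>; on linear forms this is the standard left action.\<close>

definition lin_subst :: "'k::field^4^4 \<Rightarrow> 'k pol4 \<Rightarrow> 'k pol4"
  where "lin_subst g = mp_eval const (\<lambda>i. \<Sum>j\<in>UNIV. const (g $ j $ i) * var j)"

definition gl_image :: "'k::field^4^4 \<Rightarrow> 'k pol4 set \<Rightarrow> 'k pol4 set"
  where "gl_image g I = lin_subst g ` I"

definition lin_equiv :: "'k::field pol4 set \<Rightarrow> 'k pol4 set \<Rightarrow> bool"
  where "lin_equiv I J \<longleftrightarrow> (\<exists>g. invertible g \<and> gl_image g I = J)"


section \<open>Lexicographic order and generic initial ideals\<close>

text \<open>The order of the library on exponent vectors is the lexicographic order in which the
  variable with the smallest index is the largest one, so $x_1 > x_2 > x_3 > x_4$.\<close>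

lemma index_order: "(0::4) < 1" "(1::4) < 2" "(2::4) < 3"
  by (simp_all add: less_bit0_def bit0.Rep_0 bit0.Rep_1 bit0.Rep_numeral)

lemma exponent_order_lex:
  fixes m n :: "4 \<Rightarrow>\<^sub>0 nat"
  shows "m < n \<longleftrightarrow> (\<exists>i. Poly_Mapping.lookup m i < Poly_Mapping.lookup n i \<and> (\<forall>j<i. Poly_Mapping.lookup m j = Poly_Mapping.lookup n j))"
  by transfer (simp add: less_fun_def)

definition lead_monomial :: "'k::field pol4 \<Rightarrow> 'k pol4"
  where "lead_monomial p = Poly_Mapping.single (Max (Poly_Mapping.keys p)) 1"

definition initial_ideal :: "'k::field pol4 set \<Rightarrow> 'k pol4 set"
  where "initial_ideal I = ideal_gen {lead_monomial p | p. p \<in> I \<and> p \<noteq> 0}"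

text \<open>A set of matrices is Zariski open in the general linear group iff its complement there
  is the set of common zeros of a family of polynomials in the 16 matrix entries.
  (Inverting the determinant in these polynomials would not give more closed sets.)\<close>

definition zariski_open_GL4 :: "('k::field^4^4) set \<Rightarrow> bool"
  where "zariski_open_GL4 U \<longleftrightarrow>
    (\<exists>S :: (4 \<times> 4, 'k) mpol set.
      U = {g. invertible g \<and> \<not> (\<forall>p\<in>S. mp_eval id (\<lambda>(i, j). g $ i $ j) p = 0)})"

text \<open>Two nonempty open sets of matrices meet over an infinite field, hence there is at most
  one such \<^term>\<open>J\<close>.\<close>

definition is_gin :: "'k::field pol4 set \<Rightarrow> 'k pol4 set \<Rightarrow> bool"
  where "is_gin I J \<longleftrightarrow>
    (\<exists>U. zariski_open_GL4 U \<and> U \<noteq> {} \<and> (\<forall>g\<in>U. initial_ideal (gl_image g I) = J))"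


section \<open>Hilbert function\<close>

text \<open>\<^term>\<open>B\<close> is a set of forms of degree \<^term>\<open>j\<close> whose residue classes are pairwise distinct
  and form a basis of the degree \<^term>\<open>j\<close> part of the quotient by \<^term>\<open>I\<close> over the ground
  field.\<close>

definition residue_basis :: "'k::field pol4 set \<Rightarrow> nat \<Rightarrow> 'k pol4 set \<Rightarrow> bool"
  where "residue_basis I j B \<longleftrightarrow>
    finite B \<and> (\<forall>b\<in>B. homogeneous j b) \<and>
    (\<forall>c. (\<Sum>b\<in>B. const (c b) * b) \<in> I \<longrightarrow> (\<forall>b\<in>B. c b = 0)) \<and>
    (\<forall>f. homogeneous j f \<longrightarrow> (\<exists>c. f - (\<Sum>b\<in>B. const (c b) * b) \<in> I))"

definition hilbert_fun :: "'k::field pol4 set \<Rightarrow> nat \<Rightarrow> nat"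
  where "hilbert_fun I j = (THE n. \<exists>B. residue_basis I j B \<and> card B = n)"


section \<open>The ideals of the classification\<close>

definition ideal_i :: "'k::field pol4 set"
  where "ideal_i = ideal_gen {x1 * x3, x1 * x4, x2 * x3, x2 * x4}"

definition ideal_ii :: "'k::field pol4 set"
  where "ideal_ii = ideal_gen {x1^2, x2^2, x3^2, x1 * x2 + x1 * x3 + x2 * x3}"

definition ideal_iii :: "'k::field pol4 set"
  where "ideal_iii = ideal_gen {x1^2, x2^2, x3^2, x1 * x3 + x2 * x3}"

definition ideal_iv :: "'k::field pol4 set"
  where "ideal_iv = ideal_gen {x1^2, x1 * x2, x1 * x3 - x2^2, x3^2}"

definition ideal_v :: "'k::field pol4 set"
  where "ideal_v = ideal_gen {x1^2, x1 * x2, x1 * x3 - x2^2, x2 * x3}"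

definition ideal_vi :: "'k::field pol4 set"
  where "ideal_vi = ideal_gen {x1^2, x1 * x3, x2^2, x2 * x3}"

definition ideal_vii :: "'k::field pol4 set"
  where "ideal_vii = ideal_gen {x1^2, x1 * x2, x1 * x3, x2 * x3}"

definition ideal_viii :: "'k::field pol4 \<Rightarrow> 'k pol4 set"
  where "ideal_viii q = ideal_gen {x1^2, x1 * x2, x2^2, q}"

definition ideal_ix :: "'k::field pol4 set"
  where "ideal_ix = ideal_gen {x1^2, x1 * x2, x2^2, x1 * x4 - x2 * x3}"

definition ideal_x :: "'k::field pol4 set"
  where "ideal_x = ideal_gen {x1^2, x1 * x2, x2^2, x1 * x3}"

end

theory Submission
  imports Defs
begin

text \<open>
  Let $V$ be the space of quadrics in $I$, which has dimension four. After a general change of coordinates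
  with first row $v$, the coefficients of $x_1^2,x_1x_2,x_1x_3,x_1x_4$ in a quadric are, up to a factor, the
  values of its polar form at $v$ and the rows. The leading monomials $x_1^2,x_1x_2,x_1x_3$ show that the
  Jacobian matrix of four generators has rank at least three at $v$, and the leading monomial $x_2^2$
  belongs to a member of $V$ without $x_1$, that is, a quadric that is singular at $v$
  (\<open>rank_three_row\<close>, \<open>singular_row\<close>). By density the Jacobian determinant vanishes identically
  (\<open>degenerate_of_gin\<close>).

  For a general point $v$ there are therefore, up to scalars, one quadric $F_v$ in $V$ that is singular at
  $v$ and one direction $s(v)$ that is orthogonal to $v$ for all polar forms of $V$. Differentiation along
  lines through $v$ shows that $F_v$ is also singular at $s(v)$ (\<open>generic_singular_quadric\<close>). So
  $F_v$ has rank at most two, and there are three possibilities (\<open>classified_degenerate\<close>).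

  \<^item> All $F_v$ are squares. Then $V$ contains $x^2,xy,y^2$ for two independent linear forms, or
    all quadrics in $V$ have a common vertex.

  \<^item> The $F_v$ are products of two independent forms, and two of their vertex lines
    $\langle v,s(v)\rangle$ are disjoint. The two pairs of factors are coordinates in which $V$ becomes
    the space of (i) (\<open>classified_two_pairs\<close>).

  \<^item> Any two of the vertex lines meet. Then they have a common point, which is a vertex of all
    quadrics in $V$.

  A space that contains $x^2,xy,y^2$ is of type (viii), (ix) or (x), by completing the square in a fourth
  quadric (\<open>classified_double_line\<close>). If there is a common vertex, then $V$ consists of quadrics in
  three variables and is cut out by two linear conditions. These form a pencil of conics in the dual
  plane, whose base points are the squares of linear forms in $V$. A pencil of conics has a base point,
  and the number and the position of the base points lead to the cases (ii) to (vii) and to some of the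
  cases with a double line (\<open>classified_ternary\<close>).

  The Hilbert functions are invariant under changes of coordinates. For each ideal of the list a linear
  projection onto the span of the standard monomials is given explicitly, and the Hilbert function
  counts these monomials (\<open>hilbert_fun_eq_card\<close>).
\<close>

section \<open>Polynomials in four variables\<close>

lemma UNIV_index: "(UNIV :: 4 set) = {0, 1, 2, 3}"
proof -
  have "(4::4) = 0" by simp
  then show ?thesis unfolding UNIV_4 by (simp only: insert_commute)
qed

lemma index_cases: obtains "i = (0::4)" | "i = 1" | "i = 2" | "i = 3"
proof -
  have "i \<in> {0, 1, 2, 3}"
    unfolding UNIV_index[symmetric] by (rule UNIV_I)
  then show thesis
    using that by (elim insertE emptyE)
qed

lemma index_distinct [simp]:
  "(0::4) \<noteq> 1" "(0::4) \<noteq> 2" "(0::4) \<noteq> 3" "(1::4) \<noteq> 2" "(1::4) \<noteq> 3" "(2::4) \<noteq> 3"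
  "(1::4) \<noteq> 0" "(2::4) \<noteq> 0" "(3::4) \<noteq> 0" "(2::4) \<noteq> 1" "(3::4) \<noteq> 1" "(3::4) \<noteq> 2"
proof -
  have "(0::4) < 1" "(1::4) < 2" "(2::4) < 3" "(0::4) < 2" "(0::4) < 3" "(1::4) < 3"
    using index_order less_trans by blast+
  then show
    "(0::4) \<noteq> 1" "(0::4) \<noteq> 2" "(0::4) \<noteq> 3" "(1::4) \<noteq> 2" "(1::4) \<noteq> 3" "(2::4) \<noteq> 3"
    "(1::4) \<noteq> 0" "(2::4) \<noteq> 0" "(3::4) \<noteq> 0" "(2::4) \<noteq> 1" "(3::4) \<noteq> 1" "(3::4) \<noteq> 2"
    by (simp_all only: less_imp_neq less_imp_neq[symmetric] not_False_eq_True)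
qed

lemma sum_index: "(\<Sum>i\<in>UNIV. f (i::4)) = f 0 + f 1 + f 2 + f 3"
proof -
  have "sum f {0, 1, 2, 3} = f 0 + f 1 + f 2 + f 3"
    by (simp add: add.assoc)
  then show ?thesis unfolding UNIV_index .
qed

lemma prod_index: "(\<Prod>i\<in>UNIV. f (i::4)) = f 0 * f 1 * f 2 * f 3"
proof -
  have "prod f {0, 1, 2, 3} = f 0 * f 1 * f 2 * f 3"
    by (simp add: mult.assoc)
  then show ?thesis unfolding UNIV_index .
qed

lemma all_index: "(\<forall>i. P (i::4)) \<longleftrightarrow> P 0 \<and> P 1 \<and> P 2 \<and> P 3"
  by (metis index_cases)

lemma const_0 [simp]: "const 0 = 0" and const_1 [simp]: "const 1 = 1"
  by (simp_all add: const_def)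

lemma const_add: "const (a + b) = const a + const b"
  by (simp add: const_def single_add)

lemma const_mult: "const (a * b) = const a * const b"
  by (simp add: const_def mult_single)

lemma const_uminus: "const (- a) = - const (a::'a::ab_group_add)"
  by (simp add: const_def single_uminus)

lemma const_diff: "const (a - b) = const a - const (b::'a::ab_group_add)"
  by (simp add: const_def single_diff)

lemma const_power: "const (a ^ n) = const (a::'a::comm_semiring_1) ^ n"
  by (induction n) (simp_all add: const_mult)

lemma const_numeral [simp]: "const (numeral n) = numeral n"
  by (simp add: const_def)

lemmas const_simps = const_add const_mult const_uminus const_diff const_power

lemma poly_mapping_sum_single:
  "p = (\<Sum>m\<in>Poly_Mapping.keys p. Poly_Mapping.single m (Poly_Mapping.lookup p m))"
  by (rule poly_mapping_eqI)
    (simp add: lookup_sum lookup_single when_def in_keys_iff sum.delta)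

locale coeff_hom =
  fixes h :: "'k::comm_ring_1 \<Rightarrow> 'r::comm_ring_1"
  assumes h0 [simp]: "h 0 = 0" and h1 [simp]: "h 1 = 1"
    and h_add: "h (a + b) = h a + h b" and h_mult: "h (a * b) = h a * h b"
begin

lemma mp_eval_superset:
  assumes "finite S" "Poly_Mapping.keys p \<subseteq> S"
  shows "mp_eval h a p = (\<Sum>m\<in>S. h (Poly_Mapping.lookup p m) * (\<Prod>i\<in>UNIV. a i ^ Poly_Mapping.lookup m i))"
  unfolding mp_eval_def using assms by (intro sum.mono_neutral_left) (auto simp: in_keys_iff)

lemma mp_eval_0 [simp]: "mp_eval h a 0 = 0"
  by (simp add: mp_eval_def)

lemma mp_eval_single: "mp_eval h a (Poly_Mapping.single m c) = h c * (\<Prod>i\<in>UNIV. a i ^ Poly_Mapping.lookup m i)"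
  by (cases "c = 0") (simp_all add: mp_eval_def)

lemma mp_eval_add: "mp_eval h a (p + q) = mp_eval h a p + mp_eval h a q"
proof -
  have "Poly_Mapping.keys (p + q) \<subseteq> Poly_Mapping.keys p \<union> Poly_Mapping.keys q"
    by (rule keys_add)
  then show ?thesis
    by (simp add: mp_eval_superset[of "Poly_Mapping.keys p \<union> Poly_Mapping.keys q"]
        lookup_add h_add algebra_simps sum.distrib)
qed

lemma mp_eval_sum: "mp_eval h a (sum f S) = (\<Sum>x\<in>S. mp_eval h a (f x))"
  by (induction S rule: infinite_finite_induct) (simp_all add: mp_eval_add)

lemma mp_eval_mult: "mp_eval h a (p * q) = mp_eval h a p * mp_eval h a q"
proof -
  let ?s = "\<lambda>p m. Poly_Mapping.single m (Poly_Mapping.lookup p m)"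
  have "p * q = (\<Sum>m\<in>Poly_Mapping.keys p. ?s p m) * (\<Sum>n\<in>Poly_Mapping.keys q. ?s q n)"
    using poly_mapping_sum_single by metis
  also have "\<dots> = (\<Sum>m\<in>Poly_Mapping.keys p. \<Sum>n\<in>Poly_Mapping.keys q. ?s p m * ?s q n)"
    by (rule sum_product)
  finally have "mp_eval h a (p * q)
      = (\<Sum>m\<in>Poly_Mapping.keys p. \<Sum>n\<in>Poly_Mapping.keys q. mp_eval h a (?s p m * ?s q n))"
    by (simp add: mp_eval_sum)
  also have "\<dots> = (\<Sum>m\<in>Poly_Mapping.keys p. \<Sum>n\<in>Poly_Mapping.keys q. mp_eval h a (?s p m) * mp_eval h a (?s q n))"
    by (simp add: mult_single mp_eval_single lookup_add power_add prod.distrib h_mult mult_ac)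
  also have "\<dots> = mp_eval h a p * mp_eval h a q"
    unfolding sum_product[symmetric] mp_eval_sum[symmetric] poly_mapping_sum_single[symmetric] ..
  finally show ?thesis .
qed

lemma mp_eval_const [simp]: "mp_eval h a (const c) = h c"
  by (simp add: const_def mp_eval_single)

lemma mp_eval_1 [simp]: "mp_eval h a 1 = 1"
  using mp_eval_const[of a 1] by simp

lemma mp_eval_var [simp]: "mp_eval h a (var i) = a i"
proof -
  have "(\<Prod>j\<in>UNIV. a j ^ Poly_Mapping.lookup (Poly_Mapping.single i (1::nat)) j) = (\<Prod>j\<in>UNIV. if j = i then a j else 1)"
    by (rule prod.cong) (auto simp: lookup_single when_def)
  then show ?thesis
    by (simp add: var_def mp_eval_single)
qed

lemma mp_eval_uminus: "mp_eval h a (- p) = - mp_eval h a p"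
  using mp_eval_add[of a p "- p"] by (simp add: eq_neg_iff_add_eq_0 add.commute)

lemma mp_eval_diff: "mp_eval h a (p - q) = mp_eval h a p - mp_eval h a q"
  using mp_eval_add[of a p "- q"] by (simp add: mp_eval_uminus)

lemma mp_eval_power: "mp_eval h a (p ^ n) = mp_eval h a p ^ n"
  by (induction n) (simp_all add: mp_eval_mult)

end

lemma single_eq_const_vars:
  "Poly_Mapping.single m c = const c * (\<Prod>i\<in>UNIV. var i ^ Poly_Mapping.lookup m (i :: 'v :: finite))"
proof -
  have pow: "var i ^ n = (Poly_Mapping.single (Poly_Mapping.single i n) 1 :: ('v, 'a) mpol)" for i and n :: nat
    by (induction n) (simp_all add: var_def mult_single single_add[symmetric])
  have "(\<Prod>i\<in>S. var i ^ Poly_Mapping.lookup m i)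
      = (Poly_Mapping.single (\<Sum>i\<in>S. Poly_Mapping.single i (Poly_Mapping.lookup m i)) 1 :: ('v, 'a) mpol)" for S
    by (induction S rule: infinite_finite_induct) (simp_all add: pow mult_single)
  moreover have "(\<Sum>i\<in>UNIV. Poly_Mapping.single i (Poly_Mapping.lookup m i)) = m"
    by (rule poly_mapping_eqI) (simp add: lookup_sum lookup_single when_def)
  ultimately show ?thesis
    by (simp add: const_def mult_single)
qed

text \<open>A homomorphism commutes with the sums and products that define a substitution. Compositions of
  substitutions and evaluations are computed by this rule, without expanding any polynomial.\<close>

lemma hom_mp_eval:
  fixes \<phi> :: "'r::comm_ring_1 \<Rightarrow> 's::comm_ring_1"
  assumes "\<phi> 0 = 0" "\<phi> 1 = 1" "\<And>x y. \<phi> (x + y) = \<phi> x + \<phi> y" "\<And>x y. \<phi> (x * y) = \<phi> x * \<phi> y"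
  shows "\<phi> (mp_eval h a p) = mp_eval (\<lambda>c. \<phi> (h c)) (\<lambda>i. \<phi> (a i)) p"
proof -
  have s: "\<phi> (sum f S) = (\<Sum>x\<in>S. \<phi> (f x))" for f :: "'c \<Rightarrow> 'r" and S
    by (induction S rule: infinite_finite_induct) (simp_all add: assms)
  have pw: "\<phi> (x ^ n) = \<phi> x ^ n" for x n
    by (induction n) (simp_all add: assms)
  have pr: "\<phi> (prod f S) = (\<Prod>x\<in>S. \<phi> (f x))" for f :: "'d \<Rightarrow> 'r" and S
    by (induction S rule: infinite_finite_induct) (simp_all add: assms)
  show ?thesis
    by (simp add: mp_eval_def s pr pw assms)
qed

lemma coeff_hom_const: "coeff_hom (const :: 'k::comm_ring_1 \<Rightarrow> ('v, 'k) mpol)"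
  by unfold_locales (simp_all add: const_simps)

lemma coeff_hom_id: "coeff_hom (id :: 'k::comm_ring_1 \<Rightarrow> 'k)"
  by unfold_locales simp_all

interpretation ch_const: coeff_hom "const :: 'k::comm_ring_1 \<Rightarrow> ('v, 'k) mpol"
  by (rule coeff_hom_const)

interpretation ch_id: coeff_hom "id :: 'k::comm_ring_1 \<Rightarrow> 'k"
  by (rule coeff_hom_id)

lemma mp_eval_const_var: "mp_eval const var p = p"
  unfolding mp_eval_def single_eq_const_vars[symmetric] by (rule poly_mapping_sum_single[symmetric])

subsection \<open>Evaluation and linear substitutions\<close>

definition ev :: "'k::field pol4 \<Rightarrow> 'k^4 \<Rightarrow> 'k"
  where "ev p v = mp_eval id (\<lambda>i. v $ i) p"

lemma ev_simps [simp]: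
  "ev 0 v = 0" "ev 1 v = 1" "ev (const c) v = c" "ev (var i) v = v $ i"
  "ev (p + q) v = ev p v + ev q v" "ev (p * q) v = ev p v * ev q v"
  "ev (p - q) v = ev p v - ev q v" "ev (- p) v = - ev p v" "ev (p ^ n) v = ev p v ^ n"
  "ev (sum f S) v = (\<Sum>x\<in>S. ev (f x) v)"
  by (simp_all add: ev_def ch_id.mp_eval_add ch_id.mp_eval_mult ch_id.mp_eval_diff
      ch_id.mp_eval_uminus ch_id.mp_eval_power ch_id.mp_eval_sum)

lemma lin_subst_simps [simp]:
  "lin_subst g 0 = 0" "lin_subst g 1 = 1" "lin_subst g (const c) = const c"
  "lin_subst g (p + q) = lin_subst g p + lin_subst g q"
  "lin_subst g (p * q) = lin_subst g p * lin_subst g q"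
  "lin_subst g (p - q) = lin_subst g p - lin_subst g q" "lin_subst g (- p) = - lin_subst g p"
  "lin_subst g (p ^ n) = lin_subst g p ^ n"
  "lin_subst g (sum f S) = (\<Sum>x\<in>S. lin_subst g (f x))"
  by (simp_all add: lin_subst_def ch_const.mp_eval_add ch_const.mp_eval_mult ch_const.mp_eval_diff
      ch_const.mp_eval_uminus ch_const.mp_eval_power ch_const.mp_eval_sum)

lemma lin_subst_var: "lin_subst g (var i) = (\<Sum>j\<in>UNIV. const (g $ j $ i) * var j)"
  by (simp add: lin_subst_def)

lemma lin_subst_mult: "lin_subst g (lin_subst h p) = lin_subst (g ** h) p"
proof -
  have "lin_subst g (lin_subst h p) = mp_eval const (\<lambda>i. lin_subst g (\<Sum>j\<in>UNIV. const (h $ j $ i) * var j)) p"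
    unfolding lin_subst_def[of h] by (subst hom_mp_eval) simp_all
  also have "(\<lambda>i. lin_subst g (\<Sum>j\<in>UNIV. const (h $ j $ i) * var j))
      = (\<lambda>i. \<Sum>j\<in>UNIV. const ((g ** h) $ j $ i) * var j)"
    by (simp add: lin_subst_var matrix_matrix_mult_def sum_index const_simps algebra_simps)
  finally show ?thesis
    by (simp add: lin_subst_def)
qed

lemma lin_subst_mat_1 [simp]: "lin_subst (mat 1) p = p"
proof -
  have "(\<lambda>i. \<Sum>j\<in>UNIV. const ((mat 1 :: 'a^4^4) $ j $ i) * var j) = (var :: 4 \<Rightarrow> 'a pol4)"
  proof
    fix i :: 4
    show "(\<Sum>j\<in>UNIV. const ((mat 1 :: 'a^4^4) $ j $ i) * var j) = (var i :: 'a pol4)"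
      by (rule index_cases[of i]) (simp_all add: mat_def sum_index)
  qed
  then show ?thesis
    by (simp add: lin_subst_def mp_eval_const_var)
qed

text \<open>Points are row vectors here, so substituting in a polynomial amounts to multiplying points by the
  matrix from the right. In particular the first unit vector becomes the first row of the matrix.\<close>

lemma ev_lin_subst: "ev (lin_subst g p) v = ev p (v v* g)"
proof -
  have "ev (lin_subst g p) v = mp_eval (\<lambda>c. ev (const c) v) (\<lambda>i. ev (\<Sum>j\<in>UNIV. const (g $ j $ i) * var j) v) p"
    unfolding lin_subst_def by (subst hom_mp_eval) simp_all
  moreover have "(\<lambda>i. ev (\<Sum>j\<in>UNIV. const (g $ j $ i) * var j) v) = (\<lambda>i. (v v* g) $ i)"
    by (simp add: vector_matrix_mult_def mult.commute)
  moreover have "(\<lambda>c. ev (const c) v) = id"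
    by (simp add: fun_eq_iff)
  ultimately show ?thesis
    by (simp add: ev_def)
qed

lemma invertible_lin_subst_inverse:
  assumes "invertible (g :: 'k::field^4^4)"
  obtains h where "invertible h" "\<And>p. lin_subst g (lin_subst h p) = p" "\<And>p. lin_subst h (lin_subst g p) = p"
proof -
  from assms obtain h where "g ** h = mat 1" "h ** g = mat 1"
    by (auto simp: invertible_def)
  then show ?thesis
    using that[of h] by (auto simp: invertible_def lin_subst_mult)
qed

lemma inj_lin_subst: "invertible g \<Longrightarrow> inj (lin_subst g)"
  by (metis invertible_lin_subst_inverse injI)

subsection \<open>Ideals and linear combinations\<close>

interpretation ideal_module: module "(*) :: 'k::field pol4 \<Rightarrow> 'k pol4 \<Rightarrow> 'k pol4"
  by (rule module_times)

interpretation pvs: vector_space "\<lambda>c p :: 'k::field pol4. const c * p"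
proof
  fix a b :: 'k and p q :: "'k pol4"
  show "const a * (p + q) = const a * p + const a * q" by (rule distrib_left)
  show "const (a + b) * p = const a * p + const b * p" by (simp only: distrib_right const_add)
  show "const a * (const b * p) = const (a * b) * p" by (simp only: mult.assoc const_mult)
  show "const 1 * p = p" by (simp only: const_1 mult_1)
qed

(* As rewrite rules these reassociate every product of polynomials. *)
declare ideal_module.scale_scale [simp del] pvs.scale_scale [simp del]

lemma ideal_gen_base: "p \<in> F \<Longrightarrow> p \<in> ideal_gen F"
  and ideal_gen_0: "0 \<in> ideal_gen F"
  and ideal_gen_add: "p \<in> ideal_gen F \<Longrightarrow> q \<in> ideal_gen F \<Longrightarrow> p + q \<in> ideal_gen F"
  and ideal_gen_diff: "p \<in> ideal_gen F \<Longrightarrow> q \<in> ideal_gen F \<Longrightarrow> p - q \<in> ideal_gen F"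
  and ideal_gen_mult: "p \<in> ideal_gen F \<Longrightarrow> r * p \<in> ideal_gen F" for F :: "'k::field pol4 set"
  by (simp_all add: ideal_gen_def ideal_module.span_base ideal_module.span_zero
      ideal_module.span_add ideal_module.span_diff ideal_module.span_scale)

lemma ideal_gen_sum:
  "(\<And>x. x \<in> S \<Longrightarrow> f x \<in> ideal_gen F) \<Longrightarrow> sum f S \<in> ideal_gen (F :: 'k::field pol4 set)"
  by (simp add: ideal_gen_def ideal_module.span_sum)

lemma ideal_gen_induct [consumes 1, case_names zero step]:
  fixes F :: "'k::field pol4 set"
  assumes "p \<in> ideal_gen F" "P 0" "\<And>r f q. f \<in> F \<Longrightarrow> q \<in> ideal_gen F \<Longrightarrow> P q \<Longrightarrow> P (r * f + q)"
  shows "P p"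
proof -
  have "p \<in> ideal_gen F \<and> P p"
    using assms(1)[unfolded ideal_gen_def]
  proof (induction rule: ideal_module.span_induct_alt)
    case base
    show ?case using assms(2) ideal_gen_0 by blast
  next
    case (step c x y)
    then show ?case
      using assms(3) ideal_gen_add ideal_gen_mult ideal_gen_base by blast
  qed
  then show ?thesis ..
qed

lemma ideal_gen_subset:
  "F \<subseteq> ideal_gen G \<Longrightarrow> ideal_gen F \<subseteq> ideal_gen (G :: 'k::field pol4 set)"
  unfolding ideal_gen_def by (rule ideal_module.span_minimal) (simp_all add: ideal_module.subspace_span)

lemma ideal_gen_eqI:
  "F \<subseteq> ideal_gen G \<Longrightarrow> G \<subseteq> ideal_gen F \<Longrightarrow> ideal_gen F = ideal_gen (G :: 'k::field pol4 set)"
  by (intro equalityI ideal_gen_subset)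

lemma lin_subst_ideal_gen: 
  assumes "invertible (g :: 'k::field^4^4)"
  shows "gl_image g (ideal_gen F) = ideal_gen (lin_subst g ` F)"
proof -
  have sub: "lin_subst g ` ideal_gen F \<subseteq> ideal_gen (lin_subst g ` F)" for g :: "'k^4^4" and F
  proof clarify
    fix p assume "p \<in> ideal_gen F"
    then show "lin_subst g p \<in> ideal_gen (lin_subst g ` F)"
      by (induction rule: ideal_gen_induct) (auto intro: ideal_gen_0 ideal_gen_add ideal_gen_mult ideal_gen_base)
  qed
  obtain h where h: "\<And>p. lin_subst g (lin_subst h p) = p" "\<And>p. lin_subst h (lin_subst g p) = p"
    using invertible_lin_subst_inverse[OF assms] by metis
  have "lin_subst h ` ideal_gen (lin_subst g ` F) \<subseteq> ideal_gen F"
    using sub[of h "lin_subst g ` F"] by (simp add: image_comp h o_def)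
  then have "lin_subst g ` lin_subst h ` ideal_gen (lin_subst g ` F) \<subseteq> lin_subst g ` ideal_gen F"
    by (rule image_mono)
  then show ?thesis
    using sub[of g F] by (auto simp: gl_image_def image_comp o_def h)
qed

subsection \<open>Homogeneous polynomials\<close>

abbreviation mdeg :: "(4 \<Rightarrow>\<^sub>0 nat) \<Rightarrow> nat"
  where "mdeg m \<equiv> (\<Sum>i\<in>UNIV. Poly_Mapping.lookup m i)"

lemma mdeg_add: "mdeg (m + n) = mdeg m + mdeg n"
  by (simp add: lookup_add sum.distrib)

lemma homogeneous_0 [simp]: "homogeneous d (0 :: 'k::field pol4)"
  by (simp add: homogeneous_def)

lemma homogeneous_add: "homogeneous d p \<Longrightarrow> homogeneous d q \<Longrightarrow> homogeneous d (p + q :: 'k::field pol4)"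
  unfolding homogeneous_def by (auto dest!: subsetD[OF keys_add])

lemma homogeneous_uminus: "homogeneous d p \<Longrightarrow> homogeneous d (- p :: 'k::field pol4)"
  by (simp add: homogeneous_def)

lemma homogeneous_diff: "homogeneous d p \<Longrightarrow> homogeneous d q \<Longrightarrow> homogeneous d (p - q :: 'k::field pol4)"
  using homogeneous_add[of d p "- q"] homogeneous_uminus by force

lemma homogeneous_sum: "(\<And>x. x \<in> S \<Longrightarrow> homogeneous d (f x)) \<Longrightarrow> homogeneous d (sum f S :: 'k::field pol4)"
  by (induction S rule: infinite_finite_induct) (auto intro: homogeneous_add)

lemma homogeneous_mult:
  assumes "homogeneous d p" "homogeneous e q"
  shows "homogeneous (d + e) (p * q :: 'k::field pol4)"
  unfolding homogeneous_def
proof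
  fix m assume "m \<in> Poly_Mapping.keys (p * q)"
  with keys_mult obtain a b where "m = a + b" "a \<in> Poly_Mapping.keys p" "b \<in> Poly_Mapping.keys q"
    by blast
  with assms show "mdeg m = d + e"
    by (simp add: homogeneous_def mdeg_add)
qed

lemma homogeneous_const: "homogeneous 0 (const c :: 'k::field pol4)"
  by (simp add: homogeneous_def const_def)

lemma homogeneous_scale: "homogeneous d p \<Longrightarrow> homogeneous d (const c * p :: 'k::field pol4)"
  using homogeneous_mult[OF homogeneous_const] by fastforce

lemma homogeneous_var: "homogeneous 1 (var i :: 'k::field pol4)"
  by (simp add: homogeneous_def var_def lookup_single when_def)

lemma homogeneous_power: "homogeneous d p \<Longrightarrow> homogeneous (n * d) (p ^ n :: 'k::field pol4)"
proof (induction n)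
  case 0
  show ?case using homogeneous_const[of 1] by simp
next
  case (Suc n)
  then show ?case using homogeneous_mult[of d p "n * d" "p ^ n"] by simp
qed

lemma homogeneous_prod:
  "(\<And>i. i \<in> S \<Longrightarrow> homogeneous (d i) (f i)) \<Longrightarrow> homogeneous (\<Sum>i\<in>S. d i) (\<Prod>i\<in>S. f i :: 'k::field pol4)"
proof (induction S rule: infinite_finite_induct)
  case (insert x S)
  then show ?case by (simp add: homogeneous_mult)
qed (use homogeneous_const[of 1] in simp_all)

lemma homogeneous_lin_subst:
  assumes "homogeneous d p"
  shows "homogeneous d (lin_subst g p)"
  unfolding lin_subst_def mp_eval_def
proof (intro homogeneous_sum homogeneous_scale)
  fix m assume "m \<in> Poly_Mapping.keys p"
  then have "mdeg m = d" using assms by (simp add: homogeneous_def)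
  moreover have "homogeneous (Poly_Mapping.lookup m i * 1) ((\<Sum>j\<in>UNIV. const (g $ j $ i) * var j) ^ Poly_Mapping.lookup m i)" for i
    by (intro homogeneous_power homogeneous_sum homogeneous_scale homogeneous_var)
  ultimately show "homogeneous d (\<Prod>i\<in>UNIV. (\<Sum>j\<in>UNIV. const (g $ j $ i) * var j) ^ Poly_Mapping.lookup m i)"
    using homogeneous_prod[of UNIV "Poly_Mapping.lookup m" "\<lambda>i. (\<Sum>j\<in>UNIV. const (g $ j $ i) * var j) ^ Poly_Mapping.lookup m i"]
    by simp
qed

definition expo :: "nat \<Rightarrow> nat \<Rightarrow> nat \<Rightarrow> nat \<Rightarrow> (4 \<Rightarrow>\<^sub>0 nat)"
  where "expo a b c d = Poly_Mapping.single 0 a + Poly_Mapping.single 1 b + Poly_Mapping.single 2 c + Poly_Mapping.single 3 d"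

lemma lookup_expo [simp]:
  "Poly_Mapping.lookup (expo a b c d) 0 = a" "Poly_Mapping.lookup (expo a b c d) 1 = b"
  "Poly_Mapping.lookup (expo a b c d) 2 = c" "Poly_Mapping.lookup (expo a b c d) 3 = d"
  by (simp_all add: expo_def lookup_add lookup_single when_def)

lemma expo_eqI:
  "Poly_Mapping.lookup m 0 = Poly_Mapping.lookup n 0 \<Longrightarrow> Poly_Mapping.lookup m 1 = Poly_Mapping.lookup n 1 \<Longrightarrow>
   Poly_Mapping.lookup m 2 = Poly_Mapping.lookup n 2 \<Longrightarrow> Poly_Mapping.lookup m 3 = Poly_Mapping.lookup n 3 \<Longrightarrow>
   m = (n :: 4 \<Rightarrow>\<^sub>0 nat)"
  by (rule poly_mapping_eqI) (metis index_cases)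

lemma expo_lookup: "m = expo (Poly_Mapping.lookup m 0) (Poly_Mapping.lookup m 1) (Poly_Mapping.lookup m 2) (Poly_Mapping.lookup m 3)"
  by (rule expo_eqI) simp_all

lemma expo_cases: obtains a b c d where "m = expo a b c d"
  using expo_lookup by blast

lemma expo_eq_iff [simp]: "expo a b c d = expo a' b' c' d' \<longleftrightarrow> a = a' \<and> b = b' \<and> c = c' \<and> d = d'"
  by (metis lookup_expo)

lemma expo_add: "expo a b c d + expo a' b' c' d' = expo (a + a') (b + b') (c + c') (d + d')"
  by (rule expo_eqI) (simp_all add: lookup_add)

lemma mdeg_expo [simp]: "mdeg (expo a b c d) = a + b + c + d"
  by (simp add: sum_index)

definition mon :: "nat \<Rightarrow> nat \<Rightarrow> nat \<Rightarrow> nat \<Rightarrow> 'k::field pol4"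
  where "mon a b c d = Poly_Mapping.single (expo a b c d) 1"

lemma mon_eq: "mon a b c d = x1 ^ a * x2 ^ b * x3 ^ c * x4 ^ d"
  by (simp add: mon_def single_eq_const_vars prod_index)

lemma mon_mult: "mon a b c d * mon a' b' c' d' = mon (a + a') (b + b') (c + c') (d + d')"
  by (simp add: mon_def mult_single expo_add)

lemma lookup_mon: "Poly_Mapping.lookup (mon a b c d) (expo a' b' c' d') = (if a = a' \<and> b = b' \<and> c = c' \<and> d = d' then 1 else 0)"
  by (simp add: mon_def lookup_single when_def)

lemma homogeneous_mon: "homogeneous (a + b + c + d) (mon a b c d :: 'k::field pol4)"
  by (simp add: homogeneous_def mon_def)

lemma lookup_scale: "Poly_Mapping.lookup (const c * p) m = c * Poly_Mapping.lookup (p :: 'k::field pol4) m"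
proof -
  have "const c * p = Poly_Mapping.map ((*) c) p"
    by (simp add: const_def mult_map_scale_conv_mult)
  then show ?thesis
    by (simp add: Poly_Mapping.map.rep_eq when_def)
qed

lemma poly_sum_mon:
  fixes p :: "'k::field pol4"
  shows "p = (\<Sum>m\<in>Poly_Mapping.keys p. const (Poly_Mapping.lookup p m) * Poly_Mapping.single m 1)"
proof -
  have "const c * Poly_Mapping.single m 1 = Poly_Mapping.single m (c :: 'k)" for c and m :: "4 \<Rightarrow>\<^sub>0 nat"
    by (simp add: const_def mult_single)
  then show ?thesis
    by (simp only: poly_mapping_sum_single[symmetric])
qed

section \<open>Linear forms and quadrics\<close>

definition linform :: "'k::field pol4 \<Rightarrow> bool"
  where "linform p \<longleftrightarrow> (\<exists>a. p = (\<Sum>i\<in>UNIV. const (a i) * var i))"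

lemma linformI: "p = (\<Sum>i\<in>UNIV. const (a i) * var i) \<Longrightarrow> linform p"
  unfolding linform_def by (rule exI)

lemma linform_eq: "linform p \<longleftrightarrow> (\<exists>a b c d. p = const a * x1 + const b * x2 + const c * x3 + const d * x4)"
proof
  assume "linform p"
  then show "\<exists>a b c d. p = const a * x1 + const b * x2 + const c * x3 + const d * x4"
    by (auto simp: linform_def sum_index)
next
  assume "\<exists>a b c d. p = const a * x1 + const b * x2 + const c * x3 + const d * x4"
  then obtain a b c d where p: "p = const a * x1 + const b * x2 + const c * x3 + const d * x4"
    by blast
  show "linform p"
    unfolding linform_def
    by (rule exI[of _ "\<lambda>i. if i = 0 then a else if i = 1 then b else if i = 2 then c else d"])
      (simp add: p sum_index)
qed

lemma linform_var [simp]: "linform (var i)"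
proof -
  have "(\<Sum>j\<in>UNIV. const (if j = i then 1 else 0) * var j) = (\<Sum>j\<in>UNIV. if j = i then var j else 0 :: 'a pol4)"
    by (rule sum.cong) simp_all
  also have "\<dots> = var i" by simp
  finally show ?thesis
    unfolding linform_def by (intro exI[of _ "\<lambda>j. if j = i then 1 else 0"]) simp
qed

lemma linform_add [intro]: "linform p \<Longrightarrow> linform q \<Longrightarrow> linform (p + q)"
proof -
  assume "linform p" "linform q"
  then obtain a b where "p = (\<Sum>i\<in>UNIV. const (a i) * var i)" "q = (\<Sum>i\<in>UNIV. const (b i) * var i)"
    by (auto simp: linform_def)
  then have "p + q = (\<Sum>i\<in>UNIV. const (a i + b i) * var i)"
    by (simp add: const_add distrib_right sum.distrib)
  then show ?thesis by (rule linformI)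
qed

lemma linform_scale [intro]: "linform p \<Longrightarrow> linform (const c * p)"
proof -
  assume "linform p"
  then obtain a where "p = (\<Sum>i\<in>UNIV. const (a i) * var i)"
    by (auto simp: linform_def)
  then have "const c * p = (\<Sum>i\<in>UNIV. const (c * a i) * var i)"
    by (simp add: sum_distrib_left const_mult mult.assoc)
  then show ?thesis by (rule linformI)
qed

lemma homogeneous_linform: "linform p \<Longrightarrow> homogeneous 1 p"
  unfolding linform_def by (auto intro!: homogeneous_sum homogeneous_scale simp del: One_nat_def intro: homogeneous_var)

lemma homogeneous_linform_mult: "linform p \<Longrightarrow> linform q \<Longrightarrow> homogeneous 2 (p * q)"
  using homogeneous_mult[OF homogeneous_linform homogeneous_linform, of p q] by (simp add: numeral_2_eq_2)

lemma ev_linform_add: "linform p \<Longrightarrow> ev p (v + w) = ev p v + ev p w"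
  unfolding linform_def by (auto simp: distrib_left sum.distrib)

lemma ev_linform_scale: "linform p \<Longrightarrow> ev p (c *s v) = c * ev p v"
  unfolding linform_def by (auto simp: sum_distrib_left mult.left_commute)

lemma ev_linform_diff: "linform p \<Longrightarrow> ev p (v - w) = ev p v - ev p w"
  unfolding linform_def by (auto simp: right_diff_distrib sum_subtractf)

lemma linform_of_linear_fun:
  assumes "\<And>v w. \<phi> (v + w) = \<phi> v + \<phi> w" "\<And>c v. \<phi> (c *s v) = c * \<phi> v"
  obtains p where "linform p" "\<And>v. ev p v = \<phi> (v :: 'k::field^4)"
proof -
  let ?p = "\<Sum>i\<in>UNIV. const (\<phi> (axis i 1)) * var i"
  have eq: "\<phi> v = ev ?p v" for v
  proof -
    have "v = v $ 0 *s axis 0 1 + v $ 1 *s axis 1 1 + v $ 2 *s axis 2 1 + v $ 3 *s axis 3 1"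
      unfolding vec_eq_iff all_index by (simp add: axis_def)
    then have "\<phi> v = \<phi> (v $ 0 *s axis 0 1 + v $ 1 *s axis 1 1 + v $ 2 *s axis 2 1 + v $ 3 *s axis 3 1)"
      by simp
    also have "\<dots> = ev ?p v"
      by (simp only: assms ev_simps sum_index) (simp add: mult.commute)
    finally show ?thesis .
  qed
  show thesis
    by (rule that[OF linformI[OF refl] eq[symmetric]])
qed

lemma quadratic_exponents: "a + b + c + d = (2::nat) \<Longrightarrow> 
 (a,b,c,d) = (2,0,0,0) \<or> (a,b,c,d) = (0,2,0,0) \<or> (a,b,c,d) = (0,0,2,0) \<or> (a,b,c,d) = (0,0,0,2) \<or> (a,b,c,d) = (1,1,0,0)
 \<or> (a,b,c,d) = (1,0,1,0) \<or> (a,b,c,d) = (1,0,0,1) \<or> (a,b,c,d) = (0,1,1,0) \<or> (a,b,c,d) = (0,1,0,1) \<or> (a,b,c,d) = (0,0,1,1)"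
proof -
  assume *: "a + b + c + d = 2"
  then have "a \<le> 2" "b \<le> 2" "c \<le> 2" "d = 2 - (a + b + c)" by auto
  with * show ?thesis
    by (simp add: le_Suc_eq numeral_2_eq_2) (elim disjE; simp)
qed
lemma lookup_coeff_mon: fixes p :: "'k::field pol4" shows "Poly_Mapping.lookup (const (Poly_Mapping.lookup p (expo a b c d)) * mon a b c d) (expo a' b' c' d') =
  (if a = a' \<and> b = b' \<and> c = c' \<and> d = d' then Poly_Mapping.lookup p (expo a b c d) else 0)"
by (simp add: lookup_scale lookup_mon)
lemma quadric_expansion:
  assumes "homogeneous 2 (p :: 'k::field pol4)"
  obtains a b c d e f g h i j where
    "p = const a * x1^2 + const b * x2^2 + const c * x3^2 + const d * x4^2
       + const e * (x1 * x2) + const f * (x1 * x3) + const g * (x1 * x4)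
       + const h * (x2 * x3) + const i * (x2 * x4) + const j * (x3 * x4)"
proof -
  let ?l = "\<lambda>a b c d. const (Poly_Mapping.lookup p (expo a b c d)) * mon a b c d :: 'k pol4"
  let ?q = "?l 2 0 0 0 + ?l 0 2 0 0 + ?l 0 0 2 0 + ?l 0 0 0 2 + ?l 1 1 0 0 + ?l 1 0 1 0
    + ?l 1 0 0 1 + ?l 0 1 1 0 + ?l 0 1 0 1 + ?l 0 0 1 1"
  have "p = ?q"
  proof (rule poly_mapping_eqI)
    fix m
    obtain a b c d where m: "m = expo a b c d" by (rule expo_cases)
    show "Poly_Mapping.lookup p m = Poly_Mapping.lookup ?q m"
    proof (cases "a + b + c + d = 2")
      case True
      from quadratic_exponents[OF this] show ?thesis
        unfolding m by (elim disjE) (simp_all only: prod.inject lookup_add lookup_coeff_mon, simp_all)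
    next
      case False
      then have "m \<notin> Poly_Mapping.keys p"
        using assms by (auto simp: homogeneous_def m)
      then have "Poly_Mapping.lookup p m = 0"
        by (simp add: in_keys_iff)
      moreover from False have "Poly_Mapping.lookup (?l a' b' c' d') m = 0" if "a' + b' + c' + d' = 2" for a' b' c' d'
        using that by (auto simp only: m lookup_coeff_mon split: if_splits)
      ultimately show ?thesis
        by (simp add: lookup_add)
    qed
  qed
  then show thesis
    by (intro that) (simp add: mon_eq)
qed

text \<open>The symmetric bilinear form of a quadric, normalised so that for fixed \<open>v\<close> it is the differential
  of the quadric at \<open>v\<close>. A quadric is singular at \<open>v\<close> iff this linear form vanishes.\<close>

definition polar :: "'k::field pol4 \<Rightarrow> 'k^4 \<Rightarrow> 'k^4 \<Rightarrow> 'k"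
  where "polar f v w = ev f (v + w) - ev f v - ev f w"

lemma polar_linear [simp]:
  "polar 0 v w = 0" "polar (p + q) v w = polar p v w + polar q v w"
  "polar (p - q) v w = polar p v w - polar q v w"
  "polar (const c * p) v w = c * polar p v w" "polar (- p) v w = - polar p v w"
  "polar (sum F S) v w = (\<Sum>x\<in>S. polar (F x) v w)"
  by (simp_all add: polar_def algebra_simps sum_subtractf sum.distrib)

lemma polar_mult: "linform x \<Longrightarrow> linform y \<Longrightarrow> polar (x * y) v w = ev x v * ev y w + ev x w * ev y v"
  by (simp add: polar_def ev_linform_add algebra_simps)

lemma polar_square: "linform x \<Longrightarrow> polar (x ^ 2) v w = 2 * (ev x v * ev x w)"
  by (simp add: power2_eq_square polar_mult)

lemma polar_commute: "polar f v w = polar f w v"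
  by (simp add: polar_def add.commute)

lemma polar_bilinear:
  assumes "homogeneous 2 f"
  shows "polar f (u + v) w = polar f u w + polar f v w" "polar f (c *s v) w = c * polar f v w"
    "polar f w (u + v) = polar f w u + polar f w v" "polar f w (c *s v) = c * polar f w v"
proof -
  show "polar f (u + v) w = polar f u w + polar f v w" for u v w
    by (rule quadric_expansion[OF assms]) (simp add: polar_mult polar_square distrib_left distrib_right)
  then show "polar f w (u + v) = polar f w u + polar f w v"
    by (simp only: polar_commute[of f w])
  show "polar f (c *s v) w = c * polar f v w" for c v w
    by (rule quadric_expansion[OF assms]) (simp add: polar_mult polar_square distrib_left distrib_right mult_ac)
  then show "polar f w (c *s v) = c * polar f w v"
    by (simp only: polar_commute[of f w])
qed

lemma polar_self:
  assumes "homogeneous 2 f"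
  shows "polar f v v = 2 * ev f v"
  by (rule quadric_expansion[OF assms]) (simp add: polar_mult polar_square power2_eq_square distrib_left)

lemma quadric_eq_0_iff:
  assumes "homogeneous 2 (f :: 'k::field_char_0 pol4)"
  shows "f = 0 \<longleftrightarrow> (\<forall>v w. polar f v w = 0)"
proof
  assume *: "\<forall>v w. polar f v w = 0"
  obtain a b c d e f' g h i j where f:
    "f = const a * x1^2 + const b * x2^2 + const c * x3^2 + const d * x4^2
       + const e * (x1 * x2) + const f' * (x1 * x3) + const g * (x1 * x4)
       + const h * (x2 * x3) + const i * (x2 * x4) + const j * (x3 * x4)"
    by (rule quadric_expansion[OF assms])
  have p: "polar f (axis r 1) (axis s 1) = 0" for r s
    using * by simp
  note pol = polar_linear polar_mult[OF linform_var linform_var] polar_square[OF linform_var] ev_simps axis_def vec_lambda_beta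
  have "a = 0" using p[of 0 0] unfolding f by (simp add: pol)
  moreover have "b = 0" using p[of 1 1] unfolding f by (simp add: pol)
  moreover have "c = 0" using p[of 2 2] unfolding f by (simp add: pol)
  moreover have "d = 0" using p[of 3 3] unfolding f by (simp add: pol)
  moreover have "e = 0" using p[of 0 1] unfolding f by (simp add: pol)
  moreover have "f' = 0" using p[of 0 2] unfolding f by (simp add: pol)
  moreover have "g = 0" using p[of 0 3] unfolding f by (simp add: pol)
  moreover have "h = 0" using p[of 1 2] unfolding f by (simp add: pol)
  moreover have "i = 0" using p[of 1 3] unfolding f by (simp add: pol)
  moreover have "j = 0" using p[of 2 3] unfolding f by (simp add: pol)
  ultimately show "f = 0"
    unfolding f by simp
qed simp

lemma quadric_eqI:
  assumes "homogeneous 2 f" "homogeneous 2 (g :: 'k::field_char_0 pol4)" "\<And>v. ev f v = ev g v"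
  shows "f = g"
proof -
  have "homogeneous 2 (f - g)" using assms by (intro homogeneous_diff)
  then have "f - g = 0" using assms(3) by (simp add: quadric_eq_0_iff[of "f - g"] polar_def del: right_minus_eq)
  then show ?thesis by simp
qed

subsection \<open>Coordinate systems\<close>

definition ind4 :: "'k::field pol4 \<Rightarrow> 'k pol4 \<Rightarrow> 'k pol4 \<Rightarrow> 'k pol4 \<Rightarrow> bool"
  where "ind4 x y z w \<longleftrightarrow> (\<forall>a b c d. const a * x + const b * y + const c * z + const d * w = 0
    \<longrightarrow> a = 0 \<and> b = 0 \<and> c = 0 \<and> d = 0)"

definition coords :: "'k::field pol4 \<Rightarrow> 'k pol4 \<Rightarrow> 'k pol4 \<Rightarrow> 'k pol4 \<Rightarrow> bool"
  where "coords x y z w \<longleftrightarrow> linform x \<and> linform y \<and> linform z \<and> linform w \<and> ind4 x y z w"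

text \<open>A coordinate system is the image of the variables under an invertible substitution. All arguments
  below choose coordinate systems adapted to a space of quadrics and never mention matrices.\<close>

lemma coords_subst:
  assumes "coords x y z w"
  obtains h where "invertible h" "lin_subst h x1 = x" "lin_subst h x2 = y" "lin_subst h x3 = z" "lin_subst h x4 = w"
proof -
  have lin: "linform x" "linform y" "linform z" "linform w"
    using assms by (simp_all add: coords_def)
  obtain a where a: "x = (\<Sum>i\<in>UNIV. const (a i) * var i)" using lin(1)[unfolded linform_def] ..
  obtain b where b: "y = (\<Sum>i\<in>UNIV. const (b i) * var i)" using lin(2)[unfolded linform_def] ..
  obtain c where c: "z = (\<Sum>i\<in>UNIV. const (c i) * var i)" using lin(3)[unfolded linform_def] ..
  obtain d where d: "w = (\<Sum>i\<in>UNIV. const (d i) * var i)" using lin(4)[unfolded linform_def] ..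
  note l = a b c d
  define h :: "'a^4^4" where "h = (\<chi> j i. if i = 0 then a j else if i = 1 then b j else if i = 2 then c j else d j)"
  have s: "lin_subst h x1 = x" "lin_subst h x2 = y" "lin_subst h x3 = z" "lin_subst h x4 = w"
    by (simp_all add: lin_subst_var h_def l)
  have "v = 0" if "h *v v = 0" for v
  proof -
    have "const (v $ 0) * x + const (v $ 1) * y + const (v $ 2) * z + const (v $ 3) * w
        = (\<Sum>j\<in>UNIV. const ((h *v v) $ j) * var j)"
      by (simp add: l matrix_vector_mult_def h_def sum_index const_add const_mult distrib_left distrib_right mult_ac add_ac)
    also have "\<dots> = 0" using that by simp
    finally have "v $ 0 = 0 \<and> v $ 1 = 0 \<and> v $ 2 = 0 \<and> v $ 3 = 0"
      using assms by (simp add: coords_def ind4_def)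
    then show "v = 0" by (simp add: vec_eq_iff all_index)
  qed
  then have "invertible h"
    by (simp add: invertible_left_inverse matrix_left_invertible_ker)
  then show thesis using that s by blast
qed

lemma coords_point:
  assumes "coords x y z w"
  obtains v where "ev x v = a" "ev y v = b" "ev z v = c" "ev w v = d"
proof -
  obtain h where h: "invertible h" "lin_subst h x1 = x" "lin_subst h x2 = y" "lin_subst h x3 = z" "lin_subst h x4 = w"
    by (rule coords_subst[OF assms])
  obtain k where k: "k ** h = mat 1" using h(1) by (auto simp: invertible_def)
  define u where "u = ((\<chi> i. if i = 0 then a else if i = 1 then b else if i = 2 then c else d) :: 'a^4)"
  have "(u v* k) v* h = u"
    by (simp add: vector_matrix_mul_assoc k)
  then show thesis
    using that[of "u v* k"] by (simp add: h(2-5)[symmetric] ev_lin_subst u_def)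
qed

lemma coords_point_eq:
  assumes "coords x y z w" "ev x v = ev x v'" "ev y v = ev y v'" "ev z v = ev z v'" "ev w v = ev w v'"
  shows "v = v'"
proof -
  obtain h where h: "invertible h" "lin_subst h x1 = x" "lin_subst h x2 = y" "lin_subst h x3 = z" "lin_subst h x4 = w"
    by (rule coords_subst[OF assms(1)])
  obtain k where k: "h ** k = mat 1" using h(1) by (auto simp: invertible_def)
  have "v v* h = v' v* h"
    using assms(2-5) by (simp add: h(2-5)[symmetric] ev_lin_subst vec_eq_iff all_index)
  then have "(v v* h) v* k = (v' v* h) v* k" by simp
  then show ?thesis by (simp add: vector_matrix_mul_assoc k)
qed

lemma coords_linform_expansion:
  assumes "coords x y z w" "linform p"
  obtains a b c d where "p = const a * x + const b * y + const c * z + const d * w"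
proof -
  obtain h where h: "invertible h" "lin_subst h x1 = x" "lin_subst h x2 = y" "lin_subst h x3 = z" "lin_subst h x4 = w"
    by (rule coords_subst[OF assms(1)])
  obtain k where k: "\<And>p. lin_subst h (lin_subst k p) = p"
    using invertible_lin_subst_inverse[OF h(1)] by metis
  have "linform (lin_subst k p)"
  proof -
    from assms(2) obtain a where "p = (\<Sum>i\<in>UNIV. const (a i) * var i)" by (auto simp: linform_def)
    then have "lin_subst k p = (\<Sum>i\<in>UNIV. const (a i) * (\<Sum>j\<in>UNIV. const (k $ j $ i) * var j))"
      by (simp add: lin_subst_var)
    then show ?thesis
      by (simp add: sum_index linform_add linform_scale)
  qed
  then obtain a b c d where "lin_subst k p = const a * x1 + const b * x2 + const c * x3 + const d * x4"
    by (auto simp: linform_eq)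
  then have "p = const a * x + const b * y + const c * z + const d * w"
    using k[of p] by (simp add: h)
  then show thesis by (rule that)
qed

lemma coords_quadric_expansion:
  assumes "coords x y z w" "homogeneous 2 p"
  obtains a b c d e f g h i j where
    "p = const a * x^2 + const b * y^2 + const c * z^2 + const d * w^2
       + const e * (x * y) + const f * (x * z) + const g * (x * w)
       + const h * (y * z) + const i * (y * w) + const j * (z * w)"
proof -
  obtain h where h: "invertible h" "lin_subst h x1 = x" "lin_subst h x2 = y" "lin_subst h x3 = z" "lin_subst h x4 = w"
    by (rule coords_subst[OF assms(1)])
  obtain k where k: "\<And>p. lin_subst h (lin_subst k p) = p"
    using invertible_lin_subst_inverse[OF h(1)] by metis
  have "homogeneous 2 (lin_subst k p)"
    by (rule homogeneous_lin_subst[OF assms(2)])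
  then obtain a b c d e f g h' i j where
    "lin_subst k p = const a * x1^2 + const b * x2^2 + const c * x3^2 + const d * x4^2
       + const e * (x1 * x2) + const f * (x1 * x3) + const g * (x1 * x4)
       + const h' * (x2 * x3) + const i * (x2 * x4) + const j * (x3 * x4)"
    by (rule quadric_expansion)
  then have "p = const a * x^2 + const b * y^2 + const c * z^2 + const d * w^2
       + const e * (x * y) + const f * (x * z) + const g * (x * w)
       + const h' * (y * z) + const i * (y * w) + const j * (z * w)"
    using k[of p] by (simp only: lin_subst_simps h(2-5))
  then show thesis by (rule that)
qed

lemma ind4D: "ind4 x y z w \<Longrightarrow> const a * x + const b * y + const c * z + const d * w = 0 \<Longrightarrow>
    a = 0 \<and> b = 0 \<and> c = 0 \<and> d = 0"
  unfolding ind4_def by blast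

lemma ind4I:
  assumes "\<And>a b c d. const a * x + const b * y + const c * z + const d * w = 0 \<Longrightarrow> a = 0"
    "\<And>a b c d. const a * x + const b * y + const c * z + const d * w = 0 \<Longrightarrow> b = 0"
    "\<And>a b c d. const a * x + const b * y + const c * z + const d * w = 0 \<Longrightarrow> c = 0"
    "\<And>a b c d. const a * x + const b * y + const c * z + const d * w = 0 \<Longrightarrow> d = 0"
  shows "ind4 x y z w"
  unfolding ind4_def using assms by blast

lemma coords_swap12: "coords x y z w \<Longrightarrow> coords y x z w"
  unfolding coords_def
proof (elim conjE, intro conjI ind4I)
  fix a b c d
  assume ind: "ind4 x y z w" and "const a * y + const b * x + const c * z + const d * w = 0"
  then have "const b * x + const a * y + const c * z + const d * w = 0"
    by (simp only: add_ac)
  from ind4D[OF ind this] show "a = 0" "b = 0" "c = 0" "d = 0" by simp_all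
qed

lemma coords_swap23: "coords x y z w \<Longrightarrow> coords x z y w"
  unfolding coords_def
proof (elim conjE, intro conjI ind4I)
  fix a b c d
  assume ind: "ind4 x y z w" and "const a * x + const b * z + const c * y + const d * w = 0"
  then have "const a * x + const c * y + const b * z + const d * w = 0"
    by (simp only: add_ac)
  from ind4D[OF ind this] show "a = 0" "b = 0" "c = 0" "d = 0" by simp_all
qed

lemma coords_swap34: "coords x y z w \<Longrightarrow> coords x y w z"
  unfolding coords_def
proof (elim conjE, intro conjI ind4I)
  fix a b c d
  assume ind: "ind4 x y z w" and "const a * x + const b * y + const c * w + const d * z = 0"
  then have "const a * x + const b * y + const d * z + const c * w = 0"
    by (simp only: add_ac)
  from ind4D[OF ind this] show "a = 0" "b = 0" "c = 0" "d = 0" by simp_all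
qed

text \<open>Every change of coordinates below is a product of permutations and of the following
  block transformation of the first two coordinates.\<close>

lemma coords_change2:
  assumes "coords x y z w" "a * d - b * c \<noteq> 0"
  shows "coords (const a * x + const b * y) (const c * x + const d * y) z w"
proof -
  have "ind4 (const a * x + const b * y) (const c * x + const d * y) z w"
    unfolding ind4_def
  proof (intro allI impI)
    fix r s t u
    assume "const r * (const a * x + const b * y) + const s * (const c * x + const d * y) + const t * z + const u * w = 0"
    then have "const (r * a + s * c) * x + const (r * b + s * d) * y + const t * z + const u * w = 0"
      by (simp add: const_add const_mult algebra_simps)
    then have *: "r * a + s * c = 0" "r * b + s * d = 0" "t = 0" "u = 0"
      using assms(1) by (auto simp: coords_def ind4_def)
    have "r * (a * d - b * c) = d * (r * a + s * c) - c * (r * b + s * d)"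
      "s * (a * d - b * c) = a * (r * b + s * d) - b * (r * a + s * c)"
      by (simp_all add: algebra_simps)
    then have "r * (a * d - b * c) = 0" "s * (a * d - b * c) = 0"
      using *(1,2) by simp_all
    with * assms(2) show "r = 0 \<and> s = 0 \<and> t = 0 \<and> u = 0"
      by (simp only: mult_eq_0_iff simp_thms)
  qed
  then show ?thesis
    using assms(1) by (auto simp: coords_def)
qed

lemma coords_shear:
  assumes "coords x y z w"
  shows "coords x y (z + const a * x + const b * y) w"
proof -
  have "coords x z y w" by (rule coords_swap23[OF assms])
  then have "coords x (z + const a * x) y w"
    using coords_change2[of x z y w 1 1 0 a] by (simp add: add.commute)
  then have "coords y (z + const a * x) x w"
    by (rule coords_swap12[OF coords_swap23[OF coords_swap12]])
  then have "coords y (z + const a * x + const b * y) x w"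
    using coords_change2[of y "z + const a * x" x w 1 1 0 b] by (simp add: add.commute)
  then show ?thesis
    by (meson coords_swap12 coords_swap23)
qed

lemma coords_scale3:
  assumes "coords x y z w" "a \<noteq> 0" "b \<noteq> 0" "c \<noteq> 0"
  shows "coords (const a * x) (const b * y) (const c * z) w"
proof -
  have "coords (const a * x) (const b * y) z w"
    using coords_change2[OF assms(1), of a b 0 0] assms by simp
  then have "coords z (const a * x) (const b * y) w"
    by (meson coords_swap12 coords_swap23)
  then have "coords (const c * z) (const a * x) (const b * y) w"
    using coords_change2[of z "const a * x" "const b * y" w c 1 0 0] assms by simp
  then show ?thesis
    by (meson coords_swap12 coords_swap23)
qed

section \<open>Four independent quadrics\<close>

text \<open>The classification only concerns the space \<open>V\<close> of quadrics in the ideal. Its members are written as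
  combinations of the generators with coefficient vectors, because kernels of matrices will produce
  such vectors.\<close>

locale four_quadrics =
  fixes f :: "4 \<Rightarrow> 'k::{alg_closed_field, field_char_0} pol4"
  assumes hom_f: "homogeneous 2 (f i)"
    and indep: "(\<Sum>i\<in>UNIV. const (c $ i) * f i) = 0 \<Longrightarrow> c = 0"
begin

definition comb :: "'k^4 \<Rightarrow> 'k pol4"
  where "comb c = (\<Sum>i\<in>UNIV. const (c $ i) * f i)"

definition V :: "'k pol4 set"
  where "V = range comb"

lemma comb_add: "comb (a + b) = comb a + comb b"
  by (simp add: comb_def const_add distrib_right sum.distrib)

lemma comb_scale: "comb (r *s a) = const r * comb a"
  by (simp add: comb_def const_mult sum_distrib_left mult.assoc)

lemma comb_eq_0_iff: "comb c = 0 \<longleftrightarrow> c = 0"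
  using indep by (auto simp: comb_def)

lemma comb_in_V [intro]: "comb c \<in> V"
  by (simp add: V_def)

lemma V_0 [intro]: "0 \<in> V"
  unfolding V_def by (rule image_eqI[of _ _ 0]) (simp_all add: comb_eq_0_iff)

lemma V_add [intro]: "p \<in> V \<Longrightarrow> q \<in> V \<Longrightarrow> p + q \<in> V"
  unfolding V_def by (elim imageE, simp only: comb_add[symmetric] rangeI)

lemma V_scale [intro]: "p \<in> V \<Longrightarrow> const c * p \<in> V"
  unfolding V_def by (elim imageE, simp only: comb_scale[symmetric] rangeI)

lemma V_uminus [intro]: "p \<in> V \<Longrightarrow> - p \<in> V"
  using V_scale[of p "- 1"] by (simp add: const_uminus)

lemma V_diff [intro]: "p \<in> V \<Longrightarrow> q \<in> V \<Longrightarrow> p - q \<in> V"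
  using V_add[of p "- q"] V_uminus[of q] by simp

lemma V_scale_iff: "c \<noteq> 0 \<Longrightarrow> const c * p \<in> V \<longleftrightarrow> p \<in> V"
proof
  assume "c \<noteq> 0" "const c * p \<in> V"
  then have "const (inverse c) * (const c * p) \<in> V" by blast
  then show "p \<in> V"
    using \<open>c \<noteq> 0\<close> by (simp add: mult.assoc[symmetric] const_mult[symmetric])
qed blast

lemma hom_V: "p \<in> V \<Longrightarrow> homogeneous 2 p"
  unfolding V_def comb_def by (auto intro!: homogeneous_sum homogeneous_scale hom_f)

lemma V_spanned:
  assumes q: "q1 \<in> V" "q2 \<in> V" "q3 \<in> V" "q4 \<in> V" and ind: "ind4 q1 q2 q3 q4" and "p \<in> V"
  obtains a b c d where "p = const a * q1 + const b * q2 + const c * q3 + const d * q4"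
proof -
  from q obtain c1 c2 c3 c4 where c: "q1 = comb c1" "q2 = comb c2" "q3 = comb c3" "q4 = comb c4"
    by (auto simp: V_def)
  define h :: "'k^4^4" where "h = (\<chi> j i. if i = 0 then c1 $ j else if i = 1 then c2 $ j else if i = 2 then c3 $ j else c4 $ j)"
  have h: "h *v v = v $ 0 *s c1 + v $ 1 *s c2 + v $ 2 *s c3 + v $ 3 *s c4" for v
    by (simp add: vec_eq_iff matrix_vector_mult_def h_def sum_index mult.commute)
  have comb_h: "comb (h *v v) = const (v $ 0) * q1 + const (v $ 1) * q2 + const (v $ 2) * q3 + const (v $ 3) * q4" for v
    by (simp only: h comb_add comb_scale c)
  have "v = 0" if "h *v v = 0" for v
  proof -
    have "const (v $ 0) * q1 + const (v $ 1) * q2 + const (v $ 2) * q3 + const (v $ 3) * q4 = 0"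
      unfolding comb_h[symmetric] that by (simp add: comb_eq_0_iff)
    from ind4D[OF ind this] show ?thesis
      by (simp add: vec_eq_iff all_index)
  qed
  then have "invertible h"
    by (simp add: invertible_left_inverse matrix_left_invertible_ker)
  then obtain k where k: "h ** k = mat 1"
    by (auto simp: invertible_def)
  from \<open>p \<in> V\<close> obtain v where v: "p = comb v" by (auto simp: V_def)
  have "h *v (k *v v) = v"
    by (simp add: matrix_vector_mul_assoc k)
  then have "p = comb (h *v (k *v v))"
    by (simp add: v)
  then show thesis
    unfolding comb_h by (rule that)
qed

definition I :: "'k pol4 set"
  where "I = ideal_gen (range f)"

lemma f_in_V: "f i \<in> V"
proof -
  have "f i = comb (axis i 1)"
    by (rule index_cases[of i]) (simp_all add: comb_def sum_index axis_def)
  then show ?thesis by auto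
qed

lemma V_subset_I: "V \<subseteq> I"
  unfolding V_def comb_def I_def by (clarify, intro ideal_gen_sum ideal_gen_mult ideal_gen_base) simp

lemma I_eq_ideal_gen:
  assumes "q1 \<in> V" "q2 \<in> V" "q3 \<in> V" "q4 \<in> V" "ind4 q1 q2 q3 q4"
  shows "I = ideal_gen {q1, q2, q3, q4}"
  unfolding I_def
proof (rule ideal_gen_eqI)
  show "range f \<subseteq> ideal_gen {q1, q2, q3, q4}"
  proof clarify
    fix i
    obtain a b c d where "f i = const a * q1 + const b * q2 + const c * q3 + const d * q4"
      by (rule V_spanned[OF assms f_in_V])
    then show "f i \<in> ideal_gen {q1, q2, q3, q4}"
      by (simp add: ideal_gen_add ideal_gen_mult ideal_gen_base)
  qed
  show "{q1, q2, q3, q4} \<subseteq> ideal_gen (range f)"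
    using assms V_subset_I by (auto simp: I_def)
qed

text \<open>Four independent quadrics in $V$ generate the ideal, so recognising a normal form only requires
  coordinates in which its generators lie in $V$.\<close>

lemma lin_equiv_I:
  assumes "coords x y z w" "ind4 g1 g2 g3 g4"
    and mem: "\<And>h. lin_subst h x1 = x \<Longrightarrow> lin_subst h x2 = y \<Longrightarrow> lin_subst h x3 = z \<Longrightarrow> lin_subst h x4 = w \<Longrightarrow>
      lin_subst h g1 \<in> V \<and> lin_subst h g2 \<in> V \<and> lin_subst h g3 \<in> V \<and> lin_subst h g4 \<in> V"
  shows "lin_equiv I (ideal_gen {g1, g2, g3, g4})"
proof -
  obtain h where h: "invertible h" "lin_subst h x1 = x" "lin_subst h x2 = y" "lin_subst h x3 = z" "lin_subst h x4 = w"
    by (rule coords_subst[OF assms(1)])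
  obtain k where k: "invertible k" "\<And>p. lin_subst h (lin_subst k p) = p" "\<And>p. lin_subst k (lin_subst h p) = p"
    using invertible_lin_subst_inverse[OF h(1)] by metis
  have "ind4 (lin_subst h g1) (lin_subst h g2) (lin_subst h g3) (lin_subst h g4)"
    unfolding ind4_def
  proof (intro allI impI)
    fix a b c d
    assume "const a * lin_subst h g1 + const b * lin_subst h g2 + const c * lin_subst h g3 + const d * lin_subst h g4 = 0"
    then have "lin_subst k (lin_subst h (const a * g1 + const b * g2 + const c * g3 + const d * g4)) = 0"
      by simp
    then show "a = 0 \<and> b = 0 \<and> c = 0 \<and> d = 0"
      unfolding k(3) by (rule ind4D[OF assms(2)])
  qed
  then have "I = ideal_gen (lin_subst h ` {g1, g2, g3, g4})"
    using I_eq_ideal_gen mem[OF h(2-5)] by simp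
  also have "\<dots> = gl_image h (ideal_gen {g1, g2, g3, g4})"
    by (rule lin_subst_ideal_gen[OF h(1), symmetric])
  finally have "gl_image k I = ideal_gen {g1, g2, g3, g4}"
    by (simp add: gl_image_def image_comp o_def k(3))
  then show ?thesis
    using k(1) by (auto simp: lin_equiv_def)
qed

end

lemma ind4_private_monomials:
  assumes "Poly_Mapping.lookup q1 m1 \<noteq> 0" "Poly_Mapping.lookup q2 m1 = 0" "Poly_Mapping.lookup q3 m1 = 0" "Poly_Mapping.lookup q4 m1 = 0"
    and "Poly_Mapping.lookup q2 m2 \<noteq> 0" "Poly_Mapping.lookup q1 m2 = 0" "Poly_Mapping.lookup q3 m2 = 0" "Poly_Mapping.lookup q4 m2 = 0"
    and "Poly_Mapping.lookup q3 m3 \<noteq> 0" "Poly_Mapping.lookup q1 m3 = 0" "Poly_Mapping.lookup q2 m3 = 0" "Poly_Mapping.lookup q4 m3 = 0"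
    and "Poly_Mapping.lookup q4 m4 \<noteq> 0" "Poly_Mapping.lookup q1 m4 = 0" "Poly_Mapping.lookup q2 m4 = 0" "Poly_Mapping.lookup q3 m4 = 0"
  shows "ind4 q1 q2 q3 (q4 :: 'k::field pol4)"
  unfolding ind4_def
proof (intro allI impI)
  fix a b c d
  assume "const a * q1 + const b * q2 + const c * q3 + const d * q4 = 0"
  then have "a * Poly_Mapping.lookup q1 m + b * Poly_Mapping.lookup q2 m + c * Poly_Mapping.lookup q3 m + d * Poly_Mapping.lookup q4 m = 0" for m
    by (metis lookup_add lookup_scale lookup_zero)
  from this[of m1] this[of m2] this[of m3] this[of m4] show "a = 0 \<and> b = 0 \<and> c = 0 \<and> d = 0"
    using assms by simp
qed

lemma quadratic_mon:
  "x1^2 = mon 2 0 0 0" "x2^2 = mon 0 2 0 0" "x3^2 = mon 0 0 2 0" "x4^2 = mon 0 0 0 2"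
  "x1 * x2 = mon 1 1 0 0" "x1 * x3 = mon 1 0 1 0" "x1 * x4 = mon 1 0 0 1"
  "x2 * x3 = mon 0 1 1 0" "x2 * x4 = mon 0 1 0 1" "x3 * x4 = mon 0 0 1 1"
  by (simp_all add: mon_eq)

text \<open>In each of the following lists the four exponents name a monomial that occurs in only one of
  the four forms.\<close>

lemma ind4_i: "ind4 (x1 * x3) (x1 * x4) (x2 * x3) (x2 * x4 :: 'k::field pol4)"
  by (rule ind4_private_monomials[of _ "expo 1 0 1 0" _ _ _ "expo 1 0 0 1" "expo 0 1 1 0" "expo 0 1 0 1"])
    (simp_all add: quadratic_mon lookup_mon lookup_add lookup_minus)

lemma ind4_ii: "ind4 (x1^2) (x2^2) (x3^2) (x1 * x2 + x1 * x3 + x2 * x3 :: 'k::field pol4)"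
  by (rule ind4_private_monomials[of _ "expo 2 0 0 0" _ _ _ "expo 0 2 0 0" "expo 0 0 2 0" "expo 1 1 0 0"])
    (simp_all add: quadratic_mon lookup_mon lookup_add lookup_minus)

lemma ind4_iii: "ind4 (x1^2) (x2^2) (x3^2) (x1 * x3 + x2 * x3 :: 'k::field pol4)"
  by (rule ind4_private_monomials[of _ "expo 2 0 0 0" _ _ _ "expo 0 2 0 0" "expo 0 0 2 0" "expo 1 0 1 0"])
    (simp_all add: quadratic_mon lookup_mon lookup_add lookup_minus)

lemma ind4_iv: "ind4 (x1^2) (x1 * x2) (x1 * x3 - x2^2) (x3^2 :: 'k::field pol4)"
  by (rule ind4_private_monomials[of _ "expo 2 0 0 0" _ _ _ "expo 1 1 0 0" "expo 1 0 1 0" "expo 0 0 2 0"])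
    (simp_all add: quadratic_mon lookup_mon lookup_add lookup_minus)

lemma ind4_v: "ind4 (x1^2) (x1 * x2) (x1 * x3 - x2^2) (x2 * x3 :: 'k::field pol4)"
  by (rule ind4_private_monomials[of _ "expo 2 0 0 0" _ _ _ "expo 1 1 0 0" "expo 1 0 1 0" "expo 0 1 1 0"])
    (simp_all add: quadratic_mon lookup_mon lookup_add lookup_minus)

lemma ind4_vi: "ind4 (x1^2) (x1 * x3) (x2^2) (x2 * x3 :: 'k::field pol4)"
  by (rule ind4_private_monomials[of _ "expo 2 0 0 0" _ _ _ "expo 1 0 1 0" "expo 0 2 0 0" "expo 0 1 1 0"])
    (simp_all add: quadratic_mon lookup_mon lookup_add lookup_minus)

lemma ind4_vii: "ind4 (x1^2) (x1 * x2) (x1 * x3) (x2 * x3 :: 'k::field pol4)"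
  by (rule ind4_private_monomials[of _ "expo 2 0 0 0" _ _ _ "expo 1 1 0 0" "expo 1 0 1 0" "expo 0 1 1 0"])
    (simp_all add: quadratic_mon lookup_mon lookup_add lookup_minus)

lemma ind4_viii_xy: "ind4 (x1^2) (x1 * x2) (x2^2) (x3 * x4 :: 'k::field pol4)"
  by (rule ind4_private_monomials[of _ "expo 2 0 0 0" _ _ _ "expo 1 1 0 0" "expo 0 2 0 0" "expo 0 0 1 1"])
    (simp_all add: quadratic_mon lookup_mon lookup_add lookup_minus)

lemma ind4_viii_cone: "ind4 (x1^2) (x1 * x2) (x2^2) (x3^2 + x2 * x4 :: 'k::field pol4)"
  by (rule ind4_private_monomials[of _ "expo 2 0 0 0" _ _ _ "expo 1 1 0 0" "expo 0 2 0 0" "expo 0 0 2 0"])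
    (simp_all add: quadratic_mon lookup_mon lookup_add lookup_minus)

lemma ind4_viii_sq: "ind4 (x1^2) (x1 * x2) (x2^2) (x3^2 :: 'k::field pol4)"
  by (rule ind4_private_monomials[of _ "expo 2 0 0 0" _ _ _ "expo 1 1 0 0" "expo 0 2 0 0" "expo 0 0 2 0"])
    (simp_all add: quadratic_mon lookup_mon lookup_add lookup_minus)

lemma ind4_ix: "ind4 (x1^2) (x1 * x2) (x2^2) (x1 * x4 - x2 * x3 :: 'k::field pol4)"
  by (rule ind4_private_monomials[of _ "expo 2 0 0 0" _ _ _ "expo 1 1 0 0" "expo 0 2 0 0" "expo 1 0 0 1"])
    (simp_all add: quadratic_mon lookup_mon lookup_add lookup_minus)

lemma ind4_x: "ind4 (x1^2) (x1 * x2) (x2^2) (x1 * x3 :: 'k::field pol4)"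
  by (rule ind4_private_monomials[of _ "expo 2 0 0 0" _ _ _ "expo 1 1 0 0" "expo 0 2 0 0" "expo 1 0 1 0"])
    (simp_all add: quadratic_mon lookup_mon lookup_add lookup_minus)

context four_quadrics
begin

lemma equiv_i:
  assumes "coords x y z w" "x * z \<in> V" "x * w \<in> V" "y * z \<in> V" "y * w \<in> V"
  shows "lin_equiv I ideal_i"
  unfolding ideal_i_def
  by (rule lin_equiv_I[OF assms(1) ind4_i]) (simp add: assms)

lemma equiv_ii:
  assumes "coords x y z w" "x^2 \<in> V" "y^2 \<in> V" "z^2 \<in> V" "x * y + x * z + y * z \<in> V"
  shows "lin_equiv I ideal_ii"
  unfolding ideal_ii_def
  by (rule lin_equiv_I[OF assms(1) ind4_ii]) (simp add: assms)

lemma equiv_iii: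
  assumes "coords x y z w" "x^2 \<in> V" "y^2 \<in> V" "z^2 \<in> V" "x * z + y * z \<in> V"
  shows "lin_equiv I ideal_iii"
  unfolding ideal_iii_def
  by (rule lin_equiv_I[OF assms(1) ind4_iii]) (simp add: assms)

lemma equiv_iv:
  assumes "coords x y z w" "x^2 \<in> V" "x * y \<in> V" "x * z - y^2 \<in> V" "z^2 \<in> V"
  shows "lin_equiv I ideal_iv"
  unfolding ideal_iv_def
  by (rule lin_equiv_I[OF assms(1) ind4_iv]) (simp add: assms)

lemma equiv_v:
  assumes "coords x y z w" "x^2 \<in> V" "x * y \<in> V" "x * z - y^2 \<in> V" "y * z \<in> V"
  shows "lin_equiv I ideal_v"
  unfolding ideal_v_def
  by (rule lin_equiv_I[OF assms(1) ind4_v]) (simp add: assms)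

lemma equiv_vi:
  assumes "coords x y z w" "x^2 \<in> V" "x * z \<in> V" "y^2 \<in> V" "y * z \<in> V"
  shows "lin_equiv I ideal_vi"
  unfolding ideal_vi_def
  by (rule lin_equiv_I[OF assms(1) ind4_vi]) (simp add: assms)

lemma equiv_vii:
  assumes "coords x y z w" "x^2 \<in> V" "x * y \<in> V" "x * z \<in> V" "y * z \<in> V"
  shows "lin_equiv I ideal_vii"
  unfolding ideal_vii_def
  by (rule lin_equiv_I[OF assms(1) ind4_vii]) (simp add: assms)

lemma equiv_viii_xy:
  assumes "coords x y z w" "x^2 \<in> V" "x * y \<in> V" "y^2 \<in> V" "z * w \<in> V"
  shows "lin_equiv I (ideal_viii (x3 * x4))"
  unfolding ideal_viii_def
  by (rule lin_equiv_I[OF assms(1) ind4_viii_xy]) (simp add: assms)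

lemma equiv_viii_cone:
  assumes "coords x y z w" "x^2 \<in> V" "x * y \<in> V" "y^2 \<in> V" "z^2 + y * w \<in> V"
  shows "lin_equiv I (ideal_viii (x3^2 + x2 * x4))"
  unfolding ideal_viii_def
  by (rule lin_equiv_I[OF assms(1) ind4_viii_cone]) (simp add: assms)

lemma equiv_viii_sq:
  assumes "coords x y z w" "x^2 \<in> V" "x * y \<in> V" "y^2 \<in> V" "z^2 \<in> V"
  shows "lin_equiv I (ideal_viii (x3^2))"
  unfolding ideal_viii_def
  by (rule lin_equiv_I[OF assms(1) ind4_viii_sq]) (simp add: assms)

lemma equiv_ix:
  assumes "coords x y z w" "x^2 \<in> V" "x * y \<in> V" "y^2 \<in> V" "x * w - y * z \<in> V"
  shows "lin_equiv I ideal_ix"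
  unfolding ideal_ix_def
  by (rule lin_equiv_I[OF assms(1) ind4_ix]) (simp add: assms)

lemma equiv_x:
  assumes "coords x y z w" "x^2 \<in> V" "x * y \<in> V" "y^2 \<in> V" "x * z \<in> V"
  shows "lin_equiv I ideal_x"
  unfolding ideal_x_def
  by (rule lin_equiv_I[OF assms(1) ind4_x]) (simp add: assms)

end

section \<open>Spaces containing a double line or lying in three variables\<close>

subsection \<open>Binary forms\<close>

lemma quadratic_root:
  assumes "a \<noteq> (0::'k::alg_closed_field)"
  obtains t where "a * t^2 + b * t + c = 0"
proof -
  have "\<exists>t. (\<Sum>k\<le>2. (\<lambda>k. if k = 0 then c else if k = 1 then b else a) k * t ^ k) = 0"
    using assms by (intro alg_closed) simp_all
  then show thesis
    using that by (auto simp: numeral_2_eq_2 algebra_simps)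
qed

lemma cubic_root:
  assumes "a \<noteq> (0::'k::alg_closed_field)"
  obtains t where "a * t^3 + b * t^2 + c * t + d = 0"
proof -
  have "\<exists>t. (\<Sum>k\<le>3. (\<lambda>k. if k = 0 then d else if k = 1 then c else if k = 2 then b else a) k * t ^ k) = 0"
    using assms by (intro alg_closed) simp_all
  then show thesis
    using that by (auto simp: numeral_3_eq_3 numeral_2_eq_2 algebra_simps)
qed

lemma binary_form_factors:
  fixes a b c :: "'k::alg_closed_field"
  obtains p q r s where "p * r = a" "p * s + q * r = b" "q * s = c"
proof (cases "a = 0")
  case True
  then show thesis using that[of 0 b c 1] by simp
next
  case False
  then obtain t where t: "a * t^2 + b * t + c = 0" by (rule quadratic_root)
  have c: "c = - a * t^2 - b * t"
    using t by (simp add: algebra_simps eq_neg_iff_add_eq_0)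
  show thesis
    by (rule that[of a 1 "b / a + t" "- a * t"])
      (use False in \<open>simp_all add: c field_simps power2_eq_square\<close>)
qed

text \<open>Over an algebraically closed field a nonzero binary quadratic form is a product of two linear
  forms. If these are proportional, it is a multiple of a square.\<close>

lemma binary_form_cases:
  fixes a b c :: "'k::alg_closed_field"
  assumes "a \<noteq> 0 \<or> b \<noteq> 0 \<or> c \<noteq> 0"
  obtains (product) p q r s where "p * s - q * r \<noteq> 0" "a = p * r" "b = p * s + q * r" "c = q * s"
  | (square) k p q where "k \<noteq> 0" "p \<noteq> 0 \<or> q \<noteq> 0" "a = k * p^2" "b = 2 * k * p * q" "c = k * q^2"
proof -
  obtain p q r s where f: "p * r = a" "p * s + q * r = b" "q * s = c"
    by (rule binary_form_factors)
  show thesis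
  proof (cases "p * s - q * r = 0")
    case False
    then show thesis using product f by metis
  next
    case True
    have nz: "p \<noteq> 0 \<or> q \<noteq> 0" "r \<noteq> 0 \<or> s \<noteq> 0"
      using assms f by auto
    show thesis
    proof (cases "p = 0")
      case True': True
      with True nz have "q \<noteq> 0" "r = 0" "s \<noteq> 0" by auto
      with True' f show thesis
        by (intro square[of "s / q" 0 q]) (auto simp: power2_eq_square)
    next
      case False
      have s: "s = q * r / p" using True False by (simp add: field_simps)
      with nz have "r \<noteq> 0" by auto
      with False s show thesis
        by (intro square[of "r / p" p q]) (auto simp: f[symmetric] power2_eq_square field_simps)
    qed
  qed
qed

lemma binary_form_zero:
  fixes a b c :: "'k::alg_closed_field"
  obtains p q where "p \<noteq> 0 \<or> q \<noteq> 0" "a * p^2 + b * (p * q) + c * q^2 = 0"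
proof (cases "a = 0")
  case True
  then show thesis using that[of 1 0] by simp
next
  case False
  then obtain t where "a * t^2 + b * t + c = 0" by (rule quadratic_root)
  then show thesis using that[of t 1] by simp
qed

lemma solve_linear2:
  fixes f g :: "'k::field"
  assumes "r * u - s * t \<noteq> 0"
  obtains a b where "f = a * r + b * t" "g = a * s + b * u"
proof -
  have "f * (r * u - s * t) = (f * u - g * t) * r + (g * r - f * s) * t"
    "g * (r * u - s * t) = (f * u - g * t) * s + (g * r - f * s) * u"
    by (simp_all add: algebra_simps)
  then show thesis
    using assms by (intro that[of "(f * u - g * t) / (r * u - s * t)" "(g * r - f * s) / (r * u - s * t)"])
      (simp_all add: add_divide_distrib[symmetric] eq_divide_eq del: right_minus_eq)
qed

lemma complete_to_invertible2:
  fixes p q :: "'k::field"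
  assumes "p \<noteq> 0 \<or> q \<noteq> 0"
  obtains r s where "p * s - q * r \<noteq> 0"
  using that[of 1 0] that[of 0 1] assms by auto

lemma coords_change34:
  assumes "coords x y z w" "a * d - b * c \<noteq> 0"
  shows "coords x y (const a * z + const b * w) (const c * z + const d * w)"
proof -
  have "coords z w x y"
    by (rule coords_swap23[OF coords_swap12[OF coords_swap34[OF coords_swap23[OF assms(1)]]]])
  then have "coords (const a * z + const b * w) (const c * z + const d * w) x y"
    using assms(2) by (rule coords_change2)
  then show ?thesis
    by (meson coords_swap12 coords_swap23 coords_swap34)
qed

lemma coords_change23:
  assumes "coords x y z w" "a * d - b * c \<noteq> 0"
  shows "coords x (const a * y + const b * z) (const c * y + const d * z) w"
proof -
  have "coords y z x w"
    by (rule coords_swap23[OF coords_swap12[OF assms(1)]])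
  then have "coords (const a * y + const b * z) (const c * y + const d * z) x w"
    using assms(2) by (rule coords_change2)
  then show ?thesis
    by (meson coords_swap12 coords_swap23)
qed

lemmas ring_simps = const_simps power2_eq_square algebra_simps

context four_quadrics
begin

definition classified :: bool
  where "classified \<longleftrightarrow>
    lin_equiv I ideal_i \<or> lin_equiv I ideal_ii \<or> lin_equiv I ideal_iii \<or>
    lin_equiv I ideal_iv \<or> lin_equiv I ideal_v \<or> lin_equiv I ideal_vi \<or>
    lin_equiv I ideal_vii \<or>
    (\<exists>q\<in>{x3 * x4, x3^2 + x2 * x4, x3^2}. lin_equiv I (ideal_viii q)) \<or>
    lin_equiv I ideal_ix \<or> lin_equiv I ideal_x"

lemma classifiedI:
  "lin_equiv I ideal_i \<Longrightarrow> classified" "lin_equiv I ideal_ii \<Longrightarrow> classified"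
  "lin_equiv I ideal_iii \<Longrightarrow> classified" "lin_equiv I ideal_iv \<Longrightarrow> classified"
  "lin_equiv I ideal_v \<Longrightarrow> classified" "lin_equiv I ideal_vi \<Longrightarrow> classified"
  "lin_equiv I ideal_vii \<Longrightarrow> classified" "lin_equiv I (ideal_viii (x3 * x4)) \<Longrightarrow> classified"
  "lin_equiv I (ideal_viii (x3^2 + x2 * x4)) \<Longrightarrow> classified" "lin_equiv I (ideal_viii (x3^2)) \<Longrightarrow> classified"
  "lin_equiv I ideal_ix \<Longrightarrow> classified" "lin_equiv I ideal_x \<Longrightarrow> classified"
  by (simp_all add: classified_def)

lemma V_combination:
  "p \<in> V \<Longrightarrow> q \<in> V \<Longrightarrow> r \<in> V \<Longrightarrow> const a * p + const b * q + const c * r \<in> V"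
  by (intro V_add V_scale)

subsection \<open>A pencil of squares in the space\<close>

lemma V_extend_three:
  assumes q: "q1 \<in> V" "q2 \<in> V" "q3 \<in> V"
    and ind: "\<And>a b c. const a * q1 + const b * q2 + const c * q3 = 0 \<Longrightarrow> a = 0 \<and> b = 0 \<and> c = 0"
  obtains p where "p \<in> V" "ind4 q1 q2 q3 p"
proof -
  from q obtain c1 c2 c3 where c: "q1 = comb c1" "q2 = comb c2" "q3 = comb c3"
    by (auto simp: V_def)
  have "vec.dim {c1, c2, c3} \<le> card {c1, c2, c3}"
    by (rule vec.dim_le_card) (auto intro: vec.span_base)
  also have "\<dots> < 4"
    by (rule le_less_trans[OF card_insert_le_m1[of 3]]) (auto intro: card_insert_le_m1)
  finally have "vec.dim {c1, c2, c3} < 4" .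
  moreover have "vec.dim (UNIV :: ('k^4) set) = 4"
    unfolding vec_dim_card by simp
  ultimately have "vec.span {c1, c2, c3} \<noteq> UNIV"
    by (metis vec.dim_span less_irrefl)
  then obtain e where e: "e \<notin> vec.span {c1, c2, c3}" by auto
  have "ind4 q1 q2 q3 (comb e)"
    unfolding ind4_def
  proof (intro allI impI)
    fix r s t u
    assume *: "const r * q1 + const s * q2 + const t * q3 + const u * comb e = 0"
    then have "comb (r *s c1 + s *s c2 + t *s c3 + u *s e) = 0"
      by (simp only: comb_add comb_scale c)
    then have z: "r *s c1 + s *s c2 + t *s c3 + u *s e = 0"
      by (simp only: comb_eq_0_iff)
    have "u = 0"
    proof (rule ccontr)
      assume "u \<noteq> 0"
      have "u *s e = - (r *s c1 + s *s c2 + t *s c3)"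
        using z by (metis add.commute eq_neg_iff_add_eq_0)
      then have "e = (- inverse u) *s (r *s c1 + s *s c2 + t *s c3)"
        using \<open>u \<noteq> 0\<close> by (metis (no_types, lifting) left_inverse vector_smult_assoc vector_smult_lid vector_sneg_minus1 vector_scalar_commute mult.commute mult_minus1)
      moreover have "(- inverse u) *s (r *s c1 + s *s c2 + t *s c3) \<in> vec.span {c1, c2, c3}"
        by (intro vec.span_scale vec.span_add vec.span_base) auto
      ultimately show False using e by simp
    qed
    with * ind show "r = 0 \<and> s = 0 \<and> t = 0 \<and> u = 0" by simp
  qed
  then show thesis using that by blast
qed

text \<open>Here the quadrics are reduced modulo $(x,y)^2$: completing the product or the square in
  the part that involves only $z$ and $w$ absorbs most of the terms that are linear in $x$ and $y$.\<close>

lemma double_line_rank2: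
  assumes co: "coords x y z w" and sq: "x^2 \<in> V" "x * y \<in> V" "y^2 \<in> V"
    and q: "z * w + x * (const a * z + const b * w) + y * (const c * z + const d * w) \<in> V" (is "?q \<in> V")
  shows classified
proof -
  let ?z = "z + const b * x + const d * y" and ?w = "w + const a * x + const c * y"
  have "coords x y ?z ?w"
    by (rule coords_swap34[OF coords_shear[OF coords_swap34[OF coords_shear[OF co]]]])
  moreover have "?z * ?w = ?q + const (a * b) * x^2 + const (b * c + a * d) * (x * y) + const (c * d) * y^2"
    by (simp add: ring_simps)
  then have "?z * ?w \<in> V"
    using sq q by (auto intro!: V_add V_scale)
  ultimately show ?thesis
    using sq by (intro classifiedI equiv_viii_xy)
qed

lemma double_line_rank1:
  assumes co: "coords x y z w" and sq: "x^2 \<in> V" "x * y \<in> V" "y^2 \<in> V"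
    and q: "z^2 + x * (const a * z + const b * w) + y * (const c * z + const d * w) \<in> V" (is "?q \<in> V")
  shows classified
proof -
  define a' c' where "a' = a / 2" and "c' = c / 2"
  have ac: "a = 2 * a'" "c = 2 * c'" by (simp_all add: a'_def c'_def)
  let ?z = "z + const a' * x + const c' * y"
  have co1: "coords x y ?z w" by (rule coords_shear[OF co])
  have "?z^2 + (const b * x + const d * y) * w = ?q + const (a' * a') * x^2 + const (2 * a' * c') * (x * y) + const (c' * c') * y^2"
    by (simp add: ac ring_simps)
  then have q1: "?z^2 + (const b * x + const d * y) * w \<in> V"
    using sq q by (auto intro!: V_add V_scale)
  show ?thesis
  proof (cases "b = 0 \<and> d = 0")
    case True
    with q1 have "?z^2 \<in> V" by simp
    then show ?thesis
      using co1 sq by (intro classifiedI equiv_viii_sq)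
  next
    case False
    then obtain r s where det: "b * s - d * r \<noteq> 0"
      using complete_to_invertible2[of b d] by blast
    let ?x = "const r * x + const s * y" and ?y = "const b * x + const d * y"
    have "coords ?x ?y ?z w"
      using coords_swap12[OF coords_change2[OF co1 det]] .
    moreover have "?x^2 = const (r * r) * x^2 + const (2 * r * s) * (x * y) + const (s * s) * y^2"
      "?x * ?y = const (r * b) * x^2 + const (r * d + s * b) * (x * y) + const (s * d) * y^2"
      "?y^2 = const (b * b) * x^2 + const (2 * b * d) * (x * y) + const (d * d) * y^2"
      by (simp_all add: ring_simps)
    then have "?x^2 \<in> V" "?x * ?y \<in> V" "?y^2 \<in> V"
      using V_combination[OF sq] by simp_all
    ultimately show ?thesis
      using q1 by (intro classifiedI equiv_viii_cone)
  qed
qed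

lemma double_line_rank0:
  assumes co: "coords x y z w" and sq: "x^2 \<in> V" "x * y \<in> V" "y^2 \<in> V"
    and q: "x * (const a * z + const b * w) + y * (const c * z + const d * w) \<in> V" (is "?q \<in> V")
    and nz: "a \<noteq> 0 \<or> b \<noteq> 0"
  shows classified
proof (cases "a * d - b * c = 0")
  case False
  have co': "coords x y (const (-c) * z + const (-d) * w) (const a * z + const b * w)"
    by (rule coords_change34[OF co]) (use False in \<open>simp add: algebra_simps\<close>)
  have eq: "x * (const a * z + const b * w) - y * (const (-c) * z + const (-d) * w) = ?q"
    by (simp add: ring_simps)
  have "lin_equiv I ideal_ix"
    by (rule equiv_ix[OF co' sq]) (subst eq, rule q)
  then show ?thesis by (rule classifiedI)
next
  case True
  obtain t where t: "c = t * a" "d = t * b"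
  proof (cases "a = 0")
    case True': True
    with True nz have "c = 0" "b \<noteq> 0" by auto
    with True' show thesis using that[of "d / b"] by simp
  next
    case False
    with True show thesis using that[of "c / a"] by (simp add: field_simps)
  qed
  from nz obtain r s where det: "a * s - b * r \<noteq> 0"
    using complete_to_invertible2[of a b] by blast
  have "coords (const 1 * x + const t * y) (const 0 * x + const 1 * y) (const a * z + const b * w) (const r * z + const s * w)"
    by (rule coords_change34[OF coords_change2[OF co] det]) simp
  then have "coords (x + const t * y) y (const a * z + const b * w) (const r * z + const s * w)"
    by simp
  moreover have "(x + const t * y)^2 = x^2 + const (2 * t) * (x * y) + const (t * t) * y^2"
    "(x + const t * y) * y = x * y + const t * y^2"
    "(x + const t * y) * (const a * z + const b * w) = ?q"
    by (simp_all add: t ring_simps)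
  then have "(x + const t * y)^2 \<in> V" "(x + const t * y) * y \<in> V" "(x + const t * y) * (const a * z + const b * w) \<in> V"
    using sq q by (auto intro!: V_add V_scale)
  ultimately show ?thesis
    using sq by (intro classifiedI equiv_x)
qed

text \<open>Modulo $(x,y)^2$ a fourth quadric is a binary form in $z,w$ plus terms that are linear in $x,y$ and
  in $z,w$. The rank of the binary form decides between the cases: rank two gives $x_3x_4$, rank one
  gives the other two choices of $q$ in (viii), and rank zero gives (ix) or (x).\<close>

theorem classified_double_line:
  assumes co: "coords x y z w" and sq: "x^2 \<in> V" "x * y \<in> V" "y^2 \<in> V"
  shows classified
proof -
  have ind3: "a = 0 \<and> b = 0 \<and> c = 0" if "const a * x^2 + const b * (x * y) + const c * y^2 = 0" for a b c
  proof -
    have lin: "linform x" "linform y" using co by (simp_all add: coords_def)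
    have "a * (ev x v)^2 + b * (ev x v * ev y v) + c * (ev y v)^2 = 0" for v
      using arg_cong[OF that, of "\<lambda>p. ev p v"] by simp
    then have *: "a * r^2 + b * (r * s) + c * s^2 = 0" for r s
      using coords_point[OF co, of r s 0 0] by metis
    show ?thesis using *[of 1 0] *[of 0 1] *[of 1 1] by simp
  qed
  obtain p where p: "p \<in> V" "ind4 (x^2) (x * y) (y^2) p"
    by (rule V_extend_three[OF sq ind3])
  obtain a b c d e f g h i j where exp:
    "p = const a * x^2 + const b * y^2 + const c * z^2 + const d * w^2
       + const e * (x * y) + const f * (x * z) + const g * (x * w)
       + const h * (y * z) + const i * (y * w) + const j * (z * w)"
    by (rule coords_quadric_expansion[OF co hom_V[OF p(1)]])
  let ?l = "x * (const f * z + const g * w) + y * (const h * z + const i * w)"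
  let ?q = "const c * z^2 + const j * (z * w) + const d * w^2 + ?l"
  have pq: "p = ?q + (const a * x^2 + const e * (x * y) + const b * y^2)"
    by (simp add: exp algebra_simps)
  then have q: "?q \<in> V"
    using V_diff[OF p(1) V_combination[OF sq]] by (metis add_diff_cancel_right')
  show ?thesis
  proof (cases "c = 0 \<and> j = 0 \<and> d = 0")
    case True
    then have l: "?l \<in> V" using q by simp
    then have l': "y * (const h * z + const i * w) + x * (const f * z + const g * w) \<in> V"
      by (simp add: add.commute)
    show ?thesis
    proof (cases "f \<noteq> 0 \<or> g \<noteq> 0")
      case fg: True
      show ?thesis by (rule double_line_rank0[OF co sq l fg])
    next
      case fg: False
      show ?thesis
      proof (cases "h \<noteq> 0 \<or> i \<noteq> 0")
        case hi: True
        show ?thesis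
          by (rule double_line_rank0[OF coords_swap12[OF co] _ _ _ l' hi]) (use sq in \<open>simp_all add: mult.commute\<close>)
      next
        case False
        then have "const (- a) * x^2 + const (- e) * (x * y) + const (- b) * y^2 + const 1 * p = 0"
          using fg True pq by (simp add: const_uminus)
        from ind4D[OF p(2) this] show ?thesis by simp
      qed
    qed
  next
    case False
    then have "c \<noteq> 0 \<or> j \<noteq> 0 \<or> d \<noteq> 0" by blast
    then show ?thesis
    proof (cases rule: binary_form_cases)
      case (product r s t u)
      obtain f' g' where fg: "f = f' * r + g' * t" "g = f' * s + g' * u" by (rule solve_linear2[OF product(1)])
      obtain h' i' where hi: "h = h' * r + i' * t" "i = h' * s + i' * u" by (rule solve_linear2[OF product(1)])
      let ?z = "const r * z + const s * w" and ?w = "const t * z + const u * w"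
      have "?z * ?w + x * (const f' * ?z + const g' * ?w) + y * (const h' * ?z + const i' * ?w) = ?q"
        by (simp add: product(2-4) fg hi ring_simps)
      then show ?thesis
        using double_line_rank2[OF coords_change34[OF co product(1)] sq] q by metis
    next
      case (square k r s)
      from square(2) obtain t u where det: "r * u - s * t \<noteq> 0"
        using complete_to_invertible2[of r s] by blast
      obtain f' g' where "f / k = f' * r + g' * t" "g / k = f' * s + g' * u" by (rule solve_linear2[OF det])
      then have fg: "f = k * (f' * r + g' * t)" "g = k * (f' * s + g' * u)"
        using square(1) by (metis nonzero_mult_div_cancel_left times_divide_eq_right)+
      obtain h' i' where "h / k = h' * r + i' * t" "i / k = h' * s + i' * u" by (rule solve_linear2[OF det])
      then have hi: "h = k * (h' * r + i' * t)" "i = k * (h' * s + i' * u)"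
        using square(1) by (metis nonzero_mult_div_cancel_left times_divide_eq_right)+
      let ?z = "const r * z + const s * w" and ?w = "const t * z + const u * w"
      have "const k * (?z^2 + x * (const f' * ?z + const g' * ?w) + y * (const h' * ?z + const i' * ?w)) = ?q"
        by (simp add: square(3-5) fg hi ring_simps)
      then have "?z^2 + x * (const f' * ?z + const g' * ?w) + y * (const h' * ?z + const i' * ?w) \<in> V"
        using q V_scale_iff[OF square(1)] by metis
      then show ?thesis
        by (rule double_line_rank1[OF coords_change34[OF co det] sq])
    qed
  qed
qed

end

context four_quadrics
begin

subsection \<open>Three independent squares\<close>

lemma three_squares_one_factor:
  assumes co: "coords x y z w" and sq: "x^2 \<in> V" "y^2 \<in> V" "z^2 \<in> V"
    and q: "const b * (x * z) + const c * (y * z) \<in> V" and nz: "b \<noteq> 0 \<or> c \<noteq> 0"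
  shows classified
proof (cases "b = 0 \<or> c = 0")
  case False
  then have "coords (const b * x) (const c * y) (const 1 * z) w"
    by (intro coords_scale3[OF co]) simp_all
  moreover have eqs: "(const b * x)^2 = const (b * b) * x^2" "(const c * y)^2 = const (c * c) * y^2"
    "(const b * x) * z + (const c * y) * z = const b * (x * z) + const c * (y * z)"
    by (simp_all add: ring_simps)
  have "(const b * x)^2 \<in> V" "(const c * y)^2 \<in> V" "(const b * x) * z + (const c * y) * z \<in> V"
    unfolding eqs by (intro V_scale sq q)+
  ultimately show ?thesis
    using sq(3) equiv_iii[of "const b * x" "const c * y" z w] classifiedI(3) by simp
next
  case True
  then show ?thesis
  proof
    assume "b = 0"
    then have "y * z \<in> V"
      using q nz V_scale_iff by simp
    moreover have "coords y z x w"
      by (rule coords_swap23[OF coords_swap12[OF co]])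
    ultimately show ?thesis
      using sq equiv_viii_sq[of y z x w] classifiedI(10) by blast
  next
    assume "c = 0"
    then have "x * z \<in> V"
      using q nz V_scale_iff by simp
    moreover have "coords x z y w"
      by (rule coords_swap23[OF co])
    ultimately show ?thesis
      using sq equiv_viii_sq[of x z y w] classifiedI(10) by blast
  qed
qed

text \<open>A fourth quadric may be chosen without squares. If its three coefficients are nonzero, then
  rescaling the three variables makes them equal, which is case (ii).\<close>

lemma three_squares:
  assumes co: "coords x y z w" and sq: "x^2 \<in> V" "y^2 \<in> V" "z^2 \<in> V"
    and q: "const a * (x * y) + const b * (x * z) + const c * (y * z) \<in> V" and nz: "a \<noteq> 0 \<or> b \<noteq> 0 \<or> c \<noteq> 0"
  shows classified
proof -
  consider "a = 0" | "b = 0" | "c = 0" | "a \<noteq> 0" "b \<noteq> 0" "c \<noteq> 0" by blast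
  then show ?thesis
  proof cases
    case 1
    then show ?thesis using three_squares_one_factor[OF co sq, of b c] q nz by simp
  next
    case 2
    have "coords x z y w" by (rule coords_swap23[OF co])
    then show ?thesis
      using three_squares_one_factor[of x z y w a c] sq q nz 2 by (simp add: mult.commute[of z y])
  next
    case 3
    have "coords y z x w" by (rule coords_swap23[OF coords_swap12[OF co]])
    then show ?thesis
      using three_squares_one_factor[of y z x w a b] sq q nz 3 by (simp add: mult.commute[of y x] mult.commute[of z x])
  next
    case 4
    let ?x = "const (inverse c) * x" and ?y = "const (inverse b) * y" and ?z = "const (inverse a) * z"
    have co': "coords ?x ?y ?z w"
      by (rule coords_scale3[OF co]) (use 4 in simp_all)
    have "?x^2 = const (inverse c * inverse c) * x^2" "?y^2 = const (inverse b * inverse b) * y^2"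
      "?z^2 = const (inverse a * inverse a) * z^2"
      by (simp_all add: ring_simps)
    then have sq': "?x^2 \<in> V" "?y^2 \<in> V" "?z^2 \<in> V"
      using sq by auto
    define k where "k = inverse a * inverse b * inverse c"
    have k: "k * a = inverse b * inverse c" "k * b = inverse a * inverse c" "k * c = inverse a * inverse b"
      using 4 by (simp_all add: k_def field_simps)
    have "?x * ?y + ?x * ?z + ?y * ?z
        = const (k * a) * (x * y) + const (k * b) * (x * z) + const (k * c) * (y * z)"
      unfolding k by (simp add: ring_simps)
    also have "\<dots> = const k * (const a * (x * y) + const b * (x * z) + const c * (y * z))"
      by (simp add: ring_simps)
    also have "\<dots> \<in> V" using q by blast
    finally show ?thesis
      using equiv_ii[OF co' sq'] classifiedI(2) by simp
  qed
qed

end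

text \<open>The vector of minors is a solution. It vanishes only if one of the two equations is a multiple of
  the other.\<close>

lemma homogeneous_system_2_3:
  fixes c1 c2 c3 d1 d2 d3 :: "'k::field"
  obtains a b c where "a \<noteq> 0 \<or> b \<noteq> 0 \<or> c \<noteq> 0" "a * c1 + b * c2 + c * c3 = 0" "a * d1 + b * d2 + c * d3 = 0"
proof -
  have two: "\<exists>a b c. (a \<noteq> 0 \<or> b \<noteq> 0 \<or> c \<noteq> 0) \<and> a * e1 + b * e2 + c * e3 = 0" for e1 e2 e3 :: 'k
  proof (cases "e1 = 0")
    case True
    show ?thesis by (rule exI[of _ 1], rule exI[of _ 0], rule exI[of _ 0]) (simp add: True)
  next
    case False
    show ?thesis by (rule exI[of _ "- e2"], rule exI[of _ e1], rule exI[of _ 0]) (simp add: False)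
  qed
  let ?a = "c2 * d3 - c3 * d2" and ?b = "c3 * d1 - c1 * d3" and ?c = "c1 * d2 - c2 * d1"
  show thesis
  proof (cases "?a = 0 \<and> ?b = 0 \<and> ?c = 0")
    case False
    then show thesis
      by (intro that[of ?a ?b ?c]) (auto simp: algebra_simps)
  next
    case minors: True
    show thesis
    proof (cases "c1 = 0 \<and> c2 = 0 \<and> c3 = 0")
      case True
      then show thesis using two[of d1 d2 d3] that by fastforce
    next
      case False
      obtain a b c where abc: "a \<noteq> 0 \<or> b \<noteq> 0 \<or> c \<noteq> 0" "a * c1 + b * c2 + c * c3 = 0"
        using two[of c1 c2 c3] by blast
      have "c1 * (a * d1 + b * d2 + c * d3) = d1 * (a * c1 + b * c2 + c * c3) + b * ?c - c * ?b"
        "c2 * (a * d1 + b * d2 + c * d3) = d2 * (a * c1 + b * c2 + c * c3) - a * ?c + c * ?a"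
        "c3 * (a * d1 + b * d2 + c * d3) = d3 * (a * c1 + b * c2 + c * c3) + a * ?b - b * ?a"
        by (simp_all add: algebra_simps)
      then have "c1 * (a * d1 + b * d2 + c * d3) = 0" "c2 * (a * d1 + b * d2 + c * d3) = 0" "c3 * (a * d1 + b * d2 + c * d3) = 0"
        using minors abc(2) by simp_all
      then show thesis
        using that[OF abc] False by auto
    qed
  qed
qed

lemma square_of_sum3:
  "(const a * x + const b * y + const c * z)^2 = const (a^2) * x^2 + const (b^2) * y^2 + const (c^2) * z^2
     + const (2 * a * b) * (x * y) + const (2 * a * c) * (x * z) + const (2 * b * c) * (y * z :: 'k::field pol4)"
  by (simp add: ring_simps)

text \<open>Quadrics in three variables form a space of dimension six, in which a four-dimensional subspace
  is cut out by two linear forms. On products of linear forms these are symmetric bilinear forms,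
  so that they span a pencil of conics in the dual plane, and the base points of this pencil are the
  squares of linear forms that lie in $V$.\<close>

locale ternary_quadrics = four_quadrics f for f :: "4 \<Rightarrow> 'k::{alg_closed_field, field_char_0} pol4" +
  fixes S :: "'k pol4 set"
  assumes S_add: "x \<in> S \<Longrightarrow> y \<in> S \<Longrightarrow> x + y \<in> S"
    and S_scale: "x \<in> S \<Longrightarrow> const c * x \<in> S"
begin

definition Q :: "'k pol4 set"
  where "Q = pvs.span {x * y | x y. x \<in> S \<and> y \<in> S}"

lemma Q_mult: "x \<in> S \<Longrightarrow> y \<in> S \<Longrightarrow> x * y \<in> Q"
  unfolding Q_def by (rule pvs.span_base) blast

lemma Q_square: "x \<in> S \<Longrightarrow> x^2 \<in> Q"
  by (simp add: power2_eq_square Q_mult)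

lemma Q_add: "p \<in> Q \<Longrightarrow> q \<in> Q \<Longrightarrow> p + q \<in> Q"
  unfolding Q_def by (rule pvs.span_add)

lemma Q_scale: "p \<in> Q \<Longrightarrow> const c * p \<in> Q"
  unfolding Q_def by (rule pvs.span_scale)

lemma Q_diff: "p \<in> Q \<Longrightarrow> q \<in> Q \<Longrightarrow> p - q \<in> Q"
  unfolding Q_def by (rule pvs.span_diff)

lemmas Q_intros = Q_add Q_diff Q_scale Q_mult Q_square S_add S_scale

text \<open>Two linear functionals whose common kernel in \<open>Q\<close> is the part of \<open>V\<close> in \<open>Q\<close>. They are
  defined on all polynomials so that their linearity has no side conditions.\<close>

definition pencil :: "('k pol4 \<Rightarrow> 'k) \<Rightarrow> ('k pol4 \<Rightarrow> 'k) \<Rightarrow> bool"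
  where "pencil C D \<longleftrightarrow> (\<forall>p q. C (p + q) = C p + C q) \<and> (\<forall>c p. C (const c * p) = c * C p) \<and>
    (\<forall>p q. D (p + q) = D p + D q) \<and> (\<forall>c p. D (const c * p) = c * D p) \<and>
    (\<forall>p\<in>Q. p \<in> V \<longleftrightarrow> C p = 0 \<and> D p = 0)"

lemma pencil_linear:
  assumes "pencil C D"
  shows "C (p + q) = C p + C q" "C (const c * p) = c * C p" "D (p + q) = D p + D q" "D (const c * p) = c * D p"
    "C (- p) = - C p" "D (- p) = - D p" "C (p - q) = C p - C q" "D (p - q) = D p - D q"
proof -
  have *: "\<And>p q. C (p + q) = C p + C q" "\<And>c p. C (const c * p) = c * C p" "\<And>p q. D (p + q) = D p + D q" "\<And>c p. D (const c * p) = c * D p"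
    using assms by (simp_all add: pencil_def)
  have u: "C (- p) = - C p" "D (- p) = - D p" for p
    using *(2)[of "- 1" p] *(4)[of "- 1" p] by (simp_all add: const_uminus)
  show "C (p + q) = C p + C q" "C (const c * p) = c * C p" "D (p + q) = D p + D q" "D (const c * p) = c * D p"
    "C (- p) = - C p" "D (- p) = - D p"
    by (simp_all add: * u)
  show "C (p - q) = C p - C q" "D (p - q) = D p - D q"
    using *(1)[of p "- q"] *(3)[of p "- q"] by (simp_all add: u)
qed

lemma pencil_mem: "pencil C D \<Longrightarrow> p \<in> Q \<Longrightarrow> C p = 0 \<Longrightarrow> D p = 0 \<Longrightarrow> p \<in> V"
  by (simp add: pencil_def)

lemma pencil_zero: "pencil C D \<Longrightarrow> p \<in> Q \<Longrightarrow> p \<in> V \<Longrightarrow> C p = 0 \<and> D p = 0"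
  by (simp add: pencil_def)

lemma pencil_change:
  assumes "pencil C D" "a * d - b * c \<noteq> 0"
  shows "pencil (\<lambda>p. a * C p + b * D p) (\<lambda>p. c * C p + d * D p)"
proof -
  have iff: "a * r + b * s = 0 \<and> c * r + d * s = 0 \<longleftrightarrow> r = 0 \<and> s = 0" for r s
  proof
    assume *: "a * r + b * s = 0 \<and> c * r + d * s = 0"
    have "(a * d - b * c) * r = d * (a * r + b * s) - b * (c * r + d * s)"
      "(a * d - b * c) * s = a * (c * r + d * s) - c * (a * r + b * s)"
      by (simp_all add: algebra_simps)
    with * have "(a * d - b * c) * r = 0" "(a * d - b * c) * s = 0" by simp_all
    with assms(2) show "r = 0 \<and> s = 0" by (simp only: mult_eq_0_iff simp_thms)
  qed simp
  show ?thesis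
    using assms(1) unfolding pencil_def iff by (simp add: algebra_simps)
qed

lemma pencil_combination3:
  assumes "pencil C D" "p \<in> Q" "q \<in> Q" "r \<in> Q"
  obtains a b c where "a \<noteq> 0 \<or> b \<noteq> 0 \<or> c \<noteq> 0" "const a * p + const b * q + const c * r \<in> V"
proof -
  obtain a b c where "a \<noteq> 0 \<or> b \<noteq> 0 \<or> c \<noteq> 0" "a * C p + b * C q + c * C r = 0" "a * D p + b * D q + c * D r = 0"
    by (rule homogeneous_system_2_3)
  moreover from this have "const a * p + const b * q + const c * r \<in> V"
    by (intro pencil_mem[OF assms(1)] Q_add Q_scale assms) (simp_all add: pencil_linear[OF assms(1)])
  ultimately show thesis using that by blast
qed

lemma three_squares_pencil:
  assumes "pencil C D" "coords x y z w" "x \<in> S" "y \<in> S" "z \<in> S" "x^2 \<in> V" "y^2 \<in> V" "z^2 \<in> V"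
  shows classified
proof -
  obtain a b c where "a \<noteq> 0 \<or> b \<noteq> 0 \<or> c \<noteq> 0" "const a * (x * y) + const b * (x * z) + const c * (y * z) \<in> V"
    by (rule pencil_combination3[OF assms(1), of "x * y" "x * z" "y * z"]) (use assms in \<open>simp_all add: Q_mult\<close>)
  then show ?thesis
    using three_squares[OF assms(2,6-8)] by blast
qed

subsection \<open>Two independent squares\<close>

text \<open>A linear form $lx+my+z$ has its square in \<open>V\<close> iff $l,m$ solve two equations. A solution is a third
  square. There is one unless one of the products $xz$ and $yz$ lies in \<open>V\<close>, and in that case \<open>V\<close> still
  contains a third square or is of type (iv) or (vi).\<close>

lemma two_squares_normalized:
  assumes pen: "pencil C D" and co: "coords x y z w" and S: "x \<in> S" "y \<in> S" "z \<in> S"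
    and sq: "x^2 \<in> V" "y^2 \<in> V" and xy: "C (x * y) = 1" "D (x * y) = 0"
    and C: "C (x * z) = 0" "C (y * z) = 0"
  shows classified
proof -
  have CD: "C (x^2) = 0" "D (x^2) = 0" "C (y^2) = 0" "D (y^2) = 0"
    using pencil_zero[OF pen Q_square] S sq by blast+
  define c3 d1 d2 d3 where "c3 = C (z^2)" and "d1 = D (x * z)" and "d2 = D (y * z)" and "d3 = D (z^2)"
  note cd = c3_def[symmetric] d1_def[symmetric] d2_def[symmetric] d3_def[symmetric]
  \<comment> \<open>A solution of these two equations is a third square.\<close>
  have third: classified if "2 * l * m + c3 = 0" "2 * l * d1 + 2 * m * d2 + d3 = 0" for l m
  proof -
    let ?z = "const l * x + const m * y + const 1 * z"
    have "?z^2 \<in> V"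
      unfolding square_of_sum3
      by (rule pencil_mem[OF pen])
        (use S that in \<open>simp_all add: Q_intros pencil_linear[OF pen] CD xy C cd add_ac\<close>)
    moreover have "coords x y ?z w"
      using coords_shear[OF co, of l m] by (simp add: algebra_simps)
    moreover have "?z \<in> S"
      using S by (intro S_add S_scale)
    ultimately show ?thesis
      using three_squares_pencil[OF pen _ S(1,2)] sq by blast
  qed
  have co2: "coords y x z w" by (rule coords_swap12[OF co])
  \<comment> \<open>The remaining case up to exchanging the two squares.\<close>
  have deg: classified if "coords u v z w" "u^2 \<in> V" "u * z \<in> V" "z^2 - const c3 * (x * y) \<in> V" "c3 \<noteq> 0" "u * v = x * y" "v^2 \<in> V" for u v
  proof -
    have "coords (const 1 * u) (const 1 * z) (const c3 * v) w"
      by (rule coords_scale3[OF coords_swap23[OF that(1)]]) (use that in simp_all)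
    moreover have eq: "u * (const c3 * v) - z^2 = - (z^2 - const c3 * (x * y))"
      by (simp add: that(6)[symmetric] algebra_simps)
    have "u * (const c3 * v) - z^2 \<in> V"
      unfolding eq by (rule V_uminus[OF that(4)])
    moreover have "(const c3 * v)^2 = const (c3 * c3) * v^2"
      by (simp add: ring_simps)
    then have "(const c3 * v)^2 \<in> V"
      using that(7) by auto
    ultimately show ?thesis
      using equiv_iv[of u z "const c3 * v" w] that classifiedI(4) by simp
  qed
  have mem: "x * z \<in> V" if "d1 = 0"
    by (rule pencil_mem[OF pen Q_mult]) (use S C that in \<open>simp_all add: d1_def\<close>)
  have mem': "y * z \<in> V" if "d2 = 0"
    by (rule pencil_mem[OF pen Q_mult]) (use S C that in \<open>simp_all add: d2_def\<close>)
  have mem'': "z^2 - const c3 * (x * y) \<in> V" if "d3 = 0"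
  proof -
    have "z^2 + const (- c3) * (x * y) \<in> V"
      by (rule pencil_mem[OF pen]) (use S xy that in \<open>simp_all add: Q_intros pencil_linear[OF pen] cd\<close>)
    then show ?thesis by (simp add: const_uminus)
  qed
  consider "d1 = 0" "d2 = 0" | "d1 \<noteq> 0" "d2 \<noteq> 0" | "d1 \<noteq> 0" "d2 = 0" | "d1 = 0" "d2 \<noteq> 0" by blast
  then show ?thesis
  proof cases
    case 1
    then show ?thesis
      using equiv_vi[OF co sq(1) mem sq(2) mem'] classifiedI(6) by simp
  next
    case 2
    then obtain m where m: "(2 * d2) * m^2 + d3 * m + (- c3 * d1) = 0"
      using quadratic_root[of "2 * d2" d3 "- c3 * d1"] by auto
    define l where "l = - (d3 + 2 * m * d2) / (2 * d1)"
    have l: "2 * d1 * l = - (d3 + 2 * m * d2)"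
      using 2 by (simp add: l_def)
    have "d1 * (2 * l * m + c3) = (2 * d1 * l) * m + d1 * c3"
      by (simp add: algebra_simps)
    also have "\<dots> = - ((2 * d2) * m^2 + d3 * m + (- c3 * d1))"
      unfolding l by (simp add: algebra_simps power2_eq_square)
    finally have "2 * l * m + c3 = 0"
      using m 2 by simp
    moreover have "2 * l * d1 + 2 * m * d2 + d3 = 2 * d1 * l + (d3 + 2 * m * d2)"
      by (simp add: algebra_simps)
    then have "2 * l * d1 + 2 * m * d2 + d3 = 0"
      unfolding l by simp
    ultimately show ?thesis by (rule third)
  next
    case 3
    show ?thesis
    proof (cases "d3 = 0 \<and> c3 \<noteq> 0")
      case True
      then show ?thesis
        using deg[OF co2 sq(2) mem'[OF 3(2)] mem'' _ _ sq(1)] by (simp add: mult.commute)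
    next
      case False
      define l m where "l = - d3 / (2 * d1)" and "m = (if d3 = 0 then 0 else c3 * d1 / d3)"
      show ?thesis
        by (rule third[of l m]) (use 3 False in \<open>auto simp: l_def m_def field_simps\<close>)
    qed
  next
    case 4
    show ?thesis
    proof (cases "d3 = 0 \<and> c3 \<noteq> 0")
      case True
      then show ?thesis
        using deg[OF co sq(1) mem[OF 4(1)] mem'' _ _ sq(2)] by simp
    next
      case False
      define m l where "m = - d3 / (2 * d2)" and "l = (if d3 = 0 then 0 else c3 * d2 / d3)"
      show ?thesis
        by (rule third[of l m]) (use 4 False in \<open>auto simp: l_def m_def field_simps\<close>)
    qed
  qed
qed

lemma pencil_normalize:
  assumes "pencil C D" "p \<in> Q" "p \<notin> V"
  obtains C' D' where "pencil C' D'" "C' p = 1" "D' p = 0"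
proof (cases "C p = 0")
  case False
  have "pencil (\<lambda>q. inverse (C p) * C q + 0 * D q) (\<lambda>q. (- D p / C p) * C q + 1 * D q)"
    by (rule pencil_change[OF assms(1)]) (use False in simp)
  then show thesis
    by (rule that) (use False in simp_all)
next
  case True
  then have nz: "D p \<noteq> 0"
    using pencil_mem[OF assms(1,2)] assms(3) by blast
  have "pencil (\<lambda>q. 0 * C q + inverse (D p) * D q) (\<lambda>q. 1 * C q + 0 * D q)"
    by (rule pencil_change[OF assms(1)]) (use nz in simp)
  then show thesis
    by (rule that) (use True nz in simp_all)
qed

text \<open>Adding multiples of $x$ and $y$ to $z$ moves the values on $xz$ and $yz$ of the functional that is one
  on $xy$ to zero.\<close>

lemma two_squares:
  assumes pen: "pencil C D" and co: "coords x y z w" and S: "x \<in> S" "y \<in> S" "z \<in> S"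
    and sq: "x^2 \<in> V" "y^2 \<in> V"
  shows classified
proof (cases "x * y \<in> V")
  case True
  then show ?thesis using classified_double_line[OF co sq(1) _ sq(2)] by blast
next
  case False
  obtain C' D' where pen': "pencil C' D'" and xy: "C' (x * y) = 1" "D' (x * y) = 0"
    by (rule pencil_normalize[OF pen Q_mult False]) (use S in simp_all)
  have CD: "C' (x^2) = 0" "C' (y^2) = 0"
    using pencil_zero[OF pen' Q_square] S sq by blast+
  let ?z = "z + const (- C' (y * z)) * x + const (- C' (x * z)) * y"
  have "x * ?z = x * z + const (- C' (y * z)) * x^2 + const (- C' (x * z)) * (x * y)"
    "y * ?z = y * z + const (- C' (y * z)) * (x * y) + const (- C' (x * z)) * y^2"
    by (simp_all add: ring_simps)
  then have "C' (x * ?z) = 0" "C' (y * ?z) = 0"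
    by (simp_all add: pencil_linear[OF pen'] CD xy)
  moreover have "?z \<in> S"
    using S by (intro S_add S_scale)
  ultimately show ?thesis
    using two_squares_normalized[OF pen' coords_shear[OF co] S(1,2) _ sq xy] by blast
qed

subsection \<open>A single square\<close>

text \<open>The fourth quadric is a binary form in $y,z$. It is not a square, since there is only one, so it is a
  product of two independent forms.\<close>

lemma one_square_two_products:
  assumes pen: "pencil C D" and co: "coords x y z w" and S: "x \<in> S" "y \<in> S" "z \<in> S"
    and sq: "x^2 \<in> V" and xy: "x * y \<in> V" "x * z \<in> V"
    and only: "\<And>a b c. (const a * x + const b * y + const c * z)^2 \<in> V \<Longrightarrow> b = 0 \<and> c = 0"
  shows classified
proof -
  obtain a b c where nz: "a \<noteq> 0 \<or> b \<noteq> 0 \<or> c \<noteq> 0" and q: "const a * y^2 + const b * (y * z) + const c * z^2 \<in> V"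
    by (rule pencil_combination3[OF pen, of "y^2" "y * z" "z^2"]) (use S in \<open>simp_all add: Q_intros\<close>)
  from nz show ?thesis
  proof (cases rule: binary_form_cases)
    case (product p q' r s)
    let ?y = "const p * y + const q' * z" and ?z = "const r * y + const s * z"
    have "?y * ?z = const a * y^2 + const b * (y * z) + const c * z^2"
      by (simp add: product(2-4) ring_simps)
    then have "?y * ?z \<in> V" using q by simp
    moreover have "x * ?y = const p * (x * y) + const q' * (x * z)" "x * ?z = const r * (x * y) + const s * (x * z)"
      by (simp_all add: algebra_simps)
    then have "x * ?y \<in> V" "x * ?z \<in> V"
      using xy by auto
    ultimately show ?thesis
      using equiv_vii[OF coords_change23[OF co product(1)] sq] classifiedI(7) by blast
  next
    case (square k p q')
    have "const k * (const 0 * x + const p * y + const q' * z)^2 = const a * y^2 + const b * (y * z) + const c * z^2"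
      by (simp add: square(3-5) ring_simps)
    then have "(const 0 * x + const p * y + const q' * z)^2 \<in> V"
      using q V_scale_iff[OF square(1)] by metis
    from only[OF this] square(2) show ?thesis by simp
  qed
qed

text \<open>Since $C(xz)=1$ and $D(xz)=0$, the form $lx+my+z$ has its square in \<open>V\<close> for a suitable $l$ as soon as
  $m$ is a root of the quadratic polynomial given by $D$. As there is no second square, this polynomial
  is a nonzero constant. Its vanishing coefficients yield two further members of \<open>V\<close>, which a shear and a
  scaling bring to the form (v).\<close>

lemma one_square_one_product:
  assumes pen: "pencil C D" and co: "coords x y z w" and S: "x \<in> S" "y \<in> S" "z \<in> S"
    and sq: "x^2 \<in> V" and xy: "x * y \<in> V" and xz: "C (x * z) = 1" "D (x * z) = 0"
    and only: "\<And>a b c. (const a * x + const b * y + const c * z)^2 \<in> V \<Longrightarrow> b = 0 \<and> c = 0"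
  shows classified
proof -
  have CD: "C (x^2) = 0" "D (x^2) = 0" "C (x * y) = 0" "D (x * y) = 0"
    using pencil_zero[OF pen Q_square] pencil_zero[OF pen Q_mult] S sq xy by blast+
  have no_root: "D (y^2) * m^2 + 2 * D (y * z) * m + D (z^2) \<noteq> 0" for m
  proof
    assume root: "D (y^2) * m^2 + 2 * D (y * z) * m + D (z^2) = 0"
    define l where "l = - (C (y^2) * m^2 + 2 * C (y * z) * m + C (z^2)) / 2"
    have "(const l * x + const m * y + const 1 * z)^2 \<in> V"
      unfolding square_of_sum3
    proof (rule pencil_mem[OF pen], goal_cases)
      case 1
      show ?case using S by (intro Q_intros)
    next
      case 2
      show ?case by (simp only: pencil_linear[OF pen] CD xz) (simp add: l_def field_simps)
    next
      case 3
      show ?case using root by (simp only: pencil_linear[OF pen] CD xz) (simp add: algebra_simps)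
    qed
    from only[OF this] show False by simp
  qed
  have Dy: "D (y^2) = 0"
    using quadratic_root[of "D (y^2)"] no_root by metis
  have Dyz: "D (y * z) = 0"
  proof (rule ccontr)
    assume "D (y * z) \<noteq> 0"
    then show False
      using no_root[of "- D (z^2) / (2 * D (y * z))"] Dy by simp
  qed
  define \<alpha> \<beta> where "\<alpha> = C (y^2)" and "\<beta> = C (y * z)"
  have 1: "y^2 + const (- \<alpha>) * (x * z) \<in> V"
    by (rule pencil_mem[OF pen]) (use S in \<open>simp_all add: Q_intros pencil_linear[OF pen] xz Dy \<alpha>_def\<close>)
  have 2: "y * z + const (- \<beta>) * (x * z) \<in> V"
    by (rule pencil_mem[OF pen]) (use S in \<open>simp_all add: Q_intros pencil_linear[OF pen] xz Dyz \<beta>_def\<close>)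
  have "\<alpha> \<noteq> 0"
    using 1 only[of 0 1 0] by auto
  let ?y = "y + const (- \<beta>) * x" and ?z = "const \<alpha> * z"
  have "coords x ?y ?z w"
  proof -
    have "coords x ?y z w"
      using coords_swap12[OF coords_change2[OF coords_swap12[OF co], of 1 1 "- \<beta>" 0]] by simp
    then show ?thesis
      using coords_scale3[of x ?y z w 1 1 \<alpha>] \<open>\<alpha> \<noteq> 0\<close> by simp
  qed
  moreover have eqs: "x * ?y = x * y + const (- \<beta>) * x^2"
    "x * ?z - ?y^2 = - (y^2 + const (- \<alpha>) * (x * z)) + const (2 * \<beta>) * (x * y) + const (- \<beta> * \<beta>) * x^2"
    "?y * ?z = const \<alpha> * (y * z + const (- \<beta>) * (x * z))"
    by (simp_all add: ring_simps)
  have "x * ?y \<in> V" "x * ?z - ?y^2 \<in> V" "?y * ?z \<in> V"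
    unfolding eqs by (intro V_add V_scale V_uminus sq xy 1 2)+
  ultimately show ?thesis
    using equiv_v[of x ?y ?z w] sq classifiedI(5) by blast
qed

text \<open>The two conditions on $(lx+my+z)^2$ are a formula for $l$ and, after substituting it, a cubic
  equation for $m$: two conics that meet transversally at one point meet again.\<close>

lemma no_single_square_without_products:
  assumes pen: "pencil C D" and S: "x \<in> S" "y \<in> S" "z \<in> S"
    and sq: "x^2 \<in> V" and xy: "C (x * y) = 1" "D (x * y) = 0" and xz: "C (x * z) = 0" "D (x * z) = 1"
  obtains a b c where "(const a * x + const b * y + const c * z)^2 \<in> V" "b \<noteq> 0 \<or> c \<noteq> 0"
proof -
  have CD: "C (x^2) = 0" "D (x^2) = 0"
    using pencil_zero[OF pen Q_square] S sq by blast+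
  show thesis
  proof (cases "D (y^2) = 0")
    case True
    have "(const (- C (y^2) / 2) * x + const 1 * y + const 0 * z)^2 \<in> V"
      unfolding square_of_sum3
    proof (rule pencil_mem[OF pen], goal_cases)
      case 1
      show ?case using S by (intro Q_intros)
    next
      case 2
      show ?case by (simp only: pencil_linear[OF pen] CD xy xz) (simp add: field_simps)
    next
      case 3
      show ?case by (simp only: pencil_linear[OF pen] CD xy xz True) simp
    qed
    then show thesis by (rule that) simp
  next
    case False
    then obtain m where m: "D (y^2) * m^3 + (2 * D (y * z) - C (y^2)) * m^2 + (D (z^2) - 2 * C (y * z)) * m + (- C (z^2)) = 0"
      by (rule cubic_root)
    define l where "l = - (D (y^2) * m^2 + 2 * D (y * z) * m + D (z^2)) / 2"
    have "(const l * x + const m * y + const 1 * z)^2 \<in> V"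
      unfolding square_of_sum3
    proof (rule pencil_mem[OF pen], goal_cases)
      case 1
      show ?case using S by (intro Q_intros)
    next
      case 2
      have l2: "2 * l = - (D (y^2) * m^2 + 2 * D (y * z) * m + D (z^2))" by (simp add: l_def)
      have "m^2 * C (y^2) + C (z^2) + (2 * l) * m + 2 * m * C (y * z)
          = - (D (y^2) * m^3 + (2 * D (y * z) - C (y^2)) * m^2 + (D (z^2) - 2 * C (y * z)) * m + (- C (z^2)))"
        unfolding l2 by (simp add: algebra_simps power2_eq_square power3_eq_cube)
      also have "\<dots> = 0" using m by simp
      finally show ?case by (simp only: pencil_linear[OF pen] CD xy xz) simp
    next
      case 3
      show ?case by (simp only: pencil_linear[OF pen] CD xy xz) (simp add: l_def field_simps)
    qed
    then show thesis by (rule that) simp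
  qed
qed

text \<open>The space \<open>V\<close> contains a nonzero product $x(by+cz)$ iff the values of the two functionals on $xy$ and $xz$ have
  determinant zero.\<close>

lemma one_square:
  assumes pen: "pencil C D" and co: "coords x y z w" and S: "x \<in> S" "y \<in> S" "z \<in> S"
    and sq: "x^2 \<in> V"
    and only: "\<And>a b c. (const a * x + const b * y + const c * z)^2 \<in> V \<Longrightarrow> b = 0 \<and> c = 0"
  shows classified
proof (cases "C (x * y) * D (x * z) - C (x * z) * D (x * y) = 0")
  case False
  define d where "d = C (x * y) * D (x * z) - C (x * z) * D (x * y)"
  have d: "d \<noteq> 0" using False by (simp add: d_def)
  have "(D (x * z) / d) * (C (x * y) / d) - (- C (x * z) / d) * (- D (x * y) / d)
      = (C (x * y) * D (x * z) - C (x * z) * D (x * y)) / (d * d)"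
    by (simp add: diff_divide_distrib mult.commute)
  then have det: "(D (x * z) / d) * (C (x * y) / d) - (- C (x * z) / d) * (- D (x * y) / d) \<noteq> 0"
    using d by (simp add: d_def[symmetric])
  have pen': "pencil (\<lambda>p. (D (x * z) / d) * C p + (- C (x * z) / d) * D p) (\<lambda>p. (- D (x * y) / d) * C p + (C (x * y) / d) * D p)"
    by (rule pencil_change[OF pen det])
  have one: "D (x * z) / d * C (x * y) + - C (x * z) / d * D (x * y) = 1" "- D (x * y) / d * C (x * z) + C (x * y) / d * D (x * z) = 1"
    using d by (simp_all add: d_def divide_simps)
  have zero: "- D (x * y) / d * C (x * y) + C (x * y) / d * D (x * y) = 0" "D (x * z) / d * C (x * z) + - C (x * z) / d * D (x * z) = 0"
    by simp_all
  obtain a b c where "(const a * x + const b * y + const c * z)^2 \<in> V" "b \<noteq> 0 \<or> c \<noteq> 0"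
    by (rule no_single_square_without_products[OF pen' S sq one(1) zero(1) zero(2) one(2)])
  then show ?thesis using only by blast
next
  case True
  obtain b c where bc: "b \<noteq> 0 \<or> c \<noteq> 0" "b * C (x * y) + c * C (x * z) = 0" "b * D (x * y) + c * D (x * z) = 0"
  proof (cases "C (x * y) = 0 \<and> C (x * z) = 0")
    case False
    then show thesis
      using that[of "C (x * z)" "- C (x * y)"] True by (auto simp: algebra_simps)
  next
    case C0: True
    show thesis
    proof (cases "D (x * y) = 0 \<and> D (x * z) = 0")
      case False
      then show thesis
        using that[of "D (x * z)" "- D (x * y)"] C0 by (auto simp: algebra_simps)
    next
      case True
      then show thesis using that[of 1 0] C0 by simp
    qed
  qed
  obtain r s where det: "b * s - c * r \<noteq> 0"
    using complete_to_invertible2[OF bc(1)] by blast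
  let ?y = "const b * y + const c * z" and ?z = "const r * y + const s * z"
  have co': "coords x ?y ?z w" by (rule coords_change23[OF co det])
  have S': "?y \<in> S" "?z \<in> S" by (intro S_add S_scale S)+
  have "x * ?y = const b * (x * y) + const c * (x * z)" by (simp add: algebra_simps)
  then have xy: "x * ?y \<in> V"
    using pencil_mem[OF pen Q_mult[OF S(1) S'(1)]] bc(2,3) by (simp add: pencil_linear[OF pen])
  have only': "e = 0 \<and> f = 0" if "(const a * x + const e * ?y + const f * ?z)^2 \<in> V" for a e f
  proof -
    have eq: "const a * x + const e * ?y + const f * ?z = const a * x + const (e * b + f * r) * y + const (e * c + f * s) * z"
      by (simp add: ring_simps)
    have *: "e * b + f * r = 0" "e * c + f * s = 0"
      using only[OF that[unfolded eq]] by simp_all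
    have "e * (b * s - c * r) = s * (e * b + f * r) - r * (e * c + f * s)"
      "f * (b * s - c * r) = b * (e * c + f * s) - c * (e * b + f * r)"
      by (simp_all add: algebra_simps)
    then have "e * (b * s - c * r) = 0" "f * (b * s - c * r) = 0" unfolding * by simp_all
    with det show ?thesis by (simp only: mult_eq_0_iff simp_thms)
  qed
  show ?thesis
  proof (cases "x * ?z \<in> V")
    case True
    show ?thesis
      by (rule one_square_two_products[OF pen co' S(1) S' sq xy True only'])
  next
    case False
    obtain C' D' where pen': "pencil C' D'" "C' (x * ?z) = 1" "D' (x * ?z) = 0"
      by (rule pencil_normalize[OF pen Q_mult[OF S(1) S'(2)] False])
    show ?thesis
      by (rule one_square_one_product[OF pen'(1) co' S(1) S' sq xy pen'(2,3) only'])
  qed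
qed

end

subsection \<open>Existence of a square\<close>

lemma coords_through:
  assumes co: "coords x y z w" and nz: "a \<noteq> 0 \<or> b \<noteq> 0 \<or> c \<noteq> 0"
  obtains u v where "u \<in> {x, y, z}" "v \<in> {x, y, z}" "coords (const a * x + const b * y + const c * z) u v w"
proof -
  have main: "coords (const a * x + const b * y + const c * z) y z w" if "coords x y z w" "a \<noteq> 0" for x y z and a b c
  proof -
    have "coords (const a * x + const b * y) (const 0 * x + const 1 * y) z w"
      by (rule coords_change2[OF that(1)]) (use that(2) in simp)
    then have "coords (const a * x + const b * y) y z w" by simp
    then have "coords y z (const a * x + const b * y) w"
      by (rule coords_swap23[OF coords_swap12])
    then have "coords y z (const a * x + const b * y + const 0 * y + const c * z) w"
      by (rule coords_shear)
    then have "coords y z (const a * x + const b * y + const c * z) w" by simp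
    then show ?thesis
      by (rule coords_swap12[OF coords_swap23])
  qed
  consider "a \<noteq> 0" | "b \<noteq> 0" | "c \<noteq> 0" using nz by blast
  then show thesis
  proof cases
    case 1
    show thesis by (rule that[OF _ _ main[OF co 1, of b c]]) simp_all
  next
    case 2
    have "coords (const b * y + const a * x + const c * z) x z w"
      by (rule main[OF coords_swap12[OF co] 2])
    then show thesis by (intro that[of x z]) (simp_all add: add_ac)
  next
    case 3
    have "coords (const c * z + const a * x + const b * y) x y w"
      by (rule main[OF coords_swap12[OF coords_swap23[OF co]] 3])
    then show thesis by (intro that[of x y]) (simp_all add: add_ac)
  qed
qed

lemma singular_symmetric3:
  fixes a b c d e f :: "'k::field"
  assumes "a * d * f + 2 * b * c * e - a * e^2 - d * c^2 - f * b^2 = 0"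
  obtains p q r where "p \<noteq> 0 \<or> q \<noteq> 0 \<or> r \<noteq> 0"
    "p * a + q * b + r * c = 0" "p * b + q * d + r * e = 0" "p * c + q * e + r * f = 0"
proof -
  let ?A = "vector [vector [a, b, c], vector [b, d, e], vector [c, e, f]] :: 'k^3^3"
  have "det ?A = a * d * f + 2 * b * c * e - a * e^2 - d * c^2 - f * b^2"
    by (simp add: det_3 algebra_simps power2_eq_square)
  then have "\<not> invertible ?A"
    using assms by (simp add: invertible_det_nz)
  then obtain v where "?A *v v = 0" "v \<noteq> 0"
    by (auto simp: invertible_left_inverse matrix_left_invertible_ker)
  then have "v $ 1 * a + v $ 2 * b + v $ 3 * c = 0" "v $ 1 * b + v $ 2 * d + v $ 3 * e = 0" "v $ 1 * c + v $ 2 * e + v $ 3 * f = 0"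
    "v $ 1 \<noteq> 0 \<or> v $ 2 \<noteq> 0 \<or> v $ 3 \<noteq> 0"
    by (auto simp: vec_eq_iff forall_3 matrix_vector_mult_def sum_3 mult.commute)
  then show thesis using that by blast
qed

text \<open>Cubic polynomial functions with given leading and constant coefficient. The determinant of a
  member of a pencil of conics is of this form, where these coefficients are the determinants of two
  conics that span the pencil.\<close>

definition cubic_in :: "('k::field \<Rightarrow> 'k) \<Rightarrow> 'k \<Rightarrow> 'k \<Rightarrow> bool"
  where "cubic_in g a d \<longleftrightarrow> (\<exists>b c. \<forall>t. g t = a * t^3 + b * t^2 + c * t + d)"

lemma cubic_in_product:
  "cubic_in (\<lambda>t. (c1 + t * d1) * (c2 + t * d2) * (c3 + t * d3)) (d1 * d2 * d3) (c1 * c2 * c3)"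
  unfolding cubic_in_def
  by (rule exI[of _ "c1 * d2 * d3 + d1 * c2 * d3 + d1 * d2 * c3"], rule exI[of _ "d1 * c2 * c3 + c1 * d2 * c3 + c1 * c2 * d3"])
    (simp add: algebra_simps power2_eq_square power3_eq_cube)

lemma cubic_in_add:
  assumes "cubic_in g a d" "cubic_in h a' d'"
  shows "cubic_in (\<lambda>t. g t + h t) (a + a') (d + d')"
proof -
  from assms obtain b c b' c' where "g t = a * t^3 + b * t^2 + c * t + d" "h t = a' * t^3 + b' * t^2 + c' * t + d'" for t
    unfolding cubic_in_def by blast
  then show ?thesis
    unfolding cubic_in_def by (intro exI[of _ "b + b'"] exI[of _ "c + c'"]) (simp add: distrib_right)
qed

lemma cubic_in_scale:
  assumes "cubic_in g a d"
  shows "cubic_in (\<lambda>t. r * g t) (r * a) (r * d)"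
proof -
  from assms obtain b c where "g t = a * t^3 + b * t^2 + c * t + d" for t
    unfolding cubic_in_def by blast
  then show ?thesis
    unfolding cubic_in_def by (intro exI[of _ "r * b"] exI[of _ "r * c"]) (simp add: distrib_left mult.assoc)
qed

lemma det3_pencil:
  fixes c1 c2 c3 c4 c5 c6 d1 d2 d3 d4 d5 d6 :: "'k::field" and dt :: "'k \<Rightarrow> 'k \<Rightarrow> 'k \<Rightarrow> 'k \<Rightarrow> 'k \<Rightarrow> 'k \<Rightarrow> 'k"
  defines "dt \<equiv> \<lambda>m1 m2 m3 m4 m5 m6 :: 'k. m1 * m2 * m3 + 2 * m4 * m5 * m6 - m1 * m6^2 - m2 * m5^2 - m3 * m4^2"
  shows "cubic_in (\<lambda>t. dt (c1 + t * d1) (c2 + t * d2) (c3 + t * d3) (c4 + t * d4) (c5 + t * d5) (c6 + t * d6))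
    (dt d1 d2 d3 d4 d5 d6) (dt c1 c2 c3 c4 c5 c6)"
proof -
  have dt: "dt m1 m2 m3 m4 m5 m6 = m1 * m2 * m3 + (2 * (m4 * m5 * m6) + (- 1 * (m1 * m6 * m6) + (- 1 * (m2 * m5 * m5) + - 1 * (m3 * m4 * m4))))" for m1 m2 m3 m4 m5 m6
    by (simp add: dt_def power2_eq_square)
  show ?thesis
    unfolding dt by (intro cubic_in_add cubic_in_scale cubic_in_product)
qed

context ternary_quadrics
begin

lemma pencil_singular_member:
  assumes pen: "pencil C D" and S: "x \<in> S" "y \<in> S" "z \<in> S"
  obtains E G p q r where "pencil E G" "p \<noteq> 0 \<or> q \<noteq> 0 \<or> r \<noteq> 0"
    "\<forall>u\<in>{x, y, z}. E ((const p * x + const q * y + const r * z) * u) = 0"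
proof -
  define det3 :: "('k pol4 \<Rightarrow> 'k) \<Rightarrow> 'k" where "det3 = (\<lambda>E. E (x^2) * E (y^2) * E (z^2) + 2 * E (x * y) * E (x * z) * E (y * z)
    - E (x^2) * (E (y * z))^2 - E (y^2) * (E (x * z))^2 - E (z^2) * (E (x * y))^2)"
  obtain E G where EG: "pencil E G" "det3 E = 0"
  proof (cases "det3 D = 0")
    case True
    have "pencil (\<lambda>p. 0 * C p + 1 * D p) (\<lambda>p. 1 * C p + 0 * D p)"
      by (rule pencil_change[OF pen]) simp
    then show thesis using that[of D C] True by simp
  next
    case False
    obtain b c where bc: "\<And>t. det3 (\<lambda>p. 1 * C p + t * D p) = det3 D * t^3 + b * t^2 + c * t + det3 C"
      using det3_pencil[of "C (x^2)" "D (x^2)" "C (y^2)" "D (y^2)" "C (z^2)" "D (z^2)" "C (x * y)" "D (x * y)"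
          "C (x * z)" "D (x * z)" "C (y * z)" "D (y * z)"]
      unfolding det3_def mult_1 cubic_in_def by blast
    obtain t where "det3 D * t^3 + b * t^2 + c * t + det3 C = 0"
      using cubic_root[OF False] by blast
    moreover note bc[of t]
    moreover have "pencil (\<lambda>p. 1 * C p + t * D p) (\<lambda>p. 0 * C p + 1 * D p)"
      by (rule pencil_change[OF pen]) simp
    ultimately show thesis using that by metis
  qed
  have "E (x^2) * E (y^2) * E (z^2) + 2 * E (x * y) * E (x * z) * E (y * z)
    - E (x^2) * (E (y * z))^2 - E (y^2) * (E (x * z))^2 - E (z^2) * (E (x * y))^2 = 0"
    using EG(2) by (simp only: det3_def)
  then obtain p q r where pqr: "p \<noteq> 0 \<or> q \<noteq> 0 \<or> r \<noteq> 0"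
    "p * E (x^2) + q * E (x * y) + r * E (x * z) = 0" "p * E (x * y) + q * E (y^2) + r * E (y * z) = 0"
    "p * E (x * z) + q * E (y * z) + r * E (z^2) = 0"
    by (rule singular_symmetric3)
  have "(const p * x + const q * y + const r * z) * x = const p * x^2 + const q * (x * y) + const r * (x * z)"
    "(const p * x + const q * y + const r * z) * y = const p * (x * y) + const q * y^2 + const r * (y * z)"
    "(const p * x + const q * y + const r * z) * z = const p * (x * z) + const q * (y * z) + const r * z^2"
    by (simp_all add: ring_simps)
  then have "\<forall>u\<in>{x, y, z}. E ((const p * x + const q * y + const r * z) * u) = 0"
    using pqr(2-4) by (simp add: pencil_linear[OF EG(1)])
  then show thesis
    using that[OF EG(1) pqr(1)] by blast
qed

text \<open>A pencil of conics in the plane has a base point: one of its members is singular, hence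
  contains a line, and another member meets this line.\<close>

lemma exists_square:
  assumes pen: "pencil C D" and co: "coords x y z w" and S: "x \<in> S" "y \<in> S" "z \<in> S"
  obtains x' y' z' where "coords x' y' z' w" "x' \<in> S" "y' \<in> S" "z' \<in> S" "x'^2 \<in> V"
proof -
  obtain E G p q r where EG: "pencil E G" and nz: "p \<noteq> 0 \<or> q \<noteq> 0 \<or> r \<noteq> 0"
    and sing: "\<forall>u\<in>{x, y, z}. E ((const p * x + const q * y + const r * z) * u) = 0"
    by (rule pencil_singular_member[OF pen S])
  define l where "l = const p * x + const q * y + const r * z"
  have lS: "l \<in> S" unfolding l_def using S by (intro S_add S_scale)
  obtain u v where uv: "u \<in> {x, y, z}" "v \<in> {x, y, z}" and co': "coords l u v w"
    unfolding l_def by (rule coords_through[OF co nz])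
  have uvS: "u \<in> S" "v \<in> S" using uv S by auto
  have E1: "E (l * u) = 0" "E (l * v) = 0" using bspec[OF sing uv(1)] bspec[OF sing uv(2)] by (simp_all add: l_def)
  have "l^2 = const p * (l * x) + const q * (l * y) + const r * (l * z)"
    by (simp add: l_def ring_simps)
  then have E2: "E (l^2) = 0"
    using sing by (simp add: pencil_linear[OF EG] l_def)
  obtain b c where bc: "b \<noteq> 0 \<or> c \<noteq> 0" "E (u^2) * b^2 + (2 * E (u * v)) * (b * c) + E (v^2) * c^2 = 0"
    by (rule binary_form_zero)
  define m where "m = const b * u + const c * v"
  have mS: "m \<in> S" unfolding m_def using uvS by (intro S_add S_scale)
  have eqm: "l * m = const b * (l * u) + const c * (l * v)" "m^2 = const (b^2) * u^2 + const (2 * b * c) * (u * v) + const (c^2) * v^2"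
    by (simp_all add: m_def ring_simps)
  have "E (l * m) = 0"
    unfolding eqm(1) pencil_linear[OF EG] E1 by simp
  moreover have "E (m^2) = 0"
    unfolding eqm(2) pencil_linear[OF EG] using bc(2) by (simp add: algebra_simps)
  ultimately have E3: "E (l * m) = 0" "E (m^2) = 0" .
  obtain s t where st: "s \<noteq> 0 \<or> t \<noteq> 0" "G (l^2) * s^2 + (2 * G (l * m)) * (s * t) + G (m^2) * t^2 = 0"
    by (rule binary_form_zero)
  let ?k = "const s * l + const t * m"
  have k: "?k^2 = const (s^2) * l^2 + const (2 * s * t) * (l * m) + const (t^2) * m^2"
    by (simp add: ring_simps)
  have "?k^2 \<in> V"
    unfolding k
  proof (rule pencil_mem[OF EG], goal_cases)
    case 1
    show ?case using lS mS by (intro Q_intros)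
  next
    case 2
    show ?case by (simp add: pencil_linear[OF EG] E2 E3)
  next
    case 3
    show ?case unfolding pencil_linear[OF EG] using st(2) by (simp add: algebra_simps)
  qed
  moreover have k': "?k = const s * l + const (t * b) * u + const (t * c) * v"
    by (simp add: m_def ring_simps)
  have "s \<noteq> 0 \<or> t * b \<noteq> 0 \<or> t * c \<noteq> 0"
    using st(1) bc(1) by auto
  then obtain u' v' where "u' \<in> {l, u, v}" "v' \<in> {l, u, v}" "coords ?k u' v' w"
    unfolding k' by (rule coords_through[OF co'])
  moreover from this have "u' \<in> S" "v' \<in> S"
    using lS uvS by blast+
  moreover have "?k \<in> S" using lS mS by (intro S_add S_scale)
  ultimately show thesis
    by (intro that[of ?k u' v'])
qed

theorem classified_pencil:
  assumes pen: "pencil C D" and co0: "coords x0 y0 z0 w" and S0: "x0 \<in> S" "y0 \<in> S" "z0 \<in> S"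
  shows classified
proof -
  obtain x y z where co: "coords x y z w" and S: "x \<in> S" "y \<in> S" "z \<in> S" and sq: "x^2 \<in> V"
    by (rule exists_square[OF pen co0 S0])
  show ?thesis
  proof (cases "\<exists>a b c. (const a * x + const b * y + const c * z)^2 \<in> V \<and> (b \<noteq> 0 \<or> c \<noteq> 0)")
    case False
    then show ?thesis
      using one_square[OF pen co S sq] by blast
  next
    case True
    then obtain a b c where sq2: "(const a * x + const b * y + const c * z)^2 \<in> V" and nz: "b \<noteq> 0 \<or> c \<noteq> 0"
      by blast
    let ?y = "const a * x + const b * y + const c * z"
    have yS: "?y \<in> S" using S by (intro S_add S_scale)
    obtain r s where det: "b * s - c * r \<noteq> 0"
      using complete_to_invertible2[OF nz] by blast
    let ?y' = "const b * y + const c * z" and ?z' = "const r * y + const s * z"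
    have "coords x ?y' ?z' w"
      by (rule coords_change23[OF co det])
    then have "coords x (const 1 * ?y' + const a * x) ?z' w"
      using coords_swap12[OF coords_change2[OF coords_swap12, of x ?y' ?z' w 1 1 a 0]] by simp
    then have "coords x ?y ?z' w"
      by (simp add: add_ac)
    moreover have "?z' \<in> S" using S by (intro S_add S_scale)
    ultimately show ?thesis
      using two_squares[OF pen _ S(1) yS _ sq sq2] by blast
  qed
qed

end

subsection \<open>A common vertex\<close>

context four_quadrics
begin

lemma inj_f: "inj f"
proof (rule injI, rule ccontr)
  fix i j assume ij: "f i = f j" "i \<noteq> j"
  have f_comb: "f i = comb (axis i 1)" for i
    by (rule index_cases[of i]) (simp_all add: comb_def sum_index axis_def)
  have "comb (axis i 1 + (- 1) *s axis j 1) = 0"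
    unfolding comb_add comb_scale f_comb[symmetric] using ij(1) by (simp add: const_uminus)
  then have "axis i 1 + (- 1) *s axis j (1::'k) = 0"
    by (simp only: comb_eq_0_iff)
  then have "(axis i 1 + (- 1) *s axis j (1::'k)) $ i = 0 $ i" by simp
  then show False using ij(2) by (simp add: axis_def)
qed

lemma independent_f: "pvs.independent (range f)"
proof
  assume "pvs.dependent (range f)"
  then obtain u p where u: "p \<in> range f" "u p \<noteq> 0" "(\<Sum>p\<in>range f. const (u p) * p) = 0"
    by (subst (asm) pvs.dependent_finite) auto
  have "(\<Sum>i\<in>UNIV. const ((\<chi> i. u (f i)) $ i) * f i) = 0"
    using u(3) by (simp add: sum.reindex[OF inj_f])
  then have "(\<chi> i. u (f i)) = 0"
    by (rule indep)
  with u(1,2) show False by (auto simp: vec_eq_iff)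
qed

lemma V_sum: "(\<And>x. x \<in> A \<Longrightarrow> h x \<in> V) \<Longrightarrow> sum h A \<in> V"
  by (induction A rule: infinite_finite_induct) auto

text \<open>The quadrics in three coordinates have dimension six, so a basis of \<open>V\<close> is completed to a basis of a
  space containing all of them by at most two further quadrics. The coefficients of these two are the
  functionals that cut out \<open>V\<close>.\<close>

lemma classified_ternary:
  assumes co: "coords x y z w"
    and tern: "\<And>p. p \<in> V \<Longrightarrow> \<exists>a b c d e g. p = const a * x^2 + const b * y^2 + const c * z^2
       + const d * (x * y) + const e * (x * z) + const g * (y * z)"
  shows classified
proof -
  define S where "S = {const a * x + const b * y + const c * z | a b c. True}"
  interpret ternary_quadrics f S
  proof
    fix p q assume "p \<in> S" "q \<in> S"
    then obtain a b c a' b' c' where "p = const a * x + const b * y + const c * z" "q = const a' * x + const b' * y + const c' * z"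
      by (auto simp: S_def)
    then have "p + q = const (a + a') * x + const (b + b') * y + const (c + c') * z"
      by (simp add: ring_simps)
    then show "p + q \<in> S" unfolding S_def by blast
  next
    fix p r assume "p \<in> S"
    then obtain a b c where "p = const a * x + const b * y + const c * z"
      by (auto simp: S_def)
    then have "const r * p = const (r * a) * x + const (r * b) * y + const (r * c) * z"
      by (simp add: ring_simps)
    then show "const r * p \<in> S" unfolding S_def by blast
  qed
  have "x = const 1 * x + const 0 * y + const 0 * z" "y = const 0 * x + const 1 * y + const 0 * z" "z = const 0 * x + const 0 * y + const 1 * z"
    by simp_all
  then have xyz: "x \<in> S" "y \<in> S" "z \<in> S" unfolding S_def by blast+
  define P where "P = {x^2, y^2, z^2, x * y, x * z, y * z}"
  have VP: "V \<subseteq> pvs.span P"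
  proof
    fix p assume "p \<in> V"
    from tern[OF this] show "p \<in> pvs.span P"
      by (elim exE) (simp, intro pvs.span_add pvs.span_scale pvs.span_base; simp add: P_def)
  qed
  have QP: "Q \<subseteq> pvs.span P"
    unfolding Q_def
  proof (rule pvs.span_minimal)
    show "{u * v |u v. u \<in> S \<and> v \<in> S} \<subseteq> pvs.span P"
    proof clarify
      fix u v assume "u \<in> S" "v \<in> S"
      then obtain a b c a' b' c' where "u = const a * x + const b * y + const c * z" "v = const a' * x + const b' * y + const c' * z"
        by (auto simp: S_def)
      then have "u * v = const (a * a') * x^2 + const (b * b') * y^2 + const (c * c') * z^2
         + const (a * b' + b * a') * (x * y) + const (a * c' + c * a') * (x * z) + const (b * c' + c * b') * (y * z)"
        by (simp add: ring_simps)
      then show "u * v \<in> pvs.span P"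
        by (simp, intro pvs.span_add pvs.span_scale pvs.span_base; simp add: P_def)
    qed
  qed simp
  have "range f \<subseteq> pvs.span P" using f_in_V VP by auto
  then obtain B where B: "range f \<subseteq> B" "B \<subseteq> pvs.span P" "pvs.independent B" "pvs.span P \<subseteq> pvs.span B"
    by (rule pvs.maximal_independent_subset_extend[OF _ independent_f])
  have "finite P" "card P \<le> 6"
    unfolding P_def by (auto simp: card_insert_if)
  then have finB: "finite B" and "card B \<le> 6"
    using pvs.independent_span_bound[OF _ B(3,2)] by auto
  moreover have "card (range f) = 4"
    using card_image[OF inj_f] by simp
  ultimately have card_R: "card (B - range f) \<le> 2" and finR: "finite (B - range f)"
    using card_Diff_subset[OF _ B(1)] by auto
  obtain g1 g2 where R: "B - range f \<subseteq> {g1, g2}"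
  proof -
    consider "card (B - range f) = 0" | "card (B - range f) = 1" | "card (B - range f) = 2"
      using card_R by linarith
    then show thesis
    proof cases
      case 1
      then show thesis using that finR by (metis card_0_eq empty_subsetI)
    next
      case 2
      then show thesis using that by (metis card_1_singletonE insert_is_Un subset_insertI)
    next
      case 3
      then show thesis using that by (metis card_2_iff order_refl)
    qed
  qed
  interpret vp: vector_space_pair "\<lambda>c p :: 'k pol4. const c * p" "(*) :: 'k \<Rightarrow> 'k \<Rightarrow> 'k"
    by unfold_locales
  obtain C where C: "Vector_Spaces.linear (\<lambda>c p. const c * p) (*) C" "\<forall>b\<in>B. C b = (if b \<notin> range f \<and> b = g1 then 1 else 0)"
    using vp.linear_independent_extend[OF B(3), of "\<lambda>b. if b \<notin> range f \<and> b = g1 then 1 else 0"] by blast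
  obtain D where D: "Vector_Spaces.linear (\<lambda>c p. const c * p) (*) D" "\<forall>b\<in>B. D b = (if b \<notin> range f \<and> b = g2 then 1 else 0)"
    using vp.linear_independent_extend[OF B(3), of "\<lambda>b. if b \<notin> range f \<and> b = g2 then 1 else 0"] by blast
  have lin: "C (p + q) = C p + C q" "C (const c * p) = c * C p" "D (p + q) = D p + D q" "D (const c * p) = c * D p" for p q c
    using C(1) D(1) by (simp_all add: Vector_Spaces.linear_iff)
  have zero: "C 0 = 0" "D 0 = 0"
    using lin(2)[of 0 0] lin(4)[of 0 0] by simp_all
  have sum: "C (sum h A) = (\<Sum>a\<in>A. C (h a))" "D (sum h A) = (\<Sum>a\<in>A. D (h a))" for h :: "'k pol4 \<Rightarrow> 'k pol4" and A
    by (induction A rule: infinite_finite_induct) (simp_all add: lin zero)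
  have sum': "C (sum h A) = (\<Sum>a\<in>A. C (h a))" "D (sum h A) = (\<Sum>a\<in>A. D (h a))" for h :: "4 \<Rightarrow> 'k pol4" and A
    by (induction A rule: infinite_finite_induct) (simp_all add: lin zero)
  have "C (f i) = 0" "D (f i) = 0" for i
    using bspec[OF C(2), of "f i"] bspec[OF D(2), of "f i"] subsetD[OF B(1), of "f i"] by simp_all
  then have V0: "C p = 0 \<and> D p = 0" if "p \<in> V" for p
    using that by (auto simp: V_def comb_def sum' lin)
  have "p \<in> V" if "p \<in> Q" "C p = 0" "D p = 0" for p
  proof -
    have "p \<in> pvs.span B" using that(1) QP B(4) by blast
    then obtain u where p: "p = (\<Sum>b\<in>B. const (u b) * b)"
      by (auto simp: pvs.span_finite[OF finB])
    have "C p = (\<Sum>b\<in>B. u b * (if b \<notin> range f \<and> b = g1 then 1 else 0))"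
      unfolding p sum lin using C(2) by (intro sum.cong) auto
    also have "\<dots> = (\<Sum>b\<in>B. if b = g1 then (if g1 \<notin> range f then u g1 else 0) else 0)"
      by (intro sum.cong) auto
    finally have C0: "g1 \<in> B \<Longrightarrow> g1 \<notin> range f \<Longrightarrow> u g1 = 0"
      using that(2) finB by simp
    have "D p = (\<Sum>b\<in>B. u b * (if b \<notin> range f \<and> b = g2 then 1 else 0))"
      unfolding p sum lin using D(2) by (intro sum.cong) auto
    also have "\<dots> = (\<Sum>b\<in>B. if b = g2 then (if g2 \<notin> range f then u g2 else 0) else 0)"
      by (intro sum.cong) auto
    finally have D0: "g2 \<in> B \<Longrightarrow> g2 \<notin> range f \<Longrightarrow> u g2 = 0"
      using that(3) finB by simp
    have "const (u b) * b \<in> V" if "b \<in> B" for b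
    proof (cases "b \<in> range f")
      case True
      then show ?thesis using f_in_V by auto
    next
      case False
      then have "u b = 0" using R that C0 D0 by blast
      then show ?thesis by (simp add: V_0)
    qed
    then show "p \<in> V" unfolding p by (rule V_sum)
  qed
  then have "pencil C D"
    unfolding pencil_def using lin V0 by blast
  then show ?thesis
    by (rule classified_pencil[OF _ co xyz])
qed

end

section \<open>Hilbert functions\<close>

subsection \<open>Invariance under changes of coordinates\<close>

lemma residue_basis_indep:
  assumes "residue_basis I j B" "(\<Sum>b\<in>B. const (c b) * b) \<in> I" "b \<in> B"
  shows "c b = 0"
proof -
  have "\<forall>c. (\<Sum>b\<in>B. const (c b) * b) \<in> I \<longrightarrow> (\<forall>b\<in>B. c b = 0)"
    using assms(1) unfolding residue_basis_def by (elim conjE)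
  from mp[OF spec[OF this] assms(2)] assms(3) show ?thesis by (rule bspec)
qed

lemma residue_basis_span:
  assumes "residue_basis I j B" "homogeneous j p"
  obtains c where "p - (\<Sum>b\<in>B. const (c b) * b) \<in> I"
proof -
  have "\<forall>p. homogeneous j p \<longrightarrow> (\<exists>c. p - (\<Sum>b\<in>B. const (c b) * b) \<in> I)"
    using assms(1) unfolding residue_basis_def by (elim conjE)
  from mp[OF spec[OF this] assms(2)] show thesis using that by (rule exE)
qed

lemma residue_basis_gl_image:
  assumes g: "invertible g" and B: "residue_basis I j B"
  shows "residue_basis (gl_image g I) j (lin_subst g ` B)" "card (lin_subst g ` B) = card B"
proof -
  obtain h where h: "\<And>p. lin_subst g (lin_subst h p) = p" "\<And>p. lin_subst h (lin_subst g p) = p"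
    using invertible_lin_subst_inverse[OF g] by metis
  have inj: "inj_on (lin_subst g) B"
    using inj_lin_subst[OF g] by (rule inj_on_subset) simp
  then show "card (lin_subst g ` B) = card B" by (rule card_image)
  have sum: "(\<Sum>b\<in>lin_subst g ` B. const (c b) * b) = lin_subst g (\<Sum>b\<in>B. const (c (lin_subst g b)) * b)" for c
    by (simp add: sum.reindex[OF inj])
  have mem: "lin_subst g p \<in> gl_image g I \<longleftrightarrow> p \<in> I" for p
    unfolding gl_image_def using inj_image_mem_iff[OF inj_lin_subst[OF g]] by blast
  show "residue_basis (gl_image g I) j (lin_subst g ` B)"
    unfolding residue_basis_def
  proof (intro conjI allI impI ballI)
    show "finite (lin_subst g ` B)" using B by (simp add: residue_basis_def)
  next
    fix b assume "b \<in> lin_subst g ` B"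
    then show "homogeneous j b" using B by (auto simp: residue_basis_def intro: homogeneous_lin_subst)
  next
    fix c b assume "(\<Sum>b\<in>lin_subst g ` B. const (c b) * b) \<in> gl_image g I" "b \<in> lin_subst g ` B"
    then have "(\<Sum>b\<in>B. const (c (lin_subst g b)) * b) \<in> I" and b: "b \<in> lin_subst g ` B"
      unfolding sum mem by simp_all
    from residue_basis_indep[OF B this(1)] show "c b = 0" using b by blast
  next
    fix p :: "'a pol4" assume "homogeneous j p"
    then have "homogeneous j (lin_subst h p)" by (rule homogeneous_lin_subst)
    then obtain c where "lin_subst h p - (\<Sum>b\<in>B. const (c b) * b) \<in> I"
      by (rule residue_basis_span[OF B])
    then have "lin_subst g (lin_subst h p - (\<Sum>b\<in>B. const (c b) * b)) \<in> gl_image g I"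
      by (simp only: mem)
    moreover have "(\<Sum>b\<in>lin_subst g ` B. const (c (lin_subst h b)) * b) = lin_subst g (\<Sum>b\<in>B. const (c b) * b)"
      unfolding sum h ..
    ultimately show "\<exists>c. p - (\<Sum>b\<in>lin_subst g ` B. const (c b) * b) \<in> gl_image g I"
      by (intro exI[of _ "\<lambda>b. c (lin_subst h b)"]) (simp only: lin_subst_simps(6) h)
  qed
qed

lemma hilbert_fun_lin_equiv:
  assumes "lin_equiv I J"
  shows "hilbert_fun I j = hilbert_fun J j"
proof -
  obtain g where g: "invertible g" "gl_image g I = J" using assms by (auto simp: lin_equiv_def)
  obtain h where h: "invertible h" "\<And>p. lin_subst h (lin_subst g p) = p"
    using invertible_lin_subst_inverse[OF g(1)] by metis
  have "gl_image h J = I"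
    unfolding g(2)[symmetric] gl_image_def image_image h(2) by simp
  then have "(\<exists>B. residue_basis I j B \<and> card B = n) \<longleftrightarrow> (\<exists>B. residue_basis J j B \<and> card B = n)" for n
    using residue_basis_gl_image[OF g(1)] residue_basis_gl_image[OF h(1)] g(2) by metis
  then show ?thesis by (simp add: hilbert_fun_def)
qed

subsection \<open>Normal forms modulo an ideal\<close>

definition linear_extension :: "(nat \<Rightarrow> nat \<Rightarrow> nat \<Rightarrow> nat \<Rightarrow> 'k::field pol4) \<Rightarrow> 'k pol4 \<Rightarrow> 'k pol4"
  where "linear_extension N p = (\<Sum>m\<in>Poly_Mapping.keys p. const (Poly_Mapping.lookup p m) *
    N (Poly_Mapping.lookup m 0) (Poly_Mapping.lookup m 1) (Poly_Mapping.lookup m 2) (Poly_Mapping.lookup m 3))"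

lemma linear_extension_superset:
  assumes "finite S" "Poly_Mapping.keys p \<subseteq> S"
  shows "linear_extension N p = (\<Sum>m\<in>S. const (Poly_Mapping.lookup p m) *
    N (Poly_Mapping.lookup m 0) (Poly_Mapping.lookup m 1) (Poly_Mapping.lookup m 2) (Poly_Mapping.lookup m 3))"
  unfolding linear_extension_def using assms by (intro sum.mono_neutral_left) (auto simp: in_keys_iff)

lemma linear_extension_add: "linear_extension N (p + q) = linear_extension N p + linear_extension N q"
  using keys_add[of p q]
  by (simp add: linear_extension_superset[of "Poly_Mapping.keys p \<union> Poly_Mapping.keys q"]
      lookup_add const_add distrib_right sum.distrib)

lemma linear_extension_0 [simp]: "linear_extension N 0 = 0"
  by (simp add: linear_extension_def)

lemma linear_extension_scale: "linear_extension N (const c * p) = const c * linear_extension N p"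
proof -
  have "Poly_Mapping.keys (const c * p) \<subseteq> Poly_Mapping.keys p"
    by (auto simp: in_keys_iff lookup_scale)
  then show ?thesis
    by (simp add: linear_extension_superset[of "Poly_Mapping.keys p"] lookup_scale const_mult mult.assoc sum_distrib_left)
qed

lemma linear_extension_diff: "linear_extension N (p - q) = linear_extension N p - linear_extension N q"
  using linear_extension_add[of N p "const (- 1) * q"] linear_extension_scale[of N "- 1" q]
  by (simp add: const_uminus)

lemma linear_extension_sum: "linear_extension N (sum h A) = (\<Sum>x\<in>A. linear_extension N (h x))"
  by (induction A rule: infinite_finite_induct) (simp_all add: linear_extension_add)

lemma linear_extension_mon: "linear_extension N (mon a b c d) = N a b c d"
  by (simp add: linear_extension_def mon_def)

lemma poly_sum_monomials:
  "p = (\<Sum>m\<in>Poly_Mapping.keys p. const (Poly_Mapping.lookup p m) *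
    mon (Poly_Mapping.lookup m 0) (Poly_Mapping.lookup m 1) (Poly_Mapping.lookup m 2) (Poly_Mapping.lookup m 3))"
  unfolding mon_def expo_lookup[symmetric] by (rule poly_sum_mon)

definition degree_part :: "(nat \<Rightarrow> nat \<Rightarrow> nat \<Rightarrow> nat \<Rightarrow> bool) \<Rightarrow> nat \<Rightarrow> (nat \<times> nat \<times> nat \<times> nat) set"
  where "degree_part P j = {(a, b, c, d). a + b + c + d = j \<and> P a b c d}"

lemma finite_degree_part: "finite (degree_part P j)"
proof (rule finite_subset)
  show "degree_part P j \<subseteq> {..j} \<times> {..j} \<times> {..j} \<times> {..j}"
    by (auto simp: degree_part_def)
qed simp

abbreviation mon_tuple :: "nat \<times> nat \<times> nat \<times> nat \<Rightarrow> 'k::field pol4"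
  where "mon_tuple t \<equiv> (case t of (a, b, c, d) \<Rightarrow> mon a b c d)"

lemma inj_mon_tuple: "inj (mon_tuple :: _ \<Rightarrow> 'k::field pol4)"
proof (rule injI)
  fix s t :: "nat \<times> nat \<times> nat \<times> nat"
  assume eq: "mon_tuple s = (mon_tuple t :: 'k pol4)"
  obtain a b c d a' b' c' d' where st: "s = (a, b, c, d)" "t = (a', b', c', d')"
    by (cases s, cases t)
  have "Poly_Mapping.lookup (mon a' b' c' d' :: 'k pol4) (expo a b c d) = 1"
    using arg_cong[OF eq, of "\<lambda>p. Poly_Mapping.lookup p (expo a b c d)"] by (simp add: st lookup_mon)
  then show "s = t"
    by (simp add: st lookup_mon split: if_splits)
qed

lemma mon_tuple_independent:
  fixes c :: "'k::field pol4 \<Rightarrow> 'k"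
  assumes "finite T" "(\<Sum>b\<in>mon_tuple ` T. const (c b) * b) = 0" "b \<in> mon_tuple ` T"
  shows "c b = 0"
proof -
  obtain t where t: "t \<in> T" "b = mon_tuple t" using assms(3) by auto
  obtain t0 t1 t2 t3 where t': "t = (t0, t1, t2, t3)" by (cases t)
  have inj: "inj_on (mon_tuple :: _ \<Rightarrow> 'k pol4) T"
    using inj_mon_tuple by (rule inj_on_subset) simp
  have "0 = Poly_Mapping.lookup (\<Sum>b\<in>mon_tuple ` T. const (c b) * b) (expo t0 t1 t2 t3)"
    by (simp add: assms(2))
  also have "\<dots> = (\<Sum>s\<in>T. c (mon_tuple s) * Poly_Mapping.lookup (mon_tuple s :: 'k pol4) (expo t0 t1 t2 t3))"
    by (simp add: sum.reindex[OF inj] lookup_sum lookup_scale)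
  also have "\<dots> = (\<Sum>s\<in>T. if s = t then c b else 0)"
    by (rule sum.cong) (auto simp: t t' lookup_mon split: prod.splits)
  also have "\<dots> = c b" using assms(1) t(1) by simp
  finally show ?thesis by simp
qed

text \<open>A linear map that kills every monomial multiple of the generators, fixes the standard monomials
  and changes no residue class is a projection with kernel the ideal. Hence the standard monomials
  of a given degree form a residue basis, and the image of the projection has the cardinality of
  any residue basis as its dimension.\<close>

locale normal_form =
  fixes F :: "'k::field pol4 set" and P :: "nat \<Rightarrow> nat \<Rightarrow> nat \<Rightarrow> nat \<Rightarrow> bool"
    and R :: "nat \<Rightarrow> nat \<Rightarrow> nat \<Rightarrow> nat \<Rightarrow> 'k pol4"
  assumes reduce: "\<not> P a b c d \<Longrightarrow> mon a b c d - R a b c d \<in> ideal_gen F"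
    and R_span: "\<not> P a b c d \<Longrightarrow> R a b c d \<in> pvs.span (mon_tuple ` degree_part P (a + b + c + d))"
    and kill: "p \<in> F \<Longrightarrow> linear_extension (\<lambda>a b c d. if P a b c d then mon a b c d else R a b c d) (mon a b c d * p) = 0"
begin

abbreviation nf :: "'k pol4 \<Rightarrow> 'k pol4"
  where "nf \<equiv> linear_extension (\<lambda>a b c d. if P a b c d then mon a b c d else R a b c d)"

lemma nf_ideal: "p \<in> ideal_gen F \<Longrightarrow> nf p = 0"
proof (induction rule: ideal_gen_induct)
  case (step r p q)
  let ?c = "\<lambda>m. const (Poly_Mapping.lookup r m)"
  let ?m = "\<lambda>m. mon (Poly_Mapping.lookup m 0) (Poly_Mapping.lookup m 1) (Poly_Mapping.lookup m 2) (Poly_Mapping.lookup m 3) :: 'k pol4"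
  have "r * p = (\<Sum>m\<in>Poly_Mapping.keys r. ?c m * ?m m) * p"
    by (subst poly_sum_monomials[of r]) (rule refl)
  also have "\<dots> = (\<Sum>m\<in>Poly_Mapping.keys r. ?c m * (?m m * p))"
    by (simp only: sum_distrib_right mult.assoc)
  finally have rp: "r * p = (\<Sum>m\<in>Poly_Mapping.keys r. ?c m * (?m m * p))" .
  have "nf (r * p) = (\<Sum>m\<in>Poly_Mapping.keys r. ?c m * nf (?m m * p))"
    unfolding rp by (simp only: linear_extension_sum linear_extension_scale)
  also have "\<dots> = 0"
    by (rule sum.neutral) (simp add: kill[OF step(1)])
  finally show ?case
    using step(3) by (simp only: linear_extension_add add_0_right)
qed simp

lemma nf_reduce: "p - nf p \<in> ideal_gen F"
proof -
  let ?c = "\<lambda>m. const (Poly_Mapping.lookup p m)"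
  let ?m = "\<lambda>m. mon (Poly_Mapping.lookup m 0) (Poly_Mapping.lookup m 1) (Poly_Mapping.lookup m 2) (Poly_Mapping.lookup m 3) :: 'k pol4"
  have "p - nf p = (\<Sum>m\<in>Poly_Mapping.keys p. ?c m * ?m m) - nf p"
    by (subst (1) poly_sum_monomials[of p]) (rule refl)
  also have "\<dots> = (\<Sum>m\<in>Poly_Mapping.keys p. ?c m * (?m m - nf (?m m)))"
    by (simp only: linear_extension_def[of _ p] linear_extension_mon right_diff_distrib sum_subtractf)
  also have "\<dots> \<in> ideal_gen F"
    by (intro ideal_gen_sum ideal_gen_mult) (use reduce in \<open>simp add: linear_extension_mon ideal_gen_0\<close>)
  finally show ?thesis .
qed

lemma nf_eq_0_iff: "nf p = 0 \<longleftrightarrow> p \<in> ideal_gen F"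
proof
  assume "nf p = 0"
  then show "p \<in> ideal_gen F" using nf_reduce[of p] by simp
qed (rule nf_ideal)

lemma nf_span:
  assumes "homogeneous j p"
  shows "nf p \<in> pvs.span (mon_tuple ` degree_part P j)"
  unfolding linear_extension_def
proof (intro pvs.span_sum pvs.span_scale)
  fix m assume "m \<in> Poly_Mapping.keys p"
  then have j: "Poly_Mapping.lookup m 0 + Poly_Mapping.lookup m 1 + Poly_Mapping.lookup m 2 + Poly_Mapping.lookup m 3 = j"
    using assms by (simp add: homogeneous_def sum_index)
  show "(if P (Poly_Mapping.lookup m 0) (Poly_Mapping.lookup m 1) (Poly_Mapping.lookup m 2) (Poly_Mapping.lookup m 3)
      then mon (Poly_Mapping.lookup m 0) (Poly_Mapping.lookup m 1) (Poly_Mapping.lookup m 2) (Poly_Mapping.lookup m 3)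
      else R (Poly_Mapping.lookup m 0) (Poly_Mapping.lookup m 1) (Poly_Mapping.lookup m 2) (Poly_Mapping.lookup m 3))
    \<in> pvs.span (mon_tuple ` degree_part P j)" (is "(if ?P then ?m else ?R) \<in> _")
  proof (cases ?P)
    case True
    then have "?m \<in> mon_tuple ` degree_part P j"
      using j by (intro image_eqI[of _ _ "(Poly_Mapping.lookup m 0, Poly_Mapping.lookup m 1, Poly_Mapping.lookup m 2, Poly_Mapping.lookup m 3)"])
        (simp_all add: degree_part_def)
    then show ?thesis using True by (simp add: pvs.span_base)
  next
    case False
    then show ?thesis using R_span[OF False] j by simp
  qed
qed

lemma nf_standard: "b \<in> mon_tuple ` degree_part P j \<Longrightarrow> nf b = b \<and> homogeneous j b"
  by (auto simp: degree_part_def linear_extension_mon homogeneous_mon)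

lemma standard_residue_basis: "residue_basis (ideal_gen F) j (mon_tuple ` degree_part P j)"
  unfolding residue_basis_def
proof (intro conjI ballI allI impI)
  let ?B = "mon_tuple ` degree_part P j :: 'k pol4 set"
  show fin: "finite ?B" by (simp add: finite_degree_part)
  show "homogeneous j b" if "b \<in> ?B" for b
    using nf_standard[OF that] by simp
  show "c b = 0" if "(\<Sum>b\<in>?B. const (c b) * b) \<in> ideal_gen F" "b \<in> ?B" for c b
  proof -
    have "nf (\<Sum>b\<in>?B. const (c b) * b) = (\<Sum>b\<in>?B. const (c b) * b)"
      unfolding linear_extension_sum linear_extension_scale
      by (rule sum.cong) (use nf_standard in auto)
    then have "(\<Sum>b\<in>?B. const (c b) * b) = 0"
      using nf_ideal[OF that(1)] by simp
    from mon_tuple_independent[OF finite_degree_part this that(2)] show ?thesis .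
  qed
  show "\<exists>c. p - (\<Sum>b\<in>?B. const (c b) * b) \<in> ideal_gen F" if "homogeneous j p" for p
  proof -
    have "nf p \<in> range (\<lambda>c. \<Sum>b\<in>?B. const (c b) * b)"
      using nf_span[OF that] by (simp only: pvs.span_finite[OF fin])
    then obtain c where "nf p = (\<Sum>b\<in>?B. const (c b) * b)" by (rule rangeE)
    then have "p - (\<Sum>b\<in>?B. const (c b) * b) \<in> ideal_gen F"
      using nf_reduce[of p] by simp
    then show ?thesis by (rule exI[of _ c])
  qed
qed

lemma residue_basis_card:
  assumes B: "residue_basis (ideal_gen F) j B"
  shows "card B = pvs.dim (mon_tuple ` degree_part P j :: 'k pol4 set)"
proof -
  let ?W = "pvs.span (mon_tuple ` degree_part P j :: 'k pol4 set)"
  have fin: "finite B" using B by (simp add: residue_basis_def)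
  have B0: "\<forall>b\<in>B. c b = 0" if "(\<Sum>b\<in>B. const (c b) * nf b) = 0" for c
  proof -
    have "nf (\<Sum>b\<in>B. const (c b) * b) = 0"
      using that by (simp only: linear_extension_sum linear_extension_scale)
    then have "(\<Sum>b\<in>B. const (c b) * b) \<in> ideal_gen F"
      by (simp only: nf_eq_0_iff)
    then show ?thesis using residue_basis_indep[OF B, of c] by blast
  qed
  have inj: "inj_on nf B"
  proof (rule inj_onI, rule ccontr)
    fix p q assume pq: "p \<in> B" "q \<in> B" "nf p = nf q" "p \<noteq> q"
    let ?c = "\<lambda>b. if b = p then 1 else if b = q then - 1 else 0 :: 'k"
    have "(\<Sum>b\<in>B. const (?c b) * nf b) = (\<Sum>b\<in>B. (if b = p then nf p else 0) + (if b = q then - nf q else 0))"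
      using pq(4) by (intro sum.cong) (auto simp: const_uminus)
    also have "\<dots> = 0"
      using pq fin by (simp add: sum.distrib)
    finally have "\<forall>b\<in>B. ?c b = 0" by (rule B0)
    then show False using pq(1) by force
  qed
  have "pvs.independent (nf ` B)"
  proof
    assume "pvs.dependent (nf ` B)"
    then obtain u p where u: "p \<in> nf ` B" "u p \<noteq> 0" "(\<Sum>p\<in>nf ` B. const (u p) * p) = 0"
      using fin by (subst (asm) pvs.dependent_finite) auto
    have "(\<Sum>b\<in>B. const (u (nf b)) * nf b) = 0"
      using u(3) by (simp add: sum.reindex[OF inj])
    from B0[OF this] show False using u(1,2) by auto
  qed
  moreover have "nf ` B \<subseteq> ?W"
    using B by (auto simp: residue_basis_def intro: nf_span)
  moreover have "?W \<subseteq> pvs.span (nf ` B)"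
  proof (rule pvs.span_minimal)
    show "mon_tuple ` degree_part P j \<subseteq> pvs.span (nf ` B)"
    proof
      fix b :: "'k pol4" assume b: "b \<in> mon_tuple ` degree_part P j"
      then have "homogeneous j b" using nf_standard by blast
      then obtain c where "b - (\<Sum>b\<in>B. const (c b) * b) \<in> ideal_gen F"
        by (rule residue_basis_span[OF B])
      then have "nf (b - (\<Sum>b\<in>B. const (c b) * b)) = 0" by (rule nf_ideal)
      then have "b = (\<Sum>b\<in>B. const (c b) * nf b)"
        using nf_standard[OF b] by (simp add: linear_extension_diff linear_extension_sum linear_extension_scale)
      also have "\<dots> \<in> pvs.span (nf ` B)"
        by (intro pvs.span_sum pvs.span_scale pvs.span_base) simp
      finally show "b \<in> pvs.span (nf ` B)" .
    qed
  qed simp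
  ultimately have "card (nf ` B) = pvs.dim ?W"
    by (intro pvs.basis_card_eq_dim)
  then show ?thesis by (simp add: card_image[OF inj])
qed

theorem hilbert_fun_eq_card: "hilbert_fun (ideal_gen F) j = card (degree_part P j)"
proof -
  have "card (mon_tuple ` degree_part P j :: 'k pol4 set) = card (degree_part P j)"
    by (rule card_image[OF inj_on_subset[OF inj_mon_tuple]]) simp
  moreover have "card B = card (mon_tuple ` degree_part P j :: 'k pol4 set)" if "residue_basis (ideal_gen F) j B" for B
    using residue_basis_card[OF that] residue_basis_card[OF standard_residue_basis] by simp
  ultimately have card: "card B = card (degree_part P j)" if "residue_basis (ideal_gen F) j B" for B
    using that by simp
  show ?thesis
    unfolding hilbert_fun_def
  proof (rule the_equality)
    show "\<exists>B. residue_basis (ideal_gen F) j B \<and> card B = card (degree_part P j)"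
      using standard_residue_basis card[OF standard_residue_basis] by (intro exI conjI)
  next
    fix n assume "\<exists>B. residue_basis (ideal_gen F) j B \<and> card B = n"
    then show "n = card (degree_part P j)" by (elim exE conjE) (simp add: card)
  qed
qed

end

subsection \<open>Normal forms for the ideals of the classification\<close>

lemma ideal_gen_mon_multiple:
  fixes F :: "'k::field pol4 set"
  assumes "mon a' b' c' d' \<in> ideal_gen F" "a' \<le> a" "b' \<le> b" "c' \<le> c" "d' \<le> d"
  shows "mon a b c d \<in> ideal_gen F"
proof -
  have "mon a b c d = mon (a - a') (b - b') (c - c') (d - d') * (mon a' b' c' d' :: 'k pol4)"
    using assms(2-5) by (simp add: mon_mult)
  then show ?thesis using ideal_gen_mult[OF assms(1)] by metis
qed

text \<open>The set \<open>Z\<close> lists exponents of monomials in the ideal. Their multiples are rewritten to zero, so that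
  only few families of monomials need a nonzero rewriting rule.\<close>

lemma normal_formI:
  fixes F :: "'k::field pol4 set"
  assumes Z: "\<And>a b c d. (a, b, c, d) \<in> Z \<Longrightarrow> mon a b c d \<in> ideal_gen F"
    and reduce: "\<And>a b c d. \<not> P a b c d \<Longrightarrow>
      (\<exists>(a', b', c', d')\<in>Z. a' \<le> a \<and> b' \<le> b \<and> c' \<le> c \<and> d' \<le> d) \<and> R a b c d = 0 \<or>
      mon a b c d - R a b c d \<in> ideal_gen F \<and> R a b c d \<in> pvs.span (mon_tuple ` degree_part P (a + b + c + d))"
    and kill: "\<And>a b c d p. p \<in> F \<Longrightarrow>
      linear_extension (\<lambda>a b c d. if P a b c d then mon a b c d else R a b c d) (mon a b c d * p) = 0"
  shows "normal_form F P R"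
proof
  fix a b c d assume "\<not> P a b c d"
  from reduce[OF this] show "mon a b c d - R a b c d \<in> ideal_gen F"
    using Z ideal_gen_mon_multiple[of _ _ _ _ F a b c d] by fastforce
next
  fix a b c d assume "\<not> P a b c d"
  from reduce[OF this] show "R a b c d \<in> pvs.span (mon_tuple ` degree_part P (a + b + c + d))"
    using pvs.span_zero by auto
qed (rule kill)

lemma mon_in_span_degree_part:
  "P a b c d \<Longrightarrow> a + b + c + d = j \<Longrightarrow> mon a b c d \<in> pvs.span (mon_tuple ` degree_part P j :: 'k::field pol4 set)"
  by (rule pvs.span_base, rule image_eqI[of _ _ "(a, b, c, d)"]) (simp_all add: degree_part_def)

lemma normal_form_monomial:
  assumes F: "F = mon_tuple ` Z"
    and P: "\<And>a b c d. P a b c d \<longleftrightarrow> \<not> (\<exists>(a', b', c', d')\<in>Z. a' \<le> a \<and> b' \<le> b \<and> c' \<le> c \<and> d' \<le> d)"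
  shows "normal_form (F :: 'k::field pol4 set) P (\<lambda>_ _ _ _. 0)"
proof (rule normal_formI)
  show "mon a b c d \<in> ideal_gen F" if "(a, b, c, d) \<in> Z" for a b c d
    by (rule ideal_gen_base) (use that in \<open>force simp: F\<close>)
next
  fix a b c d assume "\<not> P a b c d"
  then show "(\<exists>(a', b', c', d')\<in>Z. a' \<le> a \<and> b' \<le> b \<and> c' \<le> c \<and> d' \<le> d) \<and> (0 :: 'k pol4) = 0 \<or>
      mon a b c d - 0 \<in> ideal_gen F \<and> 0 \<in> pvs.span (mon_tuple ` degree_part P (a + b + c + d))"
    unfolding P by simp
next
  fix a b c d and p :: "'k pol4" assume "p \<in> F"
  then obtain a' b' c' d' where p: "p = mon a' b' c' d'" "(a', b', c', d') \<in> Z"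
    by (auto simp: F)
  then have "\<not> P (a + a') (b + b') (c + c') (d + d')"
    unfolding P by force
  then show "linear_extension (\<lambda>a b c d. if P a b c d then mon a b c d else 0) (mon a b c d * p) = 0"
    by (simp add: p mon_mult linear_extension_mon)
qed

lemmas linear_extension_simps = distrib_left right_diff_distrib mon_mult linear_extension_add linear_extension_diff linear_extension_mon

lemma normal_form_i: "normal_form {x1 * x3, x1 * x4, x2 * x3, x2 * (x4 :: 'k::field pol4)}
    (\<lambda>a b c d. a = 0 \<and> b = 0 \<or> c = 0 \<and> d = 0) (\<lambda>_ _ _ _. 0)"
  by (rule normal_form_monomial[of _ "{(1,0,1,0), (1,0,0,1), (0,1,1,0), (0,1,0,1)}"])
    (simp_all add: quadratic_mon, arith)

lemma normal_form_vi: "normal_form {x1^2, x1 * x3, x2^2, x2 * (x3 :: 'k::field pol4)}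
    (\<lambda>a b c d. a \<le> 1 \<and> b \<le> 1 \<and> (a = 0 \<and> b = 0 \<or> c = 0)) (\<lambda>_ _ _ _. 0)"
  by (rule normal_form_monomial[of _ "{(2,0,0,0), (1,0,1,0), (0,2,0,0), (0,1,1,0)}"])
    (simp_all add: quadratic_mon, arith)

lemma normal_form_vii: "normal_form {x1^2, x1 * x2, x1 * x3, x2 * (x3 :: 'k::field pol4)}
    (\<lambda>a b c d. a = 0 \<and> (b = 0 \<or> c = 0) \<or> a = 1 \<and> b = 0 \<and> c = 0) (\<lambda>_ _ _ _. 0)"
  by (rule normal_form_monomial[of _ "{(2,0,0,0), (1,1,0,0), (1,0,1,0), (0,1,1,0)}"])
    (simp_all add: quadratic_mon, arith)

lemma normal_form_viii_xy: "normal_form {x1^2, x1 * x2, x2^2, x3 * (x4 :: 'k::field pol4)}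
    (\<lambda>a b c d. a + b \<le> 1 \<and> (c = 0 \<or> d = 0)) (\<lambda>_ _ _ _. 0)"
  by (rule normal_form_monomial[of _ "{(2,0,0,0), (1,1,0,0), (0,2,0,0), (0,0,1,1)}"])
    (simp_all add: quadratic_mon, arith)

lemma normal_form_viii_sq: "normal_form {x1^2, x1 * x2, x2^2, (x3 :: 'k::field pol4)^2}
    (\<lambda>a b c d. a + b \<le> 1 \<and> c \<le> 1) (\<lambda>_ _ _ _. 0)"
  by (rule normal_form_monomial[of _ "{(2,0,0,0), (1,1,0,0), (0,2,0,0), (0,0,2,0)}"])
    (simp_all add: quadratic_mon, arith)

lemma normal_form_x: "normal_form {x1^2, x1 * x2, x2^2, x1 * (x3 :: 'k::field pol4)}
    (\<lambda>a b c d. a = 0 \<and> b \<le> 1 \<or> a = 1 \<and> b = 0 \<and> c = 0) (\<lambda>_ _ _ _. 0)"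
  by (rule normal_form_monomial[of _ "{(2,0,0,0), (1,1,0,0), (0,2,0,0), (1,0,1,0)}"])
    (simp_all add: quadratic_mon, arith)

lemma ideal_gen_combination2:
  "p \<in> F \<Longrightarrow> q \<in> F \<Longrightarrow> r * p - s * q \<in> ideal_gen (F :: 'k::field pol4 set)"
  by (intro ideal_gen_diff ideal_gen_mult ideal_gen_base)

text \<open>For the ideals with a generator that is not a monomial, each further monomial in the list is a
  combination of two generators in which all other terms cancel.\<close>

lemma normal_form_ii: "normal_form {x1^2, x2^2, x3^2, x1 * x2 + x1 * x3 + x2 * (x3 :: 'k::field pol4)}
    (\<lambda>a b c d. a \<le> 1 \<and> b \<le> 1 \<and> c \<le> 1 \<and> (b = 0 \<or> c = 0))
    (\<lambda>a b c d. if a = 0 \<and> b = 1 \<and> c = 1 then - mon 1 1 0 d - mon 1 0 1 d else 0)" (is "normal_form ?F ?P ?R")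
proof (rule normal_formI[of "{(2,0,0,0), (0,2,0,0), (0,0,2,0), (1,1,1,0)}"])
  have "mon 1 1 1 0 = x1 * (x1 * x2 + x1 * x3 + x2 * x3) - (x2 + x3) * (x1^2 :: 'k pol4)"
    by (simp add: mon_eq algebra_simps power2_eq_square)
  also have "\<dots> \<in> ideal_gen ?F"
    by (rule ideal_gen_combination2) simp_all
  finally show "mon a b c d \<in> ideal_gen ?F" if "(a, b, c, d) \<in> {(2,0,0,0), (0,2,0,0), (0,0,2,0), (1,1,1,0)}" for a b c d
    using that by (auto simp: quadratic_mon intro: ideal_gen_base)
next
  fix a b c d assume P: "\<not> ?P a b c d"
  show "(\<exists>(a', b', c', d')\<in>{(2,0,0,0), (0,2,0,0), (0,0,2,0), (1,1,1,0)}. a' \<le> a \<and> b' \<le> b \<and> c' \<le> c \<and> d' \<le> d) \<and> ?R a b c d = 0 \<or>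
      mon a b c d - ?R a b c d \<in> ideal_gen ?F \<and> ?R a b c d \<in> pvs.span (mon_tuple ` degree_part ?P (a + b + c + d))"
  proof (cases "a = 0 \<and> b = 1 \<and> c = 1")
    case True
    have "mon a b c d - ?R a b c d = mon 0 0 0 d * (x1 * x2 + x1 * x3 + x2 * x3)"
      using True by (simp add: mon_eq algebra_simps)
    also have "\<dots> \<in> ideal_gen ?F"
      by (intro ideal_gen_mult ideal_gen_base) simp
    finally show ?thesis
      using True by (auto intro!: pvs.span_diff pvs.span_neg mon_in_span_degree_part)
  next
    case False
    with P show ?thesis by auto
  qed
next
  fix a b c d and p :: "'k pol4" assume "p \<in> ?F"
  then show "linear_extension (\<lambda>a b c d. if ?P a b c d then mon a b c d else ?R a b c d) (mon a b c d * p) = 0"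
    by (elim insertE emptyE; simp add: quadratic_mon linear_extension_simps; auto simp: numeral_2_eq_2)
qed

lemma normal_form_iii: "normal_form {x1^2, x2^2, x3^2, x1 * x3 + x2 * (x3 :: 'k::field pol4)}
    (\<lambda>a b c d. a \<le> 1 \<and> b \<le> 1 \<and> c \<le> 1 \<and> (b = 0 \<or> c = 0))
    (\<lambda>a b c d. if a = 0 \<and> b = 1 \<and> c = 1 then - mon 1 0 1 d else 0)" (is "normal_form ?F ?P ?R")
proof (rule normal_formI[of "{(2,0,0,0), (0,2,0,0), (0,0,2,0), (1,1,1,0)}"])
  have "mon 1 1 1 0 = x1 * (x1 * x3 + x2 * x3) - x3 * (x1^2 :: 'k pol4)"
    by (simp add: mon_eq algebra_simps power2_eq_square)
  also have "\<dots> \<in> ideal_gen ?F"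
    by (rule ideal_gen_combination2) simp_all
  finally show "mon a b c d \<in> ideal_gen ?F" if "(a, b, c, d) \<in> {(2,0,0,0), (0,2,0,0), (0,0,2,0), (1,1,1,0)}" for a b c d
    using that by (auto simp: quadratic_mon intro: ideal_gen_base)
next
  fix a b c d assume P: "\<not> ?P a b c d"
  show "(\<exists>(a', b', c', d')\<in>{(2,0,0,0), (0,2,0,0), (0,0,2,0), (1,1,1,0)}. a' \<le> a \<and> b' \<le> b \<and> c' \<le> c \<and> d' \<le> d) \<and> ?R a b c d = 0 \<or>
      mon a b c d - ?R a b c d \<in> ideal_gen ?F \<and> ?R a b c d \<in> pvs.span (mon_tuple ` degree_part ?P (a + b + c + d))"
  proof (cases "a = 0 \<and> b = 1 \<and> c = 1")
    case True
    have "mon a b c d - ?R a b c d = mon 0 0 0 d * (x1 * x3 + x2 * x3)"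
      using True by (simp add: mon_eq algebra_simps)
    also have "\<dots> \<in> ideal_gen ?F"
      by (intro ideal_gen_mult ideal_gen_base) simp
    finally show ?thesis
      using True by (auto intro!: pvs.span_neg mon_in_span_degree_part)
  next
    case False
    with P show ?thesis by auto
  qed
next
  fix a b c d and p :: "'k pol4" assume "p \<in> ?F"
  then show "linear_extension (\<lambda>a b c d. if ?P a b c d then mon a b c d else ?R a b c d) (mon a b c d * p) = 0"
    by (elim insertE emptyE; simp add: quadratic_mon linear_extension_simps; auto simp: numeral_2_eq_2)
qed

lemma normal_form_iv: "normal_form {x1^2, x1 * x2, x1 * x3 - x2^2, x3^2 :: 'k::field pol4}
    (\<lambda>a b c d. a = 0 \<and> b \<le> 1 \<and> c \<le> 1 \<or> a = 1 \<and> b = 0 \<and> c = 0 \<or> a = 0 \<and> b = 2 \<and> c = 0)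
    (\<lambda>a b c d. if a = 1 \<and> b = 0 \<and> c = 1 then mon 0 2 0 d else 0)" (is "normal_form ?F ?P ?R")
proof (rule normal_formI[of "{(2,0,0,0), (1,1,0,0), (0,0,2,0), (0,3,0,0), (0,2,1,0)}"])
  have "mon 0 3 0 0 = x3 * (x1 * x2) - x2 * (x1 * x3 - x2^2 :: 'k pol4)"
    by (simp add: mon_eq algebra_simps power2_eq_square power3_eq_cube numeral_eq_Suc)
  also have "\<dots> \<in> ideal_gen ?F"
    by (rule ideal_gen_combination2) simp_all
  finally have z0300: "mon 0 3 0 0 \<in> ideal_gen ?F" .
  have "mon 0 2 1 0 = x1 * (x3^2) - x3 * (x1 * x3 - x2^2 :: 'k pol4)"
    by (simp add: mon_eq algebra_simps power2_eq_square power3_eq_cube numeral_eq_Suc)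
  also have "\<dots> \<in> ideal_gen ?F"
    by (rule ideal_gen_combination2) simp_all
  finally have z0210: "mon 0 2 1 0 \<in> ideal_gen ?F" .
  show "mon a b c d \<in> ideal_gen ?F" if "(a, b, c, d) \<in> {(2,0,0,0), (1,1,0,0), (0,0,2,0), (0,3,0,0), (0,2,1,0)}" for a b c d
    using that z0300 z0210 by (auto simp: quadratic_mon intro: ideal_gen_base)
next
  fix a b c d assume P: "\<not> ?P a b c d"
  consider "a = 1 \<and> b = 0 \<and> c = 1" | "\<not> (a = 1 \<and> b = 0 \<and> c = 1)" by blast
  then show "(\<exists>(a', b', c', d')\<in>{(2,0,0,0), (1,1,0,0), (0,0,2,0), (0,3,0,0), (0,2,1,0)}. a' \<le> a \<and> b' \<le> b \<and> c' \<le> c \<and> d' \<le> d) \<and> ?R a b c d = 0 \<or>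
      mon a b c d - ?R a b c d \<in> ideal_gen ?F \<and> ?R a b c d \<in> pvs.span (mon_tuple ` degree_part ?P (a + b + c + d))"
  proof cases
    case 1
    have "mon a b c d - ?R a b c d = mon 0 0 0 d * (x1 * x3 - x2^2)"
      using 1 by (simp add: mon_eq algebra_simps power2_eq_square power3_eq_cube power_eq_if)
    also have "\<dots> \<in> ideal_gen ?F"
      by (intro ideal_gen_mult ideal_gen_base) simp
    finally show ?thesis
      using 1 by (auto intro!: mon_in_span_degree_part)
  next
    case 2
    with P have "?R a b c d = 0" by auto
    moreover have "\<exists>(a', b', c', d')\<in>{(2,0,0,0), (1,1,0,0), (0,0,2,0), (0,3,0,0), (0,2,1,0)}. a' \<le> a \<and> b' \<le> b \<and> c' \<le> c \<and> d' \<le> d"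
      using P 2 by simp linarith
    ultimately show ?thesis by blast
  qed
next
  fix a b c d and p :: "'k pol4" assume "p \<in> ?F"
  then show "linear_extension (\<lambda>a b c d. if ?P a b c d then mon a b c d else ?R a b c d) (mon a b c d * p) = 0"
    by (elim insertE emptyE; simp add: quadratic_mon linear_extension_simps; auto simp: numeral_2_eq_2)
qed

lemma normal_form_v: "normal_form {x1^2, x1 * x2, x1 * x3 - x2^2, x2 * x3 :: 'k::field pol4}
    (\<lambda>a b c d. a = 0 \<and> b = 0 \<or> a = 1 \<and> b = 0 \<and> c = 0 \<or> a = 0 \<and> (b = 1 \<or> b = 2) \<and> c = 0)
    (\<lambda>a b c d. if a = 1 \<and> b = 0 \<and> c = 1 then mon 0 2 0 d else 0)" (is "normal_form ?F ?P ?R")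
proof (rule normal_formI[of "{(2,0,0,0), (1,1,0,0), (0,1,1,0), (0,3,0,0), (1,0,2,0)}"])
  have "mon 0 3 0 0 = x3 * (x1 * x2) - x2 * (x1 * x3 - x2^2 :: 'k pol4)"
    by (simp add: mon_eq algebra_simps power2_eq_square power3_eq_cube numeral_eq_Suc)
  also have "\<dots> \<in> ideal_gen ?F"
    by (rule ideal_gen_combination2) simp_all
  finally have z0300: "mon 0 3 0 0 \<in> ideal_gen ?F" .
  have "mon 1 0 2 0 = x3 * (x1 * x3 - x2^2) - (- x2) * (x2 * x3 :: 'k pol4)"
    by (simp add: mon_eq algebra_simps power2_eq_square power3_eq_cube numeral_eq_Suc)
  also have "\<dots> \<in> ideal_gen ?F"
    by (rule ideal_gen_combination2) simp_all
  finally have z1020: "mon 1 0 2 0 \<in> ideal_gen ?F" .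
  show "mon a b c d \<in> ideal_gen ?F" if "(a, b, c, d) \<in> {(2,0,0,0), (1,1,0,0), (0,1,1,0), (0,3,0,0), (1,0,2,0)}" for a b c d
    using that z0300 z1020 by (auto simp: quadratic_mon intro: ideal_gen_base)
next
  fix a b c d assume P: "\<not> ?P a b c d"
  consider "a = 1 \<and> b = 0 \<and> c = 1" | "\<not> (a = 1 \<and> b = 0 \<and> c = 1)" by blast
  then show "(\<exists>(a', b', c', d')\<in>{(2,0,0,0), (1,1,0,0), (0,1,1,0), (0,3,0,0), (1,0,2,0)}. a' \<le> a \<and> b' \<le> b \<and> c' \<le> c \<and> d' \<le> d) \<and> ?R a b c d = 0 \<or>
      mon a b c d - ?R a b c d \<in> ideal_gen ?F \<and> ?R a b c d \<in> pvs.span (mon_tuple ` degree_part ?P (a + b + c + d))"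
  proof cases
    case 1
    have "mon a b c d - ?R a b c d = mon 0 0 0 d * (x1 * x3 - x2^2)"
      using 1 by (simp add: mon_eq algebra_simps power2_eq_square power3_eq_cube power_eq_if)
    also have "\<dots> \<in> ideal_gen ?F"
      by (intro ideal_gen_mult ideal_gen_base) simp
    finally show ?thesis
      using 1 by (auto intro!: mon_in_span_degree_part)
  next
    case 2
    with P have "?R a b c d = 0" by auto
    moreover have "\<exists>(a', b', c', d')\<in>{(2,0,0,0), (1,1,0,0), (0,1,1,0), (0,3,0,0), (1,0,2,0)}. a' \<le> a \<and> b' \<le> b \<and> c' \<le> c \<and> d' \<le> d"
      using P 2 by simp linarith
    ultimately show ?thesis by blast
  qed
next
  fix a b c d and p :: "'k pol4" assume "p \<in> ?F"
  then show "linear_extension (\<lambda>a b c d. if ?P a b c d then mon a b c d else ?R a b c d) (mon a b c d * p) = 0"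
    by (elim insertE emptyE; simp add: quadratic_mon linear_extension_simps; auto simp: numeral_2_eq_2)
qed

lemma normal_form_viii_cone: "normal_form {x1^2, x1 * x2, x2^2, x3^2 + x2 * x4 :: 'k::field pol4}
    (\<lambda>a b c d. a + b \<le> 1 \<and> c \<le> 1)
    (\<lambda>a b c d. if a = 0 \<and> b = 0 \<and> c = 2 then - mon 0 1 0 (d + 1) else if a = 0 \<and> b = 0 \<and> c = 3 then - mon 0 1 1 (d + 1) else 0)" (is "normal_form ?F ?P ?R")
proof (rule normal_formI[of "{(2,0,0,0), (1,1,0,0), (0,2,0,0), (1,0,2,0), (0,1,2,0), (0,0,4,0)}"])
  have "mon 1 0 2 0 = x1 * (x3^2 + x2 * x4) - x4 * (x1 * x2 :: 'k pol4)"
    by (simp add: mon_eq algebra_simps power2_eq_square power3_eq_cube numeral_eq_Suc)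
  also have "\<dots> \<in> ideal_gen ?F"
    by (rule ideal_gen_combination2) simp_all
  finally have z1020: "mon 1 0 2 0 \<in> ideal_gen ?F" .
  have "mon 0 1 2 0 = x2 * (x3^2 + x2 * x4) - x4 * (x2^2 :: 'k pol4)"
    by (simp add: mon_eq algebra_simps power2_eq_square power3_eq_cube numeral_eq_Suc)
  also have "\<dots> \<in> ideal_gen ?F"
    by (rule ideal_gen_combination2) simp_all
  finally have z0120: "mon 0 1 2 0 \<in> ideal_gen ?F" .
  have "mon 0 0 4 0 = (x3^2 - x2 * x4) * (x3^2 + x2 * x4) - (- (x4^2)) * (x2^2 :: 'k pol4)"
    by (simp add: mon_eq algebra_simps power2_eq_square power3_eq_cube numeral_eq_Suc)
  also have "\<dots> \<in> ideal_gen ?F"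
    by (rule ideal_gen_combination2) simp_all
  finally have z0040: "mon 0 0 4 0 \<in> ideal_gen ?F" .
  show "mon a b c d \<in> ideal_gen ?F" if "(a, b, c, d) \<in> {(2,0,0,0), (1,1,0,0), (0,2,0,0), (1,0,2,0), (0,1,2,0), (0,0,4,0)}" for a b c d
    using that z1020 z0120 z0040 by (auto simp: quadratic_mon intro: ideal_gen_base)
next
  fix a b c d assume P: "\<not> ?P a b c d"
  consider "a = 0 \<and> b = 0 \<and> c = 2" | "a = 0 \<and> b = 0 \<and> c = 3" | "\<not> (a = 0 \<and> b = 0 \<and> c = 2)" "\<not> (a = 0 \<and> b = 0 \<and> c = 3)" by blast
  then show "(\<exists>(a', b', c', d')\<in>{(2,0,0,0), (1,1,0,0), (0,2,0,0), (1,0,2,0), (0,1,2,0), (0,0,4,0)}. a' \<le> a \<and> b' \<le> b \<and> c' \<le> c \<and> d' \<le> d) \<and> ?R a b c d = 0 \<or>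
      mon a b c d - ?R a b c d \<in> ideal_gen ?F \<and> ?R a b c d \<in> pvs.span (mon_tuple ` degree_part ?P (a + b + c + d))"
  proof cases
    case 1
    have "mon a b c d - ?R a b c d = mon 0 0 0 d * (x3^2 + x2 * x4)"
      using 1 by (simp add: mon_eq algebra_simps power2_eq_square power3_eq_cube power_eq_if)
    also have "\<dots> \<in> ideal_gen ?F"
      by (intro ideal_gen_mult ideal_gen_base) simp
    finally show ?thesis
      using 1 by (auto intro!: pvs.span_neg mon_in_span_degree_part)
  next
    case 2
    have "mon a b c d - ?R a b c d = mon 0 0 1 d * (x3^2 + x2 * x4)"
      using 2 by (simp add: mon_eq algebra_simps power2_eq_square power3_eq_cube power_eq_if)
    also have "\<dots> \<in> ideal_gen ?F"
      by (intro ideal_gen_mult ideal_gen_base) simp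
    finally show ?thesis
      using 2 by (auto intro!: pvs.span_neg mon_in_span_degree_part)
  next
    case 3
    with P have "?R a b c d = 0" by auto
    moreover have "\<exists>(a', b', c', d')\<in>{(2,0,0,0), (1,1,0,0), (0,2,0,0), (1,0,2,0), (0,1,2,0), (0,0,4,0)}. a' \<le> a \<and> b' \<le> b \<and> c' \<le> c \<and> d' \<le> d"
      using P 3 by simp linarith
    ultimately show ?thesis by blast
  qed
next
  fix a b c d and p :: "'k pol4" assume "p \<in> ?F"
  then show "linear_extension (\<lambda>a b c d. if ?P a b c d then mon a b c d else ?R a b c d) (mon a b c d * p) = 0"
    by (elim insertE emptyE; simp add: quadratic_mon linear_extension_simps; auto simp: numeral_2_eq_2 le_Suc_eq)
qed

lemma normal_form_ix: "normal_form {x1^2, x1 * x2, x2^2, x1 * x4 - x2 * x3 :: 'k::field pol4}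
    (\<lambda>a b c d. a = 0 \<and> b \<le> 1 \<or> a = 1 \<and> b = 0 \<and> d = 0)
    (\<lambda>a b c d. if a = 1 \<and> b = 0 then mon 0 1 (c + 1) (d - 1) else 0)" (is "normal_form ?F ?P ?R")
proof (rule normal_formI[of "{(2,0,0,0), (1,1,0,0), (0,2,0,0)}"])
  show "mon a b c d \<in> ideal_gen ?F" if "(a, b, c, d) \<in> {(2,0,0,0), (1,1,0,0), (0,2,0,0)}" for a b c d
    using that  by (auto simp: quadratic_mon intro: ideal_gen_base)
next
  fix a b c d assume P: "\<not> ?P a b c d"
  consider "a = 1 \<and> b = 0 \<and> d \<noteq> 0" | "\<not> (a = 1 \<and> b = 0 \<and> d \<noteq> 0)" by blast
  then show "(\<exists>(a', b', c', d')\<in>{(2,0,0,0), (1,1,0,0), (0,2,0,0)}. a' \<le> a \<and> b' \<le> b \<and> c' \<le> c \<and> d' \<le> d) \<and> ?R a b c d = 0 \<or>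
      mon a b c d - ?R a b c d \<in> ideal_gen ?F \<and> ?R a b c d \<in> pvs.span (mon_tuple ` degree_part ?P (a + b + c + d))"
  proof cases
    case 1
    have "mon a b c d - ?R a b c d = mon 0 0 c (d - 1) * (x1 * x4 - x2 * x3)"
      using 1 by (simp add: mon_eq algebra_simps power2_eq_square power3_eq_cube power_eq_if)
    also have "\<dots> \<in> ideal_gen ?F"
      by (intro ideal_gen_mult ideal_gen_base) simp
    finally show ?thesis
      using 1 by (auto intro!: mon_in_span_degree_part)
  next
    case 2
    with P have "?R a b c d = 0" by auto
    moreover have "\<exists>(a', b', c', d')\<in>{(2,0,0,0), (1,1,0,0), (0,2,0,0)}. a' \<le> a \<and> b' \<le> b \<and> c' \<le> c \<and> d' \<le> d"
      using P 2 by simp linarith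
    ultimately show ?thesis by blast
  qed
next
  fix a b c d and p :: "'k pol4" assume "p \<in> ?F"
  then show "linear_extension (\<lambda>a b c d. if ?P a b c d then mon a b c d else ?R a b c d) (mon a b c d * p) = 0"
    by (elim insertE emptyE; simp add: quadratic_mon linear_extension_simps; auto simp: numeral_2_eq_2)
qed


subsection \<open>Counting standard monomials\<close>

lemma card_degree_part_0_1:
  assumes "P 0 0 0 0" "P 1 0 0 0" "P 0 1 0 0" "P 0 0 1 0" "P 0 0 0 1"
  shows "card (degree_part P 0) = 1" "card (degree_part P 1) = 4"
proof -
  have "degree_part P 0 = {(0,0,0,0)}" using assms by (auto simp: degree_part_def)
  then show "card (degree_part P 0) = 1" by simp
  have "degree_part P 1 = {(1,0,0,0), (0,1,0,0), (0,0,1,0), (0,0,0,1)}"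
  proof (rule set_eqI)
    fix t :: "nat \<times> nat \<times> nat \<times> nat"
    obtain a b c d where t: "t = (a, b, c, d)" by (cases t)
    have "a + b + c + d = 1 \<longleftrightarrow> (a,b,c,d) = (1,0,0,0) \<or> (a,b,c,d) = (0,1,0,0) \<or> (a,b,c,d) = (0,0,1,0) \<or> (a,b,c,d) = (0,0,0,1)"
      by auto
    then show "t \<in> degree_part P 1 \<longleftrightarrow> t \<in> {(1,0,0,0), (0,1,0,0), (0,0,1,0), (0,0,0,1)}"
      using assms unfolding t degree_part_def by auto
  qed
  then show "card (degree_part P 1) = 4" by simp
qed

lemma degree_part_eqI:
  assumes "\<And>a b c d. (a, b, c, d) \<in> T \<longleftrightarrow> a + b + c + d = j \<and> P a b c d"
  shows "degree_part P j = T"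
  unfolding degree_part_def using assms by auto

lemma card_degree_part_disj:
  assumes "card (degree_part P j) = m" "card (degree_part Q j) = n" "\<And>a b c d. P a b c d \<Longrightarrow> Q a b c d \<Longrightarrow> False"
  shows "card (degree_part (\<lambda>a b c d. P a b c d \<or> Q a b c d) j) = m + n"
proof -
  have "degree_part (\<lambda>a b c d. P a b c d \<or> Q a b c d) j = degree_part P j \<union> degree_part Q j"
    by (auto simp: degree_part_def)
  moreover have "degree_part P j \<inter> degree_part Q j = {}"
    using assms(3) by (auto simp: degree_part_def)
  ultimately show ?thesis
    using assms(1,2) by (simp add: card_Un_disjoint finite_degree_part)
qed

lemma card_degree_part_point:
  "a0 + b0 + c0 \<le> j \<Longrightarrow> card (degree_part (\<lambda>a b c d. a = a0 \<and> b = b0 \<and> c = c0) j) = 1"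
proof -
  assume "a0 + b0 + c0 \<le> j"
  then have "degree_part (\<lambda>a b c d. a = a0 \<and> b = b0 \<and> c = c0) j = {(a0, b0, c0, j - (a0 + b0 + c0))}"
    by (intro degree_part_eqI) auto
  then show ?thesis by simp
qed

lemma card_degree_part_point_z:
  "a0 + b0 < j \<Longrightarrow> card (degree_part (\<lambda>a b c d. a = a0 \<and> b = b0 \<and> c > 0 \<and> d = 0) j) = 1"
proof -
  assume "a0 + b0 < j"
  then have "degree_part (\<lambda>a b c d. a = a0 \<and> b = b0 \<and> c > 0 \<and> d = 0) j = {(a0, b0, j - (a0 + b0), 0)}"
    by (intro degree_part_eqI) auto
  then show ?thesis by simp
qed

lemma card_degree_part_point_z': "Suc 0 \<le> j \<Longrightarrow> card (degree_part (\<lambda>a b c d. a = 1 \<and> b = 0 \<and> d = 0) j) = 1"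
proof -
  assume "Suc 0 \<le> j"
  then have "degree_part (\<lambda>a b c d. a = 1 \<and> b = 0 \<and> d = 0) j = {(1, 0, j - 1, 0)}"
    by (intro degree_part_eqI) auto
  then show ?thesis by simp
qed

lemma card_degree_part_line_zw:
  "a0 + b0 \<le> j \<Longrightarrow> card (degree_part (\<lambda>a b c d. a = a0 \<and> b = b0) j) = Suc (j - (a0 + b0))"
proof -
  assume "a0 + b0 \<le> j"
  then have "degree_part (\<lambda>a b c d. a = a0 \<and> b = b0) j = (\<lambda>c. (a0, b0, c, j - (a0 + b0) - c)) ` {..j - (a0 + b0)}"
    by (intro degree_part_eqI) (auto simp: image_iff)
  moreover have "card ((\<lambda>c. (a0, b0, c, j - (a0 + b0) - c)) ` {..j - (a0 + b0)}) = Suc (j - (a0 + b0))"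
    by (subst card_image) (auto intro: inj_onI)
  ultimately show ?thesis by simp
qed

lemma card_degree_part_line_xy:
  "Suc 0 \<le> j \<Longrightarrow> card (degree_part (\<lambda>a b c d. (a > 0 \<or> b > 0) \<and> c = 0 \<and> d = 0) j) = Suc j"
proof -
  assume "Suc 0 \<le> j"
  then have "degree_part (\<lambda>a b c d. (a > 0 \<or> b > 0) \<and> c = 0 \<and> d = 0) j = (\<lambda>a. (a, j - a, 0, 0)) ` {..j}"
    by (intro degree_part_eqI) (auto simp: image_iff)
  moreover have "card ((\<lambda>a. (a, j - a, 0, 0)) ` {..j}) = Suc j"
    by (subst card_image) (auto intro: inj_onI)
  ultimately show ?thesis by simp
qed

lemma card_degree_part_line_yw: "card (degree_part (\<lambda>a b c d. a = 0 \<and> b > 0 \<and> c = 0) j) = j"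
proof -
  have "degree_part (\<lambda>a b c d. a = 0 \<and> b > 0 \<and> c = 0) j = (\<lambda>b. (0, b, 0, j - b)) ` {1..j}"
    by (intro degree_part_eqI) (auto simp: image_iff)
  moreover have "card ((\<lambda>b. (0::nat, b, 0::nat, j - b)) ` {1..j}) = j"
    by (subst card_image) (auto intro: inj_onI)
  ultimately show ?thesis by simp
qed


lemma add_le_1_iff: "a + b \<le> 1 \<longleftrightarrow> a = 0 \<and> b = 0 \<or> a = 1 \<and> b = 0 \<or> a = 0 \<and> b = (1::nat)"
  by linarith

lemma hilbert_ii: "hilbert_fun (ideal_ii :: 'k::field pol4 set) 0 = 1"
    "hilbert_fun (ideal_ii :: 'k pol4 set) 1 = 4"
    "j \<ge> 2 \<Longrightarrow> hilbert_fun (ideal_ii :: 'k pol4 set) j = 6"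
proof -
  note hilb = normal_form.hilbert_fun_eq_card[OF normal_form_ii, folded ideal_ii_def]
  show "hilbert_fun (ideal_ii :: 'k pol4 set) 0 = 1"
    "hilbert_fun (ideal_ii :: 'k pol4 set) 1 = 4"
    unfolding hilb by (rule card_degree_part_0_1; simp)+
  assume j: "j \<ge> 2"
  have P: "(\<lambda>(a::nat) (b::nat) (c::nat) (d::nat). a \<le> 1 \<and> b \<le> 1 \<and> c \<le> 1 \<and> (b = 0 \<or> c = 0))
      = (\<lambda>a b c d. a = 0 \<and> b = 0 \<and> c = 0 \<or> a = 1 \<and> b = 0 \<and> c = 0 \<or> a = 0 \<and> b = 1 \<and> c = 0 \<or> a = 0 \<and> b = 0 \<and> c = 1 \<or> a = 1 \<and> b = 1 \<and> c = 0 \<or> a = 1 \<and> b = 0 \<and> c = 1)"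
    by (intro ext) (auto simp: le_Suc_eq)
  show "hilbert_fun (ideal_ii :: 'k pol4 set) j = 6"
    unfolding hilb P by (rule trans[OF card_degree_part_disj[OF card_degree_part_point card_degree_part_disj[OF card_degree_part_point card_degree_part_disj[OF card_degree_part_point card_degree_part_disj[OF card_degree_part_point card_degree_part_disj[OF card_degree_part_point card_degree_part_point]]]]]]) (use j in auto)
qed

lemma hilbert_iii: "hilbert_fun (ideal_iii :: 'k::field pol4 set) 0 = 1"
    "hilbert_fun (ideal_iii :: 'k pol4 set) 1 = 4"
    "j \<ge> 2 \<Longrightarrow> hilbert_fun (ideal_iii :: 'k pol4 set) j = 6"
proof -
  note hilb = normal_form.hilbert_fun_eq_card[OF normal_form_iii, folded ideal_iii_def]
  show "hilbert_fun (ideal_iii :: 'k pol4 set) 0 = 1"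
    "hilbert_fun (ideal_iii :: 'k pol4 set) 1 = 4"
    unfolding hilb by (rule card_degree_part_0_1; simp)+
  assume j: "j \<ge> 2"
  have P: "(\<lambda>(a::nat) (b::nat) (c::nat) (d::nat). a \<le> 1 \<and> b \<le> 1 \<and> c \<le> 1 \<and> (b = 0 \<or> c = 0))
      = (\<lambda>a b c d. a = 0 \<and> b = 0 \<and> c = 0 \<or> a = 1 \<and> b = 0 \<and> c = 0 \<or> a = 0 \<and> b = 1 \<and> c = 0 \<or> a = 0 \<and> b = 0 \<and> c = 1 \<or> a = 1 \<and> b = 1 \<and> c = 0 \<or> a = 1 \<and> b = 0 \<and> c = 1)"
    by (intro ext) (auto simp: le_Suc_eq)
  show "hilbert_fun (ideal_iii :: 'k pol4 set) j = 6"
    unfolding hilb P by (rule trans[OF card_degree_part_disj[OF card_degree_part_point card_degree_part_disj[OF card_degree_part_point card_degree_part_disj[OF card_degree_part_point card_degree_part_disj[OF card_degree_part_point card_degree_part_disj[OF card_degree_part_point card_degree_part_point]]]]]]) (use j in auto)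
qed

lemma hilbert_iv: "hilbert_fun (ideal_iv :: 'k::field pol4 set) 0 = 1"
    "hilbert_fun (ideal_iv :: 'k pol4 set) 1 = 4"
    "j \<ge> 2 \<Longrightarrow> hilbert_fun (ideal_iv :: 'k pol4 set) j = 6"
proof -
  note hilb = normal_form.hilbert_fun_eq_card[OF normal_form_iv, folded ideal_iv_def]
  show "hilbert_fun (ideal_iv :: 'k pol4 set) 0 = 1"
    "hilbert_fun (ideal_iv :: 'k pol4 set) 1 = 4"
    unfolding hilb by (rule card_degree_part_0_1; simp)+
  assume j: "j \<ge> 2"
  have P: "(\<lambda>(a::nat) (b::nat) (c::nat) (d::nat). a = 0 \<and> b \<le> 1 \<and> c \<le> 1 \<or> a = 1 \<and> b = 0 \<and> c = 0 \<or> a = 0 \<and> b = 2 \<and> c = 0)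
      = (\<lambda>a b c d. a = 0 \<and> b = 0 \<and> c = 0 \<or> a = 1 \<and> b = 0 \<and> c = 0 \<or> a = 0 \<and> b = 1 \<and> c = 0 \<or> a = 0 \<and> b = 0 \<and> c = 1 \<or> a = 0 \<and> b = 2 \<and> c = 0 \<or> a = 0 \<and> b = 1 \<and> c = 1)"
    by (intro ext) (auto simp: le_Suc_eq)
  show "hilbert_fun (ideal_iv :: 'k pol4 set) j = 6"
    unfolding hilb P by (rule trans[OF card_degree_part_disj[OF card_degree_part_point card_degree_part_disj[OF card_degree_part_point card_degree_part_disj[OF card_degree_part_point card_degree_part_disj[OF card_degree_part_point card_degree_part_disj[OF card_degree_part_point card_degree_part_point]]]]]]) (use j in auto)
qed

lemma hilbert_viii_xy: "hilbert_fun (ideal_viii (x3 * x4) :: 'k::field pol4 set) 0 = 1"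
    "hilbert_fun (ideal_viii (x3 * x4) :: 'k pol4 set) 1 = 4"
    "j \<ge> 2 \<Longrightarrow> hilbert_fun (ideal_viii (x3 * x4) :: 'k pol4 set) j = 6"
proof -
  note hilb = normal_form.hilbert_fun_eq_card[OF normal_form_viii_xy, folded ideal_viii_def]
  show "hilbert_fun (ideal_viii (x3 * x4) :: 'k pol4 set) 0 = 1"
    "hilbert_fun (ideal_viii (x3 * x4) :: 'k pol4 set) 1 = 4"
    unfolding hilb by (rule card_degree_part_0_1; simp)+
  assume j: "j \<ge> 2"
  have P: "(\<lambda>(a::nat) (b::nat) (c::nat) (d::nat). a + b \<le> 1 \<and> (c = 0 \<or> d = 0))
      = (\<lambda>a b c d. a = 0 \<and> b = 0 \<and> c = 0 \<or> a = 1 \<and> b = 0 \<and> c = 0 \<or> a = 0 \<and> b = 1 \<and> c = 0 \<or> a = 0 \<and> b = 0 \<and> c > 0 \<and> d = 0 \<or> a = 1 \<and> b = 0 \<and> c > 0 \<and> d = 0 \<or> a = 0 \<and> b = 1 \<and> c > 0 \<and> d = 0)"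
    by (intro ext, unfold add_le_1_iff, auto simp: le_Suc_eq)
  show "hilbert_fun (ideal_viii (x3 * x4) :: 'k pol4 set) j = 6"
    unfolding hilb P by (rule trans[OF card_degree_part_disj[OF card_degree_part_point card_degree_part_disj[OF card_degree_part_point card_degree_part_disj[OF card_degree_part_point card_degree_part_disj[OF card_degree_part_point_z card_degree_part_disj[OF card_degree_part_point_z card_degree_part_point_z]]]]]]) (use j in auto)
qed

lemma hilbert_viii_cone: "hilbert_fun (ideal_viii (x3^2 + x2 * x4) :: 'k::field pol4 set) 0 = 1"
    "hilbert_fun (ideal_viii (x3^2 + x2 * x4) :: 'k pol4 set) 1 = 4"
    "j \<ge> 2 \<Longrightarrow> hilbert_fun (ideal_viii (x3^2 + x2 * x4) :: 'k pol4 set) j = 6"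
proof -
  note hilb = normal_form.hilbert_fun_eq_card[OF normal_form_viii_cone, folded ideal_viii_def]
  show "hilbert_fun (ideal_viii (x3^2 + x2 * x4) :: 'k pol4 set) 0 = 1"
    "hilbert_fun (ideal_viii (x3^2 + x2 * x4) :: 'k pol4 set) 1 = 4"
    unfolding hilb by (rule card_degree_part_0_1; simp)+
  assume j: "j \<ge> 2"
  have P: "(\<lambda>(a::nat) (b::nat) (c::nat) (d::nat). a + b \<le> 1 \<and> c \<le> 1)
      = (\<lambda>a b c d. a = 0 \<and> b = 0 \<and> c = 0 \<or> a = 1 \<and> b = 0 \<and> c = 0 \<or> a = 0 \<and> b = 1 \<and> c = 0 \<or> a = 0 \<and> b = 0 \<and> c = 1 \<or> a = 1 \<and> b = 0 \<and> c = 1 \<or> a = 0 \<and> b = 1 \<and> c = 1)"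
    by (intro ext, unfold add_le_1_iff, auto simp: le_Suc_eq)
  show "hilbert_fun (ideal_viii (x3^2 + x2 * x4) :: 'k pol4 set) j = 6"
    unfolding hilb P by (rule trans[OF card_degree_part_disj[OF card_degree_part_point card_degree_part_disj[OF card_degree_part_point card_degree_part_disj[OF card_degree_part_point card_degree_part_disj[OF card_degree_part_point card_degree_part_disj[OF card_degree_part_point card_degree_part_point]]]]]]) (use j in auto)
qed

lemma hilbert_viii_sq: "hilbert_fun (ideal_viii (x3^2) :: 'k::field pol4 set) 0 = 1"
    "hilbert_fun (ideal_viii (x3^2) :: 'k pol4 set) 1 = 4"
    "j \<ge> 2 \<Longrightarrow> hilbert_fun (ideal_viii (x3^2) :: 'k pol4 set) j = 6"
proof -
  note hilb = normal_form.hilbert_fun_eq_card[OF normal_form_viii_sq, folded ideal_viii_def]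
  show "hilbert_fun (ideal_viii (x3^2) :: 'k pol4 set) 0 = 1"
    "hilbert_fun (ideal_viii (x3^2) :: 'k pol4 set) 1 = 4"
    unfolding hilb by (rule card_degree_part_0_1; simp)+
  assume j: "j \<ge> 2"
  have P: "(\<lambda>(a::nat) (b::nat) (c::nat) (d::nat). a + b \<le> 1 \<and> c \<le> 1)
      = (\<lambda>a b c d. a = 0 \<and> b = 0 \<and> c = 0 \<or> a = 1 \<and> b = 0 \<and> c = 0 \<or> a = 0 \<and> b = 1 \<and> c = 0 \<or> a = 0 \<and> b = 0 \<and> c = 1 \<or> a = 1 \<and> b = 0 \<and> c = 1 \<or> a = 0 \<and> b = 1 \<and> c = 1)"
    by (intro ext, unfold add_le_1_iff, auto simp: le_Suc_eq)
  show "hilbert_fun (ideal_viii (x3^2) :: 'k pol4 set) j = 6"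
    unfolding hilb P by (rule trans[OF card_degree_part_disj[OF card_degree_part_point card_degree_part_disj[OF card_degree_part_point card_degree_part_disj[OF card_degree_part_point card_degree_part_disj[OF card_degree_part_point card_degree_part_disj[OF card_degree_part_point card_degree_part_point]]]]]]) (use j in auto)
qed

lemma hilbert_v: "hilbert_fun (ideal_v :: 'k::field pol4 set) 0 = 1"
    "hilbert_fun (ideal_v :: 'k pol4 set) 1 = 4"
    "j \<ge> 2 \<Longrightarrow> hilbert_fun (ideal_v :: 'k pol4 set) j = j + 4"
proof -
  note hilb = normal_form.hilbert_fun_eq_card[OF normal_form_v, folded ideal_v_def]
  show "hilbert_fun (ideal_v :: 'k pol4 set) 0 = 1"
    "hilbert_fun (ideal_v :: 'k pol4 set) 1 = 4"
    unfolding hilb by (rule card_degree_part_0_1; simp)+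
  assume j: "j \<ge> 2"
  have P: "(\<lambda>(a::nat) (b::nat) (c::nat) (d::nat). a = 0 \<and> b = 0 \<or> a = 1 \<and> b = 0 \<and> c = 0 \<or> a = 0 \<and> (b = 1 \<or> b = 2) \<and> c = 0)
      = (\<lambda>a b c d. a = 0 \<and> b = 0 \<or> a = 1 \<and> b = 0 \<and> c = 0 \<or> a = 0 \<and> b = 1 \<and> c = 0 \<or> a = 0 \<and> b = 2 \<and> c = 0)"
    by (intro ext) (auto simp: le_Suc_eq)
  show "hilbert_fun (ideal_v :: 'k pol4 set) j = j + 4"
    unfolding hilb P by (rule trans[OF card_degree_part_disj[OF card_degree_part_line_zw card_degree_part_disj[OF card_degree_part_point card_degree_part_disj[OF card_degree_part_point card_degree_part_point]]]]) (use j in auto)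
qed

lemma hilbert_vi: "hilbert_fun (ideal_vi :: 'k::field pol4 set) 0 = 1"
    "hilbert_fun (ideal_vi :: 'k pol4 set) 1 = 4"
    "j \<ge> 2 \<Longrightarrow> hilbert_fun (ideal_vi :: 'k pol4 set) j = j + 4"
proof -
  note hilb = normal_form.hilbert_fun_eq_card[OF normal_form_vi, folded ideal_vi_def]
  show "hilbert_fun (ideal_vi :: 'k pol4 set) 0 = 1"
    "hilbert_fun (ideal_vi :: 'k pol4 set) 1 = 4"
    unfolding hilb by (rule card_degree_part_0_1; simp)+
  assume j: "j \<ge> 2"
  have P: "(\<lambda>(a::nat) (b::nat) (c::nat) (d::nat). a \<le> 1 \<and> b \<le> 1 \<and> (a = 0 \<and> b = 0 \<or> c = 0))
      = (\<lambda>a b c d. a = 0 \<and> b = 0 \<or> a = 1 \<and> b = 0 \<and> c = 0 \<or> a = 0 \<and> b = 1 \<and> c = 0 \<or> a = 1 \<and> b = 1 \<and> c = 0)"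
    by (intro ext) (auto simp: le_Suc_eq)
  show "hilbert_fun (ideal_vi :: 'k pol4 set) j = j + 4"
    unfolding hilb P by (rule trans[OF card_degree_part_disj[OF card_degree_part_line_zw card_degree_part_disj[OF card_degree_part_point card_degree_part_disj[OF card_degree_part_point card_degree_part_point]]]]) (use j in auto)
qed

lemma hilbert_i: "hilbert_fun (ideal_i :: 'k::field pol4 set) 0 = 1"
    "j \<ge> 1 \<Longrightarrow> hilbert_fun (ideal_i :: 'k pol4 set) j = 2 * j + 2"
proof -
  note hilb = normal_form.hilbert_fun_eq_card[OF normal_form_i, folded ideal_i_def]
  show "hilbert_fun (ideal_i :: 'k pol4 set) 0 = 1"
    unfolding hilb by (rule card_degree_part_0_1; simp)+
  assume j: "j \<ge> 1"
  have P: "(\<lambda>(a::nat) (b::nat) (c::nat) (d::nat). a = 0 \<and> b = 0 \<or> c = 0 \<and> d = 0)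
      = (\<lambda>a b c d. a = 0 \<and> b = 0 \<or> (a > 0 \<or> b > 0) \<and> c = 0 \<and> d = 0)"
    by (intro ext) (auto simp: le_Suc_eq)
  show "hilbert_fun (ideal_i :: 'k pol4 set) j = 2 * j + 2"
    unfolding hilb P by (rule trans[OF card_degree_part_disj[OF card_degree_part_line_zw card_degree_part_line_xy]]) (use j in auto)
qed

lemma hilbert_vii: "hilbert_fun (ideal_vii :: 'k::field pol4 set) 0 = 1"
    "j \<ge> 1 \<Longrightarrow> hilbert_fun (ideal_vii :: 'k pol4 set) j = 2 * j + 2"
proof -
  note hilb = normal_form.hilbert_fun_eq_card[OF normal_form_vii, folded ideal_vii_def]
  show "hilbert_fun (ideal_vii :: 'k pol4 set) 0 = 1"
    unfolding hilb by (rule card_degree_part_0_1; simp)+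
  assume j: "j \<ge> 1"
  have P: "(\<lambda>(a::nat) (b::nat) (c::nat) (d::nat). a = 0 \<and> (b = 0 \<or> c = 0) \<or> a = 1 \<and> b = 0 \<and> c = 0)
      = (\<lambda>a b c d. a = 0 \<and> b = 0 \<or> a = 0 \<and> b > 0 \<and> c = 0 \<or> a = 1 \<and> b = 0 \<and> c = 0)"
    by (intro ext) (auto simp: le_Suc_eq)
  show "hilbert_fun (ideal_vii :: 'k pol4 set) j = 2 * j + 2"
    unfolding hilb P by (rule trans[OF card_degree_part_disj[OF card_degree_part_line_zw card_degree_part_disj[OF card_degree_part_line_yw card_degree_part_point]]]) (use j in auto)
qed

lemma hilbert_ix: "hilbert_fun (ideal_ix :: 'k::field pol4 set) 0 = 1"
    "j \<ge> 1 \<Longrightarrow> hilbert_fun (ideal_ix :: 'k pol4 set) j = 2 * j + 2"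
proof -
  note hilb = normal_form.hilbert_fun_eq_card[OF normal_form_ix, folded ideal_ix_def]
  show "hilbert_fun (ideal_ix :: 'k pol4 set) 0 = 1"
    unfolding hilb by (rule card_degree_part_0_1; simp)+
  assume j: "j \<ge> 1"
  have P: "(\<lambda>(a::nat) (b::nat) (c::nat) (d::nat). a = 0 \<and> b \<le> 1 \<or> a = 1 \<and> b = 0 \<and> d = 0)
      = (\<lambda>a b c d. a = 0 \<and> b = 0 \<or> a = 0 \<and> b = 1 \<or> a = 1 \<and> b = 0 \<and> d = 0)"
    by (intro ext) (auto simp: le_Suc_eq)
  show "hilbert_fun (ideal_ix :: 'k pol4 set) j = 2 * j + 2"
    unfolding hilb P by (rule trans[OF card_degree_part_disj[OF card_degree_part_line_zw card_degree_part_disj[OF card_degree_part_line_zw card_degree_part_point_z']]]) (use j in auto)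
qed

lemma hilbert_x: "hilbert_fun (ideal_x :: 'k::field pol4 set) 0 = 1"
    "j \<ge> 1 \<Longrightarrow> hilbert_fun (ideal_x :: 'k pol4 set) j = 2 * j + 2"
proof -
  note hilb = normal_form.hilbert_fun_eq_card[OF normal_form_x, folded ideal_x_def]
  show "hilbert_fun (ideal_x :: 'k pol4 set) 0 = 1"
    unfolding hilb by (rule card_degree_part_0_1; simp)+
  assume j: "j \<ge> 1"
  have P: "(\<lambda>(a::nat) (b::nat) (c::nat) (d::nat). a = 0 \<and> b \<le> 1 \<or> a = 1 \<and> b = 0 \<and> c = 0)
      = (\<lambda>a b c d. a = 0 \<and> b = 0 \<or> a = 0 \<and> b = 1 \<or> a = 1 \<and> b = 0 \<and> c = 0)"
    by (intro ext) (auto simp: le_Suc_eq)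
  show "hilbert_fun (ideal_x :: 'k pol4 set) j = 2 * j + 2"
    unfolding hilb P by (rule trans[OF card_degree_part_disj[OF card_degree_part_line_zw card_degree_part_disj[OF card_degree_part_line_zw card_degree_part_point]]]) (use j in auto)
qed

section \<open>Quadrics with a singular Jacobian matrix\<close>

subsection \<open>Functions that are polynomial along every line\<close>

text \<open>Polynomial functions are compared on lines, where the theory of polynomials in one variable
  applies. Sums, products and determinants of such functions are of the same kind.\<close>

definition line_poly :: "('k::field^4 \<Rightarrow> 'k) \<Rightarrow> bool"
  where "line_poly g \<longleftrightarrow> (\<forall>v u. \<exists>P. \<forall>t. g (v + t *s u) = poly P t)"

lemma line_polyE:
  assumes "line_poly g"
  obtains P where "\<And>t. g (v + t *s u) = poly P t"
  using assms unfolding line_poly_def by blast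

lemma line_poly_const [intro]: "line_poly (\<lambda>v. c)"
  unfolding line_poly_def by (intro allI exI[of _ "[:c:]"]) simp

lemma line_poly_add [intro]: "line_poly g \<Longrightarrow> line_poly h \<Longrightarrow> line_poly (\<lambda>v. g v + h v)"
  unfolding line_poly_def by (metis poly_add)

lemma line_poly_diff [intro]: "line_poly g \<Longrightarrow> line_poly h \<Longrightarrow> line_poly (\<lambda>v. g v - h v)"
  unfolding line_poly_def by (metis poly_diff)

lemma line_poly_mult [intro]: "line_poly g \<Longrightarrow> line_poly h \<Longrightarrow> line_poly (\<lambda>v. g v * h v)"
  unfolding line_poly_def by (metis poly_mult)

lemma line_poly_sum: "(\<And>x. x \<in> A \<Longrightarrow> line_poly (g x)) \<Longrightarrow> line_poly (\<lambda>v. \<Sum>x\<in>A. g x v)"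
  by (induction A rule: infinite_finite_induct) auto

lemma line_poly_prod: "(\<And>x. x \<in> A \<Longrightarrow> line_poly (g x)) \<Longrightarrow> line_poly (\<lambda>v. \<Prod>x\<in>A. g x v)"
  by (induction A rule: infinite_finite_induct) auto

lemma line_poly_det: "(\<And>i j. line_poly (\<lambda>v. A v $ i $ j)) \<Longrightarrow> line_poly (\<lambda>v. det (A v :: 'k::field^4^4))"
  unfolding det_def by (intro line_poly_sum line_poly_mult line_poly_const line_poly_prod)

lemma line_poly_linform: "linform x \<Longrightarrow> line_poly (\<lambda>v. ev x v)"
proof -
  assume x: "linform x"
  have "ev x (v + t *s u) = poly [:ev x v, ev x u:] t" for v u t
    by (simp add: ev_linform_add[OF x] ev_linform_scale[OF x])
  then show ?thesis unfolding line_poly_def by blast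
qed

lemma line_poly_polar:
  assumes f: "homogeneous 2 f"
  shows "line_poly (\<lambda>v. polar f v w)" "line_poly (\<lambda>v. polar f v v)"
proof -
  have "polar f (v + t *s u) w = poly [:polar f v w, polar f u w:] t" for v u t
    by (simp add: polar_bilinear[OF f])
  then show "line_poly (\<lambda>v. polar f v w)" unfolding line_poly_def by blast
  have "polar f (v + t *s u) (v + t *s u) = poly [:polar f v v, polar f v u + polar f u v, polar f u u:] t" for v u t
    by (simp add: polar_bilinear[OF f] algebra_simps)
  then show "line_poly (\<lambda>v. polar f v v)" unfolding line_poly_def by blast
qed

lemma poly_zero_cofinite:
  fixes P Q :: "'k::field_char_0 poly"
  assumes "poly P a \<noteq> 0" "\<And>t. poly P t \<noteq> 0 \<Longrightarrow> poly Q t = 0"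
  shows "Q = 0"
proof (rule ccontr)
  assume "Q \<noteq> 0"
  moreover have "P \<noteq> 0" using assms(1) by auto
  ultimately have "P * Q \<noteq> 0" by simp
  then have "finite {t. poly (P * Q) t = 0}" by (rule poly_roots_finite)
  moreover have "{t. poly (P * Q) t = 0} = UNIV" using assms(2) by auto
  ultimately have "finite (UNIV :: 'k set)" by metis
  then show False using infinite_UNIV_char_0[where 'a='k] by blast
qed

text \<open>On the line from \<open>a\<close> to \<open>b\<close> the first function has finitely many zeros, so the second one has
  infinitely many.\<close>

lemma line_poly_dense:
  fixes g h :: "'k::field_char_0^4 \<Rightarrow> 'k"
  assumes "line_poly g" "line_poly h" "g a \<noteq> 0" "\<And>v. g v \<noteq> 0 \<Longrightarrow> h v = 0"
  shows "h b = 0"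
proof -
  obtain P where P: "\<And>t. g (a + t *s (b - a)) = poly P t" using line_polyE[OF assms(1)] by blast
  obtain Q where Q: "\<And>t. h (a + t *s (b - a)) = poly Q t" using line_polyE[OF assms(2)] by blast
  have "poly P 0 \<noteq> 0" using P[of 0] assms(3) by simp
  then have "Q = 0"
    by (rule poly_zero_cofinite) (use assms(4) P Q in metis)
  then show ?thesis using Q[of 1] by simp
qed

lemma line_poly_common_nonzero:
  fixes g h :: "'k::field_char_0^4 \<Rightarrow> 'k"
  assumes "line_poly g" "line_poly h" "g a \<noteq> 0" "h b \<noteq> 0"
  obtains v where "g v \<noteq> 0" "h v \<noteq> 0"
  using line_poly_dense[OF assms(1-3), of b] assms(4) by blast

subsection \<open>Completing vectors and linear forms to bases\<close>

lemma vector_outside_span3: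
  fixes a b c :: "'k::field^4"
  obtains d where "\<And>p q r. d \<noteq> p *s a + q *s b + r *s c"
proof -
  have "vec.dim {a, b, c} \<le> card {a, b, c}"
    by (rule vec.dim_le_card) (auto intro: vec.span_base)
  also have "\<dots> < 4"
    by (rule le_less_trans[OF card_insert_le_m1[of 3]]) (auto intro: card_insert_le_m1)
  finally have "vec.dim {a, b, c} < 4" .
  moreover have "vec.dim (UNIV :: ('k^4) set) = 4"
    unfolding vec_dim_card by simp
  ultimately have "vec.span {a, b, c} \<noteq> UNIV"
    by (metis vec.dim_span less_irrefl)
  then obtain d where "d \<notin> vec.span {a, b, c}" by auto
  moreover have "p *s a + q *s b + r *s c \<in> vec.span {a, b, c}" for p q r
    by (intro vec.span_scale vec.span_add vec.span_base) auto
  ultimately show thesis using that by metis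
qed

lemma vector_combination_eq_0D:
  fixes u d :: "'k::field^'n"
  assumes "u + s *s d = 0" "s \<noteq> 0"
  shows "d = (- inverse s) *s u"
proof -
  have "u = - (s *s d)" using assms(1) by (simp add: eq_neg_iff_add_eq_0)
  then have "(- inverse s) *s u = (- inverse s) *s (- (s *s d))" by simp
  also have "\<dots> = d" using assms(2) by (simp add: vec_eq_iff)
  finally show ?thesis by simp
qed

lemma extend_independent_vectors:
  fixes a b :: "'k::field^4"
  assumes ab: "\<And>p q. p *s a + q *s b = 0 \<Longrightarrow> p = 0 \<and> q = 0"
  obtains c d where "\<And>p q r s. p *s a + q *s b + r *s c + s *s d = 0 \<Longrightarrow> p = 0 \<and> q = 0 \<and> r = 0 \<and> s = 0"
proof -
  obtain c where c: "\<And>p q r. c \<noteq> p *s a + q *s b + r *s b" using vector_outside_span3[of a b b] by blast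
  obtain d where d: "\<And>p q r. d \<noteq> p *s a + q *s b + r *s c" using vector_outside_span3[of a b c] by blast
  have "p = 0 \<and> q = 0 \<and> r = 0 \<and> s = 0" if eq: "p *s a + q *s b + r *s c + s *s d = 0" for p q r s
  proof -
    have s: "s = 0"
    proof (rule ccontr)
      assume "s \<noteq> 0"
      from vector_combination_eq_0D[OF eq this]
      have "d = (- inverse s * p) *s a + (- inverse s * q) *s b + (- inverse s * r) *s c"
        by (simp add: vec_eq_iff algebra_simps)
      then show False using d by blast
    qed
    have r: "r = 0"
    proof (rule ccontr)
      assume "r \<noteq> 0"
      have "p *s a + q *s b + r *s c = 0" using eq s by simp
      from vector_combination_eq_0D[OF this \<open>r \<noteq> 0\<close>]
      have "c = (- inverse r * p) *s a + (- inverse r * q) *s b + 0 *s b"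
        by (simp add: vec_eq_iff algebra_simps)
      then show False using c by blast
    qed
    have "p *s a + q *s b = 0" using eq r s by simp
    then show ?thesis using ab r s by blast
  qed
  then show thesis using that by blast
qed

lemma dual_coords:
  fixes w0 w1 w2 w3 :: "'k::field^4"
  assumes ind: "\<And>p q r s. p *s w0 + q *s w1 + r *s w2 + s *s w3 = 0 \<Longrightarrow> p = 0 \<and> q = 0 \<and> r = 0 \<and> s = 0"
  obtains y0 y1 y2 y3 where "coords y0 y1 y2 y3"
    "ev y0 w0 = 1" "ev y0 w1 = 0" "ev y0 w2 = 0" "ev y0 w3 = 0"
    "ev y1 w0 = 0" "ev y1 w1 = 1" "ev y1 w2 = 0" "ev y1 w3 = 0"
    "ev y2 w0 = 0" "ev y2 w1 = 0" "ev y2 w2 = 1" "ev y2 w3 = 0"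
    "ev y3 w0 = 0" "ev y3 w1 = 0" "ev y3 w2 = 0" "ev y3 w3 = 1"
proof -
  define h :: "'k^4^4" where "h = (\<chi> j i. if i = 0 then w0 $ j else if i = 1 then w1 $ j else if i = 2 then w2 $ j else w3 $ j)"
  have h: "h *v v = v $ 0 *s w0 + v $ 1 *s w1 + v $ 2 *s w2 + v $ 3 *s w3" for v
    by (simp add: vec_eq_iff matrix_vector_mult_def h_def sum_index mult.commute)
  have "v = 0" if "h *v v = 0" for v
    using ind[OF that[unfolded h]] by (simp add: vec_eq_iff all_index)
  then have "invertible h"
    by (simp add: invertible_left_inverse matrix_left_invertible_ker)
  then obtain k where k: "k ** h = mat 1" by (auto simp: invertible_def)
  define y where "y i = (\<Sum>j\<in>UNIV. const (k $ i $ j) * var j)" for i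
  have lin: "linform (y i)" for i unfolding y_def by (rule linformI[OF refl])
  have ev: "ev (y i) v = (k *v v) $ i" for i v
    by (simp add: y_def matrix_vector_mult_def)
  have "w0 = h *v axis 0 1" "w1 = h *v axis 1 1" "w2 = h *v axis 2 1" "w3 = h *v axis 3 1"
    by (simp_all add: h axis_def)
  then have w: "ev (y i) w0 = axis 0 1 $ i" "ev (y i) w1 = axis 1 1 $ i" "ev (y i) w2 = axis 2 1 $ i" "ev (y i) w3 = axis 3 1 $ i" for i
    unfolding ev by (simp_all add: matrix_vector_mul_assoc k)
  have "ind4 (y 0) (y 1) (y 2) (y 3)"
    unfolding ind4_def
  proof (intro allI impI)
    fix a b c d assume *: "const a * y 0 + const b * y 1 + const c * y 2 + const d * y 3 = 0"
    have "a * ev (y 0) v + b * ev (y 1) v + c * ev (y 2) v + d * ev (y 3) v = 0" for v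
      using arg_cong[OF *, of "\<lambda>p. ev p v"] by simp
    from this[of w0] this[of w1] this[of w2] this[of w3] show "a = 0 \<and> b = 0 \<and> c = 0 \<and> d = 0"
      by (simp add: w axis_def)
  qed
  then have "coords (y 0) (y 1) (y 2) (y 3)"
    by (simp add: coords_def lin)
  then show thesis
    by (rule that) (simp_all add: w axis_def)
qed

lemma coords_extend:
  assumes xy: "linform x" "linform y" and ind: "\<And>a b. const a * x + const b * y = 0 \<Longrightarrow> a = 0 \<and> b = 0"
  obtains z w where "coords x y z w"
proof -
  obtain a where a: "x = (\<Sum>i\<in>UNIV. const (a i) * var i)" using xy(1)[unfolded linform_def] ..
  obtain b where b: "y = (\<Sum>i\<in>UNIV. const (b i) * var i)" using xy(2)[unfolded linform_def] ..
  define form where "form v = (\<Sum>i\<in>UNIV. const (v $ i) * var i)" for v :: "'a^4"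
  have form_add: "form (u + v) = form u + form v" for u v
    by (simp add: form_def const_add distrib_right sum.distrib)
  have form_scale: "form (c *s v) = const c * form v" for c v
    by (simp add: form_def const_mult sum_distrib_left mult.assoc)
  have form_0: "v = 0" if "form v = 0" for v
  proof -
    have "ev (form v) (axis i 1) = v $ i" for i
      by (rule index_cases[of i]) (simp_all add: form_def sum_index axis_def)
    then show ?thesis using that by (simp add: vec_eq_iff)
  qed
  have x: "x = form (\<chi> i. a i)" and y: "y = form (\<chi> i. b i)"
    by (simp_all add: form_def a b)
  obtain c d where cd: "\<And>p q r s. p *s (\<chi> i. a i) + q *s (\<chi> i. b i) + r *s c + s *s d = 0 \<Longrightarrow> p = 0 \<and> q = 0 \<and> r = 0 \<and> s = 0"
  proof (rule extend_independent_vectors[of "\<chi> i. a i" "\<chi> i. b i"])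
    fix p q assume "p *s (\<chi> i. a i) + q *s (\<chi> i. b i) = (0 :: 'a^4)"
    then have "form (p *s (\<chi> i. a i) + q *s (\<chi> i. b i)) = 0" by (simp add: form_def)
    then show "p = 0 \<and> q = 0" using ind by (simp only: form_add form_scale x[symmetric] y[symmetric])
  qed blast
  have "ind4 x y (form c) (form d)"
    unfolding ind4_def
  proof (intro allI impI)
    fix p q r s assume "const p * x + const q * y + const r * form c + const s * form d = 0"
    then have "form (p *s (\<chi> i. a i) + q *s (\<chi> i. b i) + r *s c + s *s d) = 0"
      by (simp only: form_add form_scale x y)
    then show "p = 0 \<and> q = 0 \<and> r = 0 \<and> s = 0" using form_0 cd by blast
  qed
  moreover have "linform (form c)" "linform (form d)"
    unfolding form_def by (rule linformI[OF refl])+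
  ultimately show thesis
    using that xy by (simp add: coords_def)
qed

lemma common_zero_of_dependent_forms:
  assumes lin: "linform x" "linform y" "linform z" "linform (w :: 'k::field pol4)" and dep: "\<not> coords x y z w"
  obtains e where "e \<noteq> 0" "ev x e = 0" "ev y e = 0" "ev z e = 0" "ev w e = 0"
proof -
  have "\<not> ind4 x y z w" using lin dep by (simp add: coords_def)
  then obtain a b c d where abcd: "const a * x + const b * y + const c * z + const d * w = 0" "\<not> (a = 0 \<and> b = 0 \<and> c = 0 \<and> d = 0)"
    unfolding ind4_def by blast
  define A :: "'k^4^4" where "A = (\<chi> i j. ev (if i = 0 then x else if i = 1 then y else if i = 2 then z else w) (axis j 1))"
  have ax: "ev p v = (\<Sum>j\<in>UNIV. ev p (axis j 1) * v $ j)" if "linform p" for p v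
  proof -
    have "v = v $ 0 *s axis 0 1 + v $ 1 *s axis 1 1 + v $ 2 *s axis 2 1 + v $ 3 *s axis 3 1"
      unfolding vec_eq_iff all_index by (simp add: axis_def)
    then have "ev p v = ev p (v $ 0 *s axis 0 1 + v $ 1 *s axis 1 1 + v $ 2 *s axis 2 1 + v $ 3 *s axis 3 1)"
      by simp
    then show ?thesis
      by (simp only: ev_linform_add[OF that] ev_linform_scale[OF that] sum_index) (simp add: mult.commute)
  qed
  define u :: "'k^4" where "u = (\<chi> i. if i = 0 then a else if i = 1 then b else if i = 2 then c else d)"
  have "u v* A = 0"
  proof -
    have "(u v* A) $ j = ev (const a * x + const b * y + const c * z + const d * w) (axis j 1)" for j
      by (simp add: vector_matrix_mult_def A_def u_def sum_index mult.commute)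
    then show ?thesis by (simp add: abcd(1) vec_eq_iff)
  qed
  moreover have "u \<noteq> 0" using abcd(2) by (auto simp: u_def vec_eq_iff all_index)
  ultimately have "\<not> invertible (transpose A)"
    by (auto simp: invertible_left_inverse matrix_left_invertible_ker)
  then have "\<not> invertible A" by (simp add: invertible_det_nz det_transpose)
  then obtain e where e: "A *v e = 0" "e \<noteq> 0"
    by (auto simp: invertible_left_inverse matrix_left_invertible_ker)
  have "(A *v e) $ i = 0" for i by (simp add: e)
  from this[of 0] this[of 1] this[of 2] this[of 3] show thesis
    by (intro that[OF e(2)]) (simp_all add: ax[OF lin(1), of e] ax[OF lin(2), of e] ax[OF lin(3), of e] ax[OF lin(4), of e] matrix_vector_mult_def A_def)
qed

subsection \<open>Kernels of singular matrices\<close>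

text \<open>By Cramer's rule a rank one perturbation of a singular matrix that makes it invertible
  determines the kernel of the matrix as a vector of polynomials in the entries.\<close>

definition cramer_vector :: "'k::field^4^4 \<Rightarrow> 'k^4 \<Rightarrow> 'k^4"
  where "cramer_vector N a = (\<chi> k. det (\<chi> i j. if j = k then a $ i else N $ i $ j))"

definition perturb :: "'k::field^4^4 \<Rightarrow> 'k^4 \<Rightarrow> 'k^4 \<Rightarrow> 'k^4^4"
  where "perturb A a b = (\<chi> i j. A $ i $ j + a $ i * b $ j)"

lemma perturb_mult: "perturb A a b *v y = A *v y + (\<Sum>j\<in>UNIV. b $ j * y $ j) *s a"
  by (simp add: vec_eq_iff perturb_def matrix_vector_mult_def sum_index algebra_simps)

lemma matrix_vector_scale: "A *v (c *s v) = c *s (A *v (v :: 'k::field^'n))"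
  by (simp add: vec_eq_iff matrix_vector_mult_def sum_distrib_left mult.left_commute)

lemma transpose_perturb: "transpose (perturb A a b) = perturb (transpose A) b a"
  by (simp add: vec_eq_iff perturb_def transpose_def mult.commute)

lemma cramer_kernel:
  assumes N: "det (perturb A a b) \<noteq> 0" and A: "det A = 0"
  defines "s \<equiv> cramer_vector (perturb A a b) a"
  shows "s \<noteq> 0" "A *v s = 0" "A *v y = 0 \<Longrightarrow> \<exists>t. y = t *s s"
proof -
  let ?N = "perturb A a b"
  let ?d = "det ?N"
  have "?N *v ((1 / ?d) *s s) = a"
    unfolding cramer[OF N, of _ a] by (simp add: vec_eq_iff s_def cramer_vector_def divide_inverse mult.commute)
  then have "?d *s ((1 / ?d) *s (?N *v s)) = ?d *s a"
    by (simp only: matrix_vector_scale)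
  then have Ns: "?N *v s = ?d *s a"
    using N by simp
  have inj: "y = z" if "?N *v y = ?N *v z" for y z
  proof -
    obtain k where "k ** ?N = mat 1" using N by (auto simp: invertible_det_nz[symmetric] invertible_def)
    then show ?thesis using arg_cong[OF that, of "\<lambda>x. k *v x"] by (simp add: matrix_vector_mul_assoc)
  qed
  have ker: "\<exists>t. y = t *s s" "y \<noteq> 0 \<Longrightarrow> s \<noteq> 0 \<and> A *v s = 0" if y: "A *v y = 0" for y
  proof -
    define r where "r = (\<Sum>j\<in>UNIV. b $ j * y $ j)"
    have Ny: "?N *v y = r *s a" by (simp add: perturb_mult y r_def)
    have "?N *v (?d *s y) = ?d *s (r *s a)" by (simp only: matrix_vector_scale Ny)
    also have "\<dots> = r *s (?d *s a)" by (simp add: mult.commute)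
    also have "\<dots> = ?N *v (r *s s)" by (simp only: matrix_vector_scale Ns)
    finally have dy: "?d *s y = r *s s" by (rule inj)
    then have "y = (r / ?d) *s s"
      using N by (simp add: vec_eq_iff field_simps)
    then show "\<exists>t. y = t *s s" by blast
    assume "y \<noteq> 0"
    then have "?d *s y \<noteq> 0" using N by (simp add: vector_mul_eq_0)
    then have rs: "r \<noteq> 0" "s \<noteq> 0" unfolding dy by (auto simp: vector_mul_eq_0)
    have "s = (?d / r) *s y"
      using dy rs(1) by (simp add: vec_eq_iff field_simps)
    then have "A *v s = (?d / r) *s (A *v y)" by (simp only: matrix_vector_scale)
    then show "s \<noteq> 0 \<and> A *v s = 0" using rs y by simp
  qed
  have "\<not> invertible A" using A by (simp add: invertible_det_nz)
  then obtain z where "A *v z = 0" "z \<noteq> 0"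
    by (auto simp: invertible_left_inverse matrix_left_invertible_ker)
  with ker(2) show "s \<noteq> 0" "A *v s = 0" by blast+
  show "A *v y = 0 \<Longrightarrow> \<exists>t. y = t *s s" by (rule ker(1))
qed

text \<open>If the kernel of the transpose is a line, then \<open>A\<close> has rank three, and adding the product of a column
  outside the column space and a row outside the row space makes it invertible.\<close>

lemma perturb_invertible:
  fixes A :: "'k::field^4^4"
  assumes A: "det A = 0" and ker: "\<And>y. transpose A *v y = 0 \<Longrightarrow> \<exists>t. y = t *s c"
  obtains a b where "det (perturb A a b) \<noteq> 0"
proof -
  let ?B = "transpose A"
  have nB: "\<not> invertible ?B" using A by (simp add: invertible_det_nz)
  then obtain y where y: "?B *v y = 0" "y \<noteq> 0"
    by (auto simp: invertible_left_inverse matrix_left_invertible_ker)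
  from y(2) obtain i where i: "y $ i \<noteq> 0" by (auto simp: vec_eq_iff)
  from nB have "\<not> surj ((*v) ?B)"
    by (simp add: invertible_right_inverse matrix_right_invertible_surjective)
  then obtain b where b: "\<And>x. ?B *v x \<noteq> b" by (auto simp: surj_def) metis
  define a :: "'k^4" where "a = axis i 1"
  have "x = 0" if x: "perturb ?B b a *v x = 0" for x
  proof -
    have sum: "(\<Sum>j\<in>UNIV. a $ j * x $ j) = x $ i"
      unfolding a_def axis_def by (simp add: if_distrib[of "\<lambda>z. z * _"] cong: if_cong)
    have eq: "?B *v x + x $ i *s b = 0"
      using x unfolding perturb_mult sum .
    have xi: "x $ i = 0"
    proof (rule ccontr)
      assume "x $ i \<noteq> 0"
      from vector_combination_eq_0D[OF eq this] have "?B *v ((- inverse (x $ i)) *s x) = b"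
        by (simp only: matrix_vector_scale)
      then show False using b by blast
    qed
    then have "?B *v x = 0" using eq by simp
    with ker obtain t where t: "x = t *s c" by blast
    from ker[OF y(1)] obtain t' where t': "y = t' *s c" by blast
    have "c $ i \<noteq> 0" using i t' by auto
    then have "t = 0" using xi t by simp
    then show "x = 0" using t by simp
  qed
  then have "det (perturb ?B b a) \<noteq> 0"
    by (simp add: invertible_det_nz[symmetric] invertible_left_inverse matrix_left_invertible_ker)
  then have "det (transpose (perturb ?B b a)) \<noteq> 0" by simp
  then show thesis
    by (intro that[of a b]) (simp add: transpose_perturb)
qed

context four_quadrics
begin

lemma comb_hom: "homogeneous 2 (comb c)"
  by (rule hom_V) blast

text \<open>The Jacobian matrix of the four quadrics at a point. Its kernel consists of the directions that are
  orthogonal to the point for all quadrics in \<open>V\<close>, and the kernel of its transpose describes the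
  members of \<open>V\<close> that are singular at the point.\<close>

definition polar_matrix :: "'k^4 \<Rightarrow> 'k^4^4"
  where "polar_matrix v = (\<chi> k j. polar (f k) v (axis j 1))"

lemma polar_expansion:
  assumes "homogeneous 2 q"
  shows "polar q v s = (\<Sum>j\<in>UNIV. s $ j * polar q v (axis j 1))"
proof -
  have s: "s = s $ 0 *s axis 0 1 + s $ 1 *s axis 1 1 + s $ 2 *s axis 2 1 + s $ 3 *s axis 3 1"
    unfolding vec_eq_iff all_index by (simp add: axis_def)
  have "polar q v s = polar q v (s $ 0 *s axis 0 1 + s $ 1 *s axis 1 1 + s $ 2 *s axis 2 1 + s $ 3 *s axis 3 1)"
    using s by simp
  then show ?thesis
    by (simp only: polar_bilinear[OF assms] sum_index)
qed

lemma polar_matrix_mult: "(polar_matrix v *v s) $ k = polar (f k) v s"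
  unfolding polar_expansion[OF hom_f, of k v s] by (simp add: polar_matrix_def matrix_vector_mult_def mult.commute)

lemma polar_comb: "polar (comb c) v w = (\<Sum>k\<in>UNIV. c $ k * polar (f k) v w)"
  by (simp add: comb_def)

lemma polar_matrix_mult_eq_0_iff: "polar_matrix v *v s = 0 \<longleftrightarrow> (\<forall>q\<in>V. polar q v s = 0)"
proof
  assume *: "polar_matrix v *v s = 0"
  have "polar (f k) v s = 0" for k
    unfolding polar_matrix_mult[symmetric] * by simp
  then show "\<forall>q\<in>V. polar q v s = 0"
    by (auto simp: V_def polar_comb)
next
  assume "\<forall>q\<in>V. polar q v s = 0"
  then show "polar_matrix v *v s = 0"
    by (simp add: vec_eq_iff polar_matrix_mult f_in_V)
qed

lemma transpose_polar_matrix_mult_eq_0_iff: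
  "transpose (polar_matrix v) *v c = 0 \<longleftrightarrow> (\<forall>w. polar (comb c) v w = 0)"
proof -
  have eq: "(transpose (polar_matrix v) *v c) $ j = polar (comb c) v (axis j 1)" for j
    unfolding polar_comb by (simp add: polar_matrix_def transpose_def matrix_vector_mult_def mult.commute del: transpose_matrix_vector)
  show ?thesis
  proof
    assume "transpose (polar_matrix v) *v c = 0"
    then have "polar (comb c) v (axis j 1) = 0" for j
      unfolding eq[symmetric] by simp
    then show "\<forall>w. polar (comb c) v w = 0"
      by (subst polar_expansion[OF comb_hom]) simp
  next
    assume "\<forall>w. polar (comb c) v w = 0"
    then show "transpose (polar_matrix v) *v c = 0"
      by (simp only: vec_eq_iff eq zero_index simp_thms)
  qed
qed

lemma line_poly_polar_matrix: "line_poly (\<lambda>v. polar_matrix v $ k $ j)"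
  unfolding polar_matrix_def by (simp add: line_poly_polar(1)[OF hom_f])

lemma det_polar_matrix_eq_0_iff: "det (polar_matrix v) = 0 \<longleftrightarrow> (\<exists>q\<in>V. q \<noteq> 0 \<and> (\<forall>w. polar q v w = 0))"
proof -
  have "det (polar_matrix v) = 0 \<longleftrightarrow> \<not> invertible (transpose (polar_matrix v))"
    by (simp add: invertible_det_nz det_transpose)
  also have "\<dots> \<longleftrightarrow> (\<exists>c. transpose (polar_matrix v) *v c = 0 \<and> c \<noteq> 0)"
    unfolding invertible_left_inverse matrix_left_invertible_ker by blast
  also have "\<dots> \<longleftrightarrow> (\<exists>q\<in>V. q \<noteq> 0 \<and> (\<forall>w. polar q v w = 0))"
    unfolding transpose_polar_matrix_mult_eq_0_iff V_def using comb_eq_0_iff by auto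
  finally show ?thesis .
qed

end

text \<open>Rank three at some point is expressed by the coefficient vectors of the quadrics that are
  singular there: they form at most a line.\<close>

locale degenerate_quadrics = four_quadrics f for f :: "4 \<Rightarrow> 'k::{alg_closed_field, field_char_0} pol4" +
  assumes singular: "det (polar_matrix v) = 0"
    and rank3: "\<exists>v0 c0. \<forall>c. (\<forall>w. polar (comb c) v0 w = 0) \<longrightarrow> (\<exists>t. c = t *s c0)"
begin

text \<open>A rank one perturbation that makes the Jacobian matrix invertible at one point does so at every
  general point, so Cramer's rule describes both kernels there by polynomial formulas.\<close>

lemma generic_kernels:
  obtains \<omega> and s p :: "'k^4 \<Rightarrow> 'k^4" where "line_poly \<omega>" "\<exists>v. \<omega> v \<noteq> 0"
    "\<forall>k. line_poly (\<lambda>v. s v $ k)" "\<forall>k. line_poly (\<lambda>v. p v $ k)"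
    "\<forall>v. \<omega> v \<noteq> 0 \<longrightarrow> s v \<noteq> 0 \<and> (\<forall>q\<in>V. polar q v (s v) = 0)"
    "\<forall>v. \<omega> v \<noteq> 0 \<longrightarrow> p v \<noteq> 0 \<and> (\<forall>w. polar (comb (p v)) v w = 0)"
    "\<forall>v c. \<omega> v \<noteq> 0 \<longrightarrow> (\<forall>w. polar (comb c) v w = 0) \<longrightarrow> (\<exists>t. c = t *s p v)"
proof -
  obtain v0 c0 where v0: "\<And>c. (\<forall>w. polar (comb c) v0 w = 0) \<Longrightarrow> \<exists>t. c = t *s c0"
    using rank3 by blast
  obtain a b where ab: "det (perturb (polar_matrix v0) a b) \<noteq> 0"
    by (rule perturb_invertible[OF singular, of v0 c0]) (use v0 in \<open>simp only: transpose_polar_matrix_mult_eq_0_iff\<close>)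
  define N where "N v = perturb (polar_matrix v) a b" for v
  define N' where "N' v = perturb (transpose (polar_matrix v)) b a" for v
  have detN': "det (N' v) = det (N v)" for v
    unfolding N'_def N_def transpose_perturb[symmetric] by simp
  have dt: "det (transpose (polar_matrix v)) = 0" for v using singular by simp
  have lN: "line_poly (\<lambda>v. N v $ k $ j)" "line_poly (\<lambda>v. N' v $ k $ j)" for k j
    unfolding N_def N'_def perturb_def transpose_def using line_poly_polar_matrix
    by (auto intro!: line_poly_add)
  have cv: "line_poly (\<lambda>v. cramer_vector (A v) a $ k)" if "\<And>i j. line_poly (\<lambda>v. A v $ i $ j)" for A :: "'k^4 \<Rightarrow> 'k^4^4" and a k
  proof -
    have "line_poly (\<lambda>v. (\<chi> i j. if j = k then a $ i else A v $ i $ j) $ i $ j)" for i j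
      using that by (cases "j = k") auto
    then show ?thesis
      unfolding cramer_vector_def by (simp add: line_poly_det)
  qed
  show thesis
  proof (rule that[of "\<lambda>v. det (N v)" "\<lambda>v. cramer_vector (N v) a" "\<lambda>v. cramer_vector (N' v) b"]; (intro allI impI)?)
    show "line_poly (\<lambda>v. det (N v))" by (rule line_poly_det[OF lN(1)])
    show "\<exists>v. det (N v) \<noteq> 0" using ab by (auto simp: N_def)
    show "line_poly (\<lambda>v. cramer_vector (N v) a $ k)" "line_poly (\<lambda>v. cramer_vector (N' v) b $ k)" for k
      by (rule cv[OF lN(1)], rule cv[OF lN(2)])
  next
    fix v assume "det (N v) \<noteq> 0"
    from cramer_kernel(1,2)[OF this[unfolded N_def] singular]
    show "cramer_vector (N v) a \<noteq> 0 \<and> (\<forall>q\<in>V. polar q v (cramer_vector (N v) a) = 0)"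
      by (simp add: N_def polar_matrix_mult_eq_0_iff)
  next
    fix v assume "det (N v) \<noteq> 0"
    then have "det (N' v) \<noteq> 0" unfolding detN' .
    note ker = cramer_kernel(1,2)[OF this[unfolded N'_def] dt, folded N'_def]
    from ker(2) have "\<forall>w. polar (comb (cramer_vector (N' v) b)) v w = 0"
      unfolding transpose_polar_matrix_mult_eq_0_iff .
    with ker(1) show "cramer_vector (N' v) b \<noteq> 0 \<and> (\<forall>w. polar (comb (cramer_vector (N' v) b)) v w = 0)"
      by blast
  next
    fix v c assume nz: "det (N v) \<noteq> 0" and c: "\<forall>w. polar (comb c) v w = 0"
    have "det (N' v) \<noteq> 0" using nz unfolding detN' .
    have "transpose (polar_matrix v) *v c = 0"
      using c unfolding transpose_polar_matrix_mult_eq_0_iff .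
    from cramer_kernel(3)[OF \<open>det (N' v) \<noteq> 0\<close>[unfolded N'_def] dt this, folded N'_def]
    show "\<exists>t. c = t *s cramer_vector (N' v) b" .
  qed
qed

text \<open>The member $F$ of \<open>V\<close> that is singular at a general point $v$ is also singular at the kernel vector
  $s(v)$. In fact, as $F$ is singular at $v$ and $s(v+tw)$ is orthogonal to $v+tw$ for all members of \<open>V\<close>,
  the polar form of $F$ satisfies $t\,F(w,s(v+tw))=F(v+tw,s(v+tw))=0$ for almost all $t$. Cancelling $t$
  and putting $t=0$ gives $F(w,s(v))=0$. Where some quadric of \<open>V\<close> does not vanish at $v$, the vector
  $s(v)$ is not a multiple of $v$, so $F$ has rank at most two.\<close>

lemma generic_singular_quadric:
  obtains \<omega> and s :: "'k^4 \<Rightarrow> 'k^4" and F where "line_poly \<omega>" "\<exists>v. \<omega> v \<noteq> 0"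
    "\<forall>w w'. line_poly (\<lambda>v. polar (F v) w w')"
    "\<forall>v. \<omega> v \<noteq> 0 \<longrightarrow> F v \<in> V \<and> F v \<noteq> 0 \<and> (\<forall>w. polar (F v) v w = 0) \<and> (\<forall>w. polar (F v) (s v) w = 0)"
    "\<forall>v q. \<omega> v \<noteq> 0 \<longrightarrow> q \<in> V \<longrightarrow> (\<forall>w. polar q v w = 0) \<longrightarrow> (\<exists>t. q = const t * F v)"
    "\<forall>v q. \<omega> v \<noteq> 0 \<longrightarrow> q \<in> V \<longrightarrow> polar q v (s v) = 0"
    "\<forall>v a b. \<omega> v \<noteq> 0 \<longrightarrow> a *s v + b *s s v = 0 \<longrightarrow> a = 0 \<and> b = 0"
proof -
  obtain \<omega> and s p :: "'k^4 \<Rightarrow> 'k^4" where lp: "line_poly \<omega>" and nz: "\<exists>v. \<omega> v \<noteq> 0"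
    and ls': "\<forall>k. line_poly (\<lambda>v. s v $ k)" and lpp': "\<forall>k. line_poly (\<lambda>v. p v $ k)"
    and s': "\<forall>v. \<omega> v \<noteq> 0 \<longrightarrow> s v \<noteq> 0 \<and> (\<forall>q\<in>V. polar q v (s v) = 0)"
    and p': "\<forall>v. \<omega> v \<noteq> 0 \<longrightarrow> p v \<noteq> 0 \<and> (\<forall>w. polar (comb (p v)) v w = 0)"
    and pu': "\<forall>v c. \<omega> v \<noteq> 0 \<longrightarrow> (\<forall>w. polar (comb c) v w = 0) \<longrightarrow> (\<exists>t. c = t *s p v)"
    by (rule generic_kernels)
  note ls = ls'[rule_format] and lpp = lpp'[rule_format] and s = s'[rule_format] and p = p'[rule_format] and pu = pu'[rule_format]
  define F where "F v = comb (p v)" for v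
  have f0: "f 0 \<noteq> 0"
  proof
    assume "f 0 = 0"
    then have "comb (axis 0 1) = 0" by (simp add: comb_def sum_index axis_def)
    then have "axis 0 (1::'k) $ (0::4) = 0" by (simp add: comb_eq_0_iff)
    then show False by simp
  qed
  obtain u where u: "polar (f 0) u u \<noteq> 0"
  proof -
    have "\<exists>u. ev (f 0) u \<noteq> 0"
      using f0 quadric_eqI[OF hom_f[of 0] homogeneous_0] by fastforce
    then show thesis using that by (auto simp: polar_self[OF hom_f])
  qed
  define \<omega>' where "\<omega>' v = \<omega> v * polar (f 0) v v" for v
  have lp': "line_poly \<omega>'"
    unfolding \<omega>'_def by (intro line_poly_mult lp line_poly_polar(2) hom_f)
  have nz': "\<exists>v. \<omega>' v \<noteq> 0"
  proof -
    obtain a where "\<omega> a \<noteq> 0" using nz by blast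
    then obtain v where "\<omega> v \<noteq> 0" "polar (f 0) v v \<noteq> 0"
      by (rule line_poly_common_nonzero[OF lp line_poly_polar(2)[OF hom_f] _ u])
    then show ?thesis by (auto simp: \<omega>'_def)
  qed
  have kills_s: "polar (F v) w (s v) = 0" if v: "\<omega> v \<noteq> 0" for v w
  proof -
    have hF: "homogeneous 2 (F v)" unfolding F_def by (rule comb_hom)
    obtain P where P: "\<And>t. \<omega> (v + t *s w) = poly P t" using line_polyE[OF lp] by blast
    have eq: "(\<lambda>u. polar (F v) w (s u)) = (\<lambda>u. \<Sum>j\<in>UNIV. s u $ j * polar (F v) w (axis j 1))"
      by (rule ext) (rule polar_expansion[OF hF])
    have "line_poly (\<lambda>u. polar (F v) w (s u))"
      unfolding eq by (intro line_poly_sum line_poly_mult ls line_poly_const)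
    then obtain Q where Q: "\<And>t. polar (F v) w (s (v + t *s w)) = poly Q t" using line_polyE by blast
    have "[:0, 1:] * Q = 0"
    proof (rule poly_zero_cofinite[of P 0])
      show "poly P 0 \<noteq> 0" using P[of 0] v by simp
      fix t assume "poly P t \<noteq> 0"
      then have "\<omega> (v + t *s w) \<noteq> 0" by (simp add: P)
      then have "polar (F v) (v + t *s w) (s (v + t *s w)) = 0"
        using s by (auto simp: F_def)
      then have "t * polar (F v) w (s (v + t *s w)) = 0"
        using p[OF v] by (simp add: polar_bilinear[OF comb_hom] F_def)
      then show "poly ([:0, 1:] * Q) t = 0" by (simp add: Q)
    qed
    then have "Q = 0" by simp
    then show ?thesis using Q[of 0] by simp
  qed
  show thesis
  proof (rule that[of \<omega>' F s]; (intro allI impI)?)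
    show "line_poly (\<lambda>v. polar (F v) w w')" for w w'
      unfolding F_def polar_comb by (intro line_poly_sum line_poly_mult lpp line_poly_const)
  next
    fix v assume "\<omega>' v \<noteq> 0"
    then have v: "\<omega> v \<noteq> 0" by (auto simp: \<omega>'_def)
    show "F v \<in> V \<and> F v \<noteq> 0 \<and> (\<forall>w. polar (F v) v w = 0) \<and> (\<forall>w. polar (F v) (s v) w = 0)"
      using p[OF v] kills_s[OF v] by (simp add: F_def comb_in_V comb_eq_0_iff polar_commute[of _ "s v"])
  next
    fix v q assume "\<omega>' v \<noteq> 0" "q \<in> V" "\<forall>w. polar q v w = 0"
    then have "\<omega> v \<noteq> 0" by (auto simp: \<omega>'_def)
    from \<open>q \<in> V\<close> obtain c where c: "q = comb c" by (auto simp: V_def)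
    obtain t where "c = t *s p v" using pu[OF \<open>\<omega> v \<noteq> 0\<close>, of c] \<open>\<forall>w. polar q v w = 0\<close> unfolding c by blast
    then show "\<exists>t. q = const t * F v"
      unfolding c F_def by (auto simp: comb_scale)
  next
    fix v q assume "\<omega>' v \<noteq> 0" "q \<in> V"
    then show "polar q v (s v) = 0" using s by (auto simp: \<omega>'_def)
  next
    fix v a b assume v: "\<omega>' v \<noteq> 0" and ab: "a *s v + b *s s v = 0"
    then have v': "\<omega> v \<noteq> 0" "polar (f 0) v v \<noteq> 0" by (auto simp: \<omega>'_def)
    have "polar (f 0) v (a *s v + b *s s v) = 0"
      unfolding ab using polar_bilinear(4)[OF hom_f[of 0], of v 0 0] by simp
    then have "a * polar (f 0) v v = 0"
      using s[OF v'(1)] f_in_V by (simp add: polar_bilinear[OF hom_f])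
    then have "a = 0" using v'(2) by simp
    then show "a = 0 \<and> b = 0" using ab s[OF v'(1)] by (simp add: vector_mul_eq_0)
  qed (rule lp' nz')+
qed

end

lemma linform_nonzero_ev:
  assumes "linform l" "l \<noteq> 0"
  obtains v where "ev l v \<noteq> 0"
proof -
  obtain a where a: "l = (\<Sum>i\<in>UNIV. const (a i) * var i)" using assms(1)[unfolded linform_def] ..
  have "ev l (axis i 1) = a i" for i
    unfolding a by (rule index_cases[of i]) (simp_all add: sum_index axis_def)
  moreover have "\<exists>i. a i \<noteq> 0"
  proof (rule ccontr)
    assume "\<nexists>i. a i \<noteq> 0"
    then have "l = 0" unfolding a by simp
    then show False using assms(2) by simp
  qed
  ultimately show thesis using that by metis
qed

text \<open>The vectors $(f_1,f_2)$ and $(i_1,i_2)$ are both proportional to $(g_1,g_2)$ and to $(h_1,h_2)$, and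
  proportionality is transitive through nonzero vectors.\<close>

lemma parallel_pairs:
  fixes f1 f2 g1 g2 h1 h2 i1 i2 :: "'a::field"
  assumes "g1 * f2 = g2 * f1" "g1 * i2 = g2 * i1" "h1 * f2 = h2 * f1" "h1 * i2 = h2 * i1"
  obtains (fi) "f1 = 0" "f2 = 0" "i1 = 0" "i2 = 0" | (gh) "g1 = 0" "g2 = 0" "h1 = 0" "h2 = 0"
  | (parallel) m1 m2 where "m1 \<noteq> 0 \<or> m2 \<noteq> 0" "m2 * f1 = m1 * f2" "m2 * g1 = m1 * g2" "m2 * h1 = m1 * h2" "m2 * i1 = m1 * i2"
proof -
  have trans: "c1 * b2 = c2 * b1" if "a1 * b2 = a2 * b1" "a1 * c2 = a2 * c1" "a1 \<noteq> 0 \<or> a2 \<noteq> 0" for a1 a2 b1 b2 c1 c2 :: 'a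
  proof (cases "a1 = 0")
    case True
    then show ?thesis using that by auto
  next
    case False
    then have "b2 = a2 * b1 / a1" "c2 = a2 * c1 / a1" using that by (simp_all add: field_simps)
    then show ?thesis by simp
  qed
  consider "f1 = 0 \<and> f2 = 0 \<and> i1 = 0 \<and> i2 = 0" | "g1 = 0 \<and> g2 = 0 \<and> h1 = 0 \<and> h2 = 0"
    | "g1 \<noteq> 0 \<or> g2 \<noteq> 0" "f1 \<noteq> 0 \<or> f2 \<noteq> 0" | "g1 \<noteq> 0 \<or> g2 \<noteq> 0" "i1 \<noteq> 0 \<or> i2 \<noteq> 0"
    | "h1 \<noteq> 0 \<or> h2 \<noteq> 0" "f1 \<noteq> 0 \<or> f2 \<noteq> 0" | "h1 \<noteq> 0 \<or> h2 \<noteq> 0" "i1 \<noteq> 0 \<or> i2 \<noteq> 0"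
    by blast
  then show thesis
  proof cases
    case 1
    then show thesis using fi by blast
  next
    case 2
    then show thesis using gh by blast
  next
    case 3
    have "f1 * h2 = f2 * h1" using assms(3) by (simp add: mult.commute)
    with trans[of f1 g2 f2 g1 h2 h1] trans[of g1 f2 g2 f1 i2 i1] assms 3 show thesis
      by (intro parallel[of g1 g2]) (simp_all add: mult.commute)
  next
    case 4
    with trans[of i1 g2 i2 g1 h2 h1] assms show thesis
      by (intro parallel[of g1 g2]) (simp_all add: mult.commute)
  next
    case 5
    with trans[of f1 h2 f2 h1 g2 g1] assms show thesis
      by (intro parallel[of h1 h2]) (simp_all add: mult.commute)
  next
    case 6
    with trans[of i1 h2 i2 h1 g2 g1] assms show thesis
      by (intro parallel[of h1 h2]) (simp_all add: mult.commute)
  qed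
qed

context four_quadrics
begin

text \<open>The linear form is the polar form with a vector at which the quadric does not vanish.\<close>

lemma rank_one_square:
  assumes q: "q \<in> V" "q \<noteq> 0"
    and rank: "\<And>w1 w2 w3 w4. polar q w1 w3 * polar q w2 w4 = polar q w1 w4 * polar q w2 w3"
  obtains l where "linform l" "l \<noteq> 0" "l^2 \<in> V" "\<And>v. (\<forall>w. polar q v w = 0) \<Longrightarrow> ev l v = 0"
proof -
  have hq: "homogeneous 2 q" by (rule hom_V[OF q(1)])
  obtain w0 where w0: "polar q w0 w0 \<noteq> 0"
  proof -
    have "\<exists>u. ev q u \<noteq> 0"
      using q(2) quadric_eqI[OF hq homogeneous_0] by fastforce
    then show thesis using that by (auto simp: polar_self[OF hq])
  qed
  obtain l where l: "linform l" "\<And>v. ev l v = polar q v w0"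
    by (rule linform_of_linear_fun[of "\<lambda>v. polar q v w0"]) (simp_all add: polar_bilinear[OF hq])
  have "l^2 = const (2 * polar q w0 w0) * q"
  proof (rule quadric_eqI)
    show "homogeneous 2 (l^2)" using homogeneous_linform_mult[OF l(1,1)] by (simp add: power2_eq_square)
    show "homogeneous 2 (const (2 * polar q w0 w0) * q)" by (rule homogeneous_scale[OF hq])
    fix v
    have "(polar q v w0)^2 = polar q v v * polar q w0 w0"
      using rank[of v w0 w0 v] by (simp add: power2_eq_square polar_commute[of q w0 v] mult.commute)
    then show "ev (l^2) v = ev (const (2 * polar q w0 w0) * q) v"
      by (simp add: l(2) polar_self[OF hq, of v])
  qed
  then have "l^2 \<in> V" using q(1) by auto
  moreover have "l \<noteq> 0" using l(2)[of w0] w0 by auto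
  ultimately show thesis using that l by simp
qed

text \<open>In these coordinates every quadric in \<open>V\<close> is free of $w$.\<close>

lemma classified_vertex:
  assumes co: "coords x y z w" and e: "ev x e = 0" "ev y e = 0" "ev z e = 0" "ev w e \<noteq> 0"
    and ker: "\<And>q v. q \<in> V \<Longrightarrow> polar q v e = 0"
  shows classified
proof (rule classified_ternary[OF co])
  have lin: "linform x" "linform y" "linform z" "linform w" using co by (simp_all add: coords_def)
  fix p assume p: "p \<in> V"
  obtain a b c d r f' g h i j where exp: "p = const a * x^2 + const b * y^2 + const c * z^2 + const d * w^2
       + const r * (x * y) + const f' * (x * z) + const g * (x * w)
       + const h * (y * z) + const i * (y * w) + const j * (z * w)"
    by (rule coords_quadric_expansion[OF co hom_V[OF p]])
  have "ev w e * (2 * d * ev w v + g * ev x v + i * ev y v + j * ev z v) = polar p v e" for v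
    unfolding exp by (simp only: polar_linear polar_mult[OF lin(1,2)] polar_mult[OF lin(1,3)] polar_mult[OF lin(1,4)]
        polar_mult[OF lin(2,3)] polar_mult[OF lin(2,4)] polar_mult[OF lin(3,4)] polar_square[OF lin(1)]
        polar_square[OF lin(2)] polar_square[OF lin(3)] polar_square[OF lin(4)] e) (simp add: algebra_simps)
  then have *: "2 * d * ev w v + g * ev x v + i * ev y v + j * ev z v = 0" for v
    using ker[OF p] e(4) by (metis mult_eq_0_iff)
  have "2 * d * t4 + g * t1 + i * t2 + j * t3 = 0" for t1 t2 t3 t4
    using coords_point[OF co, of t1 t2 t3 t4] * by metis
  from this[of 1 0 0 0] this[of 0 1 0 0] this[of 0 0 1 0] this[of 0 0 0 1]
  have "d = 0" "g = 0" "i = 0" "j = 0" by simp_all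
  then have "p = const a * x^2 + const b * y^2 + const c * z^2
       + const r * (x * y) + const f' * (x * z) + const h * (y * z)"
    unfolding exp by simp
  then show "\<exists>a b c d e g. p = const a * x^2 + const b * y^2 + const c * z^2
       + const d * (x * y) + const e * (x * z) + const g * (y * z)"
    by blast
qed

lemma classified_common_kernel:
  assumes "e \<noteq> 0" and ker: "\<And>q v. q \<in> V \<Longrightarrow> polar q v e = 0"
  shows classified
proof -
  obtain b where b: "\<And>p q r. b \<noteq> p *s e + q *s e + r *s e"
    using vector_outside_span3[of e e e] by blast
  have eb: "p = 0 \<and> q = 0" if eq: "p *s e + q *s b = 0" for p q
  proof -
    have "q = 0"
    proof (rule ccontr)
      assume "q \<noteq> 0"
      from vector_combination_eq_0D[OF eq this] have "b = (- inverse q * p) *s e + 0 *s e + 0 *s e"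
        by (simp add: vec_eq_iff)
      then show False using b by blast
    qed
    then show ?thesis using eq \<open>e \<noteq> 0\<close> by (simp add: vector_mul_eq_0)
  qed
  obtain c d where ind: "\<And>p q r s. p *s e + q *s b + r *s c + s *s d = 0 \<Longrightarrow> p = 0 \<and> q = 0 \<and> r = 0 \<and> s = 0"
    using extend_independent_vectors[of e b, OF eb] by blast
  obtain y0 y1 y2 y3 where y: "coords y0 y1 y2 y3" "ev y0 e = 1" "ev y1 e = 0" "ev y2 e = 0" "ev y3 e = 0"
    by (rule dual_coords[OF ind]) blast
  have "coords y1 y2 y3 y0"
    by (rule coords_swap34[OF coords_swap23[OF coords_swap12[OF y(1)]]])
  then show ?thesis
    by (rule classified_vertex[where e = e]) (use y ker in simp_all)
qed

end

context four_quadrics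
begin

subsection \<open>Products of two pairs of linear forms\<close>

text \<open>Modulo $ab$ and $cd$ the space \<open>V\<close> is spanned by two forms $C_1,C_2$ in $ac,ad,bc,bd$. That some member
  is singular at each point is an identity between their coefficients, which makes the pairs of
  coefficients of $ac$ and of $bd$ proportional to those of $ad$ and of $bc$. As $C_1$ and $C_2$ are
  independent, they must span $ad,bc$ or $ac,bd$, so \<open>V\<close> is the
  space of products of two pencils of linear forms.\<close>

lemma classified_two_pairs:
  assumes co: "coords a b c d" and ab: "a * b \<in> V" and cd: "c * d \<in> V"
    and no_squares: "\<And>q. q \<in> V \<Longrightarrow> \<exists>e f g h i j. q = const e * (a * b) + const f * (a * c) + const g * (a * d)
      + const h * (b * c) + const i * (b * d) + const j * (c * d)"
    and sing: "\<And>v. \<exists>q\<in>V. q \<noteq> 0 \<and> (\<forall>w. polar q v w = 0)"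
  shows classified
proof -
  have lin: "linform a" "linform b" "linform c" "linform d" using co by (simp_all add: coords_def)
  note pol = polar_linear polar_mult[OF lin(1,2)] polar_mult[OF lin(1,3)] polar_mult[OF lin(1,4)]
    polar_mult[OF lin(2,3)] polar_mult[OF lin(2,4)] polar_mult[OF lin(3,4)]
  obtain u1 where u1: "a * b = comb u1" using ab by (auto simp: V_def)
  obtain u2 where u2: "c * d = comb u2" using cd by (auto simp: V_def)
  have ind2: "p = 0 \<and> q = 0" if "p *s u1 + q *s u2 = 0" for p q
  proof -
    have eq: "const p * (a * b) + const q * (c * d) = 0"
      unfolding u1 u2 comb_scale[symmetric] comb_add[symmetric] that by (simp add: comb_eq_0_iff)
    have *: "p * (ev a v * ev b v) + q * (ev c v * ev d v) = 0" for v
      using arg_cong[OF eq, of "\<lambda>t. ev t v"] by simp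
    have **: "p * (r1 * r2) + q * (r3 * r4) = 0" for r1 r2 r3 r4
      using coords_point[OF co, of r1 r2 r3 r4] * by metis
    show ?thesis using **[of 1 1 0 0] **[of 0 0 1 1] by simp
  qed
  obtain u3 u4 where ind: "\<And>p q r s. p *s u1 + q *s u2 + r *s u3 + s *s u4 = 0 \<Longrightarrow> p = 0 \<and> q = 0 \<and> r = 0 \<and> s = 0"
    using extend_independent_vectors[of u1 u2, OF ind2] by blast
  obtain e1 f1 g1 h1 i1 j1 where q3: "comb u3 = const e1 * (a * b) + const f1 * (a * c) + const g1 * (a * d)
      + const h1 * (b * c) + const i1 * (b * d) + const j1 * (c * d)"
    using no_squares[OF comb_in_V[of u3]] by blast
  obtain e2 f2 g2 h2 i2 j2 where q4: "comb u4 = const e2 * (a * b) + const f2 * (a * c) + const g2 * (a * d)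
      + const h2 * (b * c) + const i2 * (b * d) + const j2 * (c * d)"
    using no_squares[OF comb_in_V[of u4]] by blast
  define C1 where "C1 = const f1 * (a * c) + const g1 * (a * d) + const h1 * (b * c) + const i1 * (b * d)"
  define C2 where "C2 = const f2 * (a * c) + const g2 * (a * d) + const h2 * (b * c) + const i2 * (b * d)"
  have C1: "C1 = comb (u3 + (- e1) *s u1 + (- j1) *s u2)" and C2: "C2 = comb (u4 + (- e2) *s u1 + (- j2) *s u2)"
    unfolding comb_add comb_scale q3 q4 u1[symmetric] u2[symmetric] C1_def C2_def by (simp_all add: ring_simps)
  have CV: "C1 \<in> V" "C2 \<in> V" unfolding C1 C2 by blast+
  have ind4: "ind4 (a * b) (c * d) C1 C2"
    unfolding ind4_def
  proof (intro allI impI)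
    fix p q r s
    assume "const p * (a * b) + const q * (c * d) + const r * C1 + const s * C2 = 0"
    then have "comb (p *s u1 + q *s u2 + r *s (u3 + (- e1) *s u1 + (- j1) *s u2) + s *s (u4 + (- e2) *s u1 + (- j2) *s u2)) = 0"
      by (simp only: comb_add comb_scale u1 u2 C1 C2)
    then have "p *s u1 + q *s u2 + r *s (u3 + (- e1) *s u1 + (- j1) *s u2) + s *s (u4 + (- e2) *s u1 + (- j2) *s u2) = 0"
      by (simp only: comb_eq_0_iff)
    then have "(p - r * e1 - s * e2) *s u1 + (q - r * j1 - s * j2) *s u2 + r *s u3 + s *s u4 = 0"
      by (simp add: vec_eq_iff algebra_simps)
    from ind[OF this] show "p = 0 \<and> q = 0 \<and> r = 0 \<and> s = 0" by auto
  qed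
  have key: "(g1 * (x * y') - h1 * (y * x')) * (f2 * (x * x') - i2 * (y * y'))
      = (g2 * (x * y') - h2 * (y * x')) * (f1 * (x * x') - i1 * (y * y'))"
    if nz: "x \<noteq> 0" "y \<noteq> 0" "x' \<noteq> 0" "y' \<noteq> 0" for x y x' y'
  proof -
    obtain v where v: "ev a v = x" "ev b v = y" "ev c v = x'" "ev d v = y'"
      by (rule coords_point[OF co])
    obtain q where q: "q \<in> V" "q \<noteq> 0" "\<And>w. polar q v w = 0" using sing[of v] by blast
    obtain r s t u where exp: "q = const r * (a * b) + const s * (c * d) + const t * C1 + const u * C2"
      by (rule V_spanned[OF ab cd CV ind4 q(1)])
    obtain w1 where w1: "ev a w1 = x" "ev b w1 = - y" "ev c w1 = 0" "ev d w1 = 0" by (rule coords_point[OF co])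
    obtain w2 where w2: "ev a w2 = 0" "ev b w2 = 0" "ev c w2 = x'" "ev d w2 = - y'" by (rule coords_point[OF co])
    obtain w3 where w3: "ev a w3 = 0" "ev b w3 = 1" "ev c w3 = 0" "ev d w3 = 0" by (rule coords_point[OF co])
    obtain w4 where w4: "ev a w4 = 0" "ev b w4 = 0" "ev c w4 = 0" "ev d w4 = 1" by (rule coords_point[OF co])
    define D1 D2 E1 E2 where "D1 = f1 * (x * x') - i1 * (y * y')" and "D2 = f2 * (x * x') - i2 * (y * y')"
      and "E1 = g1 * (x * y') - h1 * (y * x')" and "E2 = g2 * (x * y') - h2 * (y * x')"
    \<comment> \<open>The points \<open>w1\<close> and \<open>w2\<close> are orthogonal to \<open>v\<close> for both \<open>a * b\<close> and \<open>c * d\<close>.\<close>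
    have 1: "t * (D1 + E1) + u * (D2 + E2) = 0"
      using q(3)[of w1] unfolding exp C1_def C2_def pol v w1 D1_def D2_def E1_def E2_def by (simp add: algebra_simps)
    have 2: "t * (D1 - E1) + u * (D2 - E2) = 0"
      using q(3)[of w2] unfolding exp C1_def C2_def pol v w2 D1_def D2_def E1_def E2_def by (simp add: algebra_simps)
    have tu: "t \<noteq> 0 \<or> u \<noteq> 0"
    proof (rule ccontr)
      assume "\<not> (t \<noteq> 0 \<or> u \<noteq> 0)"
      then have q': "q = const r * (a * b) + const s * (c * d)" unfolding exp by simp
      have "r * x = 0" "s * x' = 0"
        using q(3)[of w3] q(3)[of w4] unfolding q' pol v w3 w4 by simp_all
      then have "q = 0" unfolding q' using nz by simp
      then show False using q(2) by simp
    qed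
    have "t * (2 * (E1 * D2 - E2 * D1)) = 0" "u * (2 * (E1 * D2 - E2 * D1)) = 0"
      using 1 2 by algebra+
    then have "2 * (E1 * D2 - E2 * D1) = 0" using tu by (metis mult_eq_0_iff)
    then show ?thesis unfolding D1_def D2_def E1_def E2_def by simp
  qed
  define P Q R S where "P = g1 * f2 - g2 * f1" and "Q = g1 * i2 - g2 * i1" and "R = h1 * f2 - h2 * f1" and "S = h1 * i2 - h2 * i1"
  have k: "P * (x^2 * x' * y') - Q * (x * y * y'^2) - R * (x * y * x'^2) + S * (y^2 * x' * y') = 0"
    if "x \<noteq> 0" "y \<noteq> 0" "x' \<noteq> 0" "y' \<noteq> 0" for x y x' y'
    using key[OF that] unfolding P_def Q_def R_def S_def by algebra
  \<comment> \<open>Four values of this polynomial identity determine its four coefficients.\<close>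
  have k1: "P - Q - R + S = 0" using k[of 1 1 1 1] by simp
  have k2: "P + Q + R + S = 0" using k[of 1 "-1" 1 1] by simp
  have k3: "4 * P - 2 * Q - 2 * R + S = 0" using k[of 2 1 1 1] by (simp add: mult.commute)
  have k4: "2 * P - Q - 4 * R + 2 * S = 0" using k[of 1 1 2 1] by (simp add: mult.commute)
  have "6 * P = 0" "6 * R = 0" "6 * S = 0" "6 * Q = 0"
    using k1 k2 k3 k4 by algebra+
  then have PQRS: "g1 * f2 = g2 * f1" "g1 * i2 = g2 * i1" "h1 * f2 = h2 * f1" "h1 * i2 = h2 * i1"
    unfolding P_def Q_def R_def S_def by simp_all
  from PQRS show ?thesis
  proof (cases rule: parallel_pairs)
    case fi
    have C: "C1 = const g1 * (a * d) + const h1 * (b * c)" "C2 = const g2 * (a * d) + const h2 * (b * c)"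
      unfolding C1_def C2_def using fi by simp_all
    define D where "D = g1 * h2 - g2 * h1"
    have eqs: "const D * (a * d) = const h2 * C1 - const h1 * C2" "const D * (b * c) = const g1 * C2 - const g2 * C1"
      unfolding C D_def by (simp_all add: ring_simps)
    have D: "D \<noteq> 0"
    proof
      assume "D = 0"
      then have "const 0 * (a * b) + const 0 * (c * d) + const h2 * C1 + const (- h1) * C2 = 0"
        "const 0 * (a * b) + const 0 * (c * d) + const (- g2) * C1 + const g1 * C2 = 0"
        using eqs by (simp_all add: const_uminus)
      from ind4D[OF ind4 this(1)] ind4D[OF ind4 this(2)] have "C1 = 0" unfolding C by simp
      then have "const 0 * (a * b) + const 0 * (c * d) + const 1 * C1 + const 0 * C2 = 0" by simp
      from ind4D[OF ind4 this] show False by simp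
    qed
    have "const D * (a * d) \<in> V" "const D * (b * c) \<in> V"
      unfolding eqs by (intro V_diff V_scale CV)+
    then have "a * d \<in> V" "b * c \<in> V" using V_scale_iff[OF D] by blast+
    then have "lin_equiv I ideal_i"
      by (intro equiv_i[OF coords_swap23[OF co]]) (use ab cd in \<open>simp_all add: mult.commute\<close>)
    then show ?thesis by (rule classifiedI)
  next
    case gh
    have C: "C1 = const f1 * (a * c) + const i1 * (b * d)" "C2 = const f2 * (a * c) + const i2 * (b * d)"
      unfolding C1_def C2_def using gh by simp_all
    define D where "D = f1 * i2 - f2 * i1"
    have eqs: "const D * (a * c) = const i2 * C1 - const i1 * C2" "const D * (b * d) = const f1 * C2 - const f2 * C1"
      unfolding C D_def by (simp_all add: ring_simps)
    have D: "D \<noteq> 0"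
    proof
      assume "D = 0"
      then have "const 0 * (a * b) + const 0 * (c * d) + const i2 * C1 + const (- i1) * C2 = 0"
        "const 0 * (a * b) + const 0 * (c * d) + const (- f2) * C1 + const f1 * C2 = 0"
        using eqs by (simp_all add: const_uminus)
      from ind4D[OF ind4 this(1)] ind4D[OF ind4 this(2)] have "C1 = 0" unfolding C by simp
      then have "const 0 * (a * b) + const 0 * (c * d) + const 1 * C1 + const 0 * C2 = 0" by simp
      from ind4D[OF ind4 this] show False by simp
    qed
    have "const D * (a * c) \<in> V" "const D * (b * d) \<in> V"
      unfolding eqs by (intro V_diff V_scale CV)+
    then have "a * c \<in> V" "b * d \<in> V" using V_scale_iff[OF D] by blast+
    then have "lin_equiv I ideal_i"
      by (intro equiv_i[OF coords_swap23[OF coords_swap34[OF co]]]) (use ab cd in \<open>simp_all add: mult.commute\<close>)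
    then show ?thesis by (rule classifiedI)
  next
    case (parallel m1 m2)
    have "const 0 * (a * b) + const 0 * (c * d) + const m2 * C1 + const (- m1) * C2
        = const (m2 * f1 - m1 * f2) * (a * c) + const (m2 * g1 - m1 * g2) * (a * d)
          + const (m2 * h1 - m1 * h2) * (b * c) + const (m2 * i1 - m1 * i2) * (b * d)"
      unfolding C1_def C2_def by (simp add: ring_simps)
    also have "\<dots> = 0" using parallel by simp
    finally show ?thesis using ind4D[OF ind4] parallel(1) by fastforce
  qed
qed

end

context degenerate_quadrics
begin

lemma singular_quadric: "\<exists>q\<in>V. q \<noteq> 0 \<and> (\<forall>w. polar q v w = 0)"
  using singular det_polar_matrix_eq_0_iff by blast

subsection \<open>General singular members of rank one\<close>

text \<open>Every general point lies on the plane of a form whose square is in \<open>V\<close>, so there are three such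
  squares of pairwise independent forms $x,y,z$. If they are dependent, then \<open>V\<close> contains
  $x^2,xy,y^2$. Otherwise the member that is singular at a general point involves the fourth quadric of
  \<open>V\<close>, as no combination of the three squares is singular there, and it follows that all members of \<open>V\<close>
  are singular at the common zero of $x,y,z$.\<close>

lemma classified_squares:
  assumes lp: "line_poly \<omega>" "\<omega> v0 \<noteq> 0"
    and sq: "\<And>v. \<omega> v \<noteq> 0 \<Longrightarrow> \<exists>l. linform l \<and> l \<noteq> 0 \<and> l^2 \<in> V \<and> ev l v = 0"
  shows classified
proof -
  obtain x where x: "linform x" "x \<noteq> 0" "x^2 \<in> V" using sq[OF lp(2)] by blast
  obtain u1 where u1: "ev x u1 \<noteq> 0" by (rule linform_nonzero_ev[OF x(1,2)])
  obtain v2 where v2: "\<omega> v2 \<noteq> 0" "ev x v2 \<noteq> 0"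
    by (rule line_poly_common_nonzero[OF lp(1) line_poly_linform[OF x(1)] lp(2) u1])
  obtain y where y: "linform y" "y \<noteq> 0" "y^2 \<in> V" "ev y v2 = 0" using sq[OF v2(1)] by blast
  obtain u2 where u2: "ev y u2 \<noteq> 0" by (rule linform_nonzero_ev[OF y(1,2)])
  obtain v where v: "\<omega> v * ev x v \<noteq> 0" "ev y v \<noteq> 0"
    by (rule line_poly_common_nonzero[OF line_poly_mult[OF lp(1) line_poly_linform[OF x(1)]] line_poly_linform[OF y(1)] _ u2, of v2])
      (use v2 in simp)
  then have v3: "\<omega> v \<noteq> 0" "ev x v \<noteq> 0" by auto
  obtain z where z: "linform z" "z \<noteq> 0" "z^2 \<in> V" "ev z v = 0" using sq[OF v3(1)] by blast
  have xy: "a = 0 \<and> b = 0" if "const a * x + const b * y = 0" for a b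
  proof -
    have "a * ev x v2 + b * ev y v2 = 0" using arg_cong[OF that, of "\<lambda>p. ev p v2"] by simp
    then have "a = 0" using v2 y(4) by simp
    then show ?thesis using that y(2) by (simp add: const_def) (metis lookup_single_eq lookup_zero)
  qed
  obtain z' w' where co: "coords x y z' w'" by (rule coords_extend[OF x(1) y(1) xy])
  show ?thesis
  proof (cases "\<exists>a b. z = const a * x + const b * y")
    case True
    then obtain a b where ab: "z = const a * x + const b * y" by blast
    have "a * ev x v + b * ev y v = 0" using z(4) unfolding ab by simp
    then have "a \<noteq> 0" "b \<noteq> 0" using v3 v(2) z(2) ab by auto
    have "const (2 * a * b) * (x * y) = z^2 - const (a^2) * x^2 - const (b^2) * y^2"
      unfolding ab by (simp add: ring_simps)
    then have "const (2 * a * b) * (x * y) \<in> V"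
      using x(3) y(3) z(3) by (metis V_diff V_scale)
    then have "x * y \<in> V" using V_scale_iff[of "2 * a * b"] \<open>a \<noteq> 0\<close> \<open>b \<noteq> 0\<close> by simp
    then show ?thesis using classified_double_line[OF co x(3) _ y(3)] by blast
  next
    case False
    obtain a b c d where exp: "z = const a * x + const b * y + const c * z' + const d * w'"
      by (rule coords_linform_expansion[OF co z(1)])
    have cd: "c \<noteq> 0 \<or> d \<noteq> 0" using False exp by force
    obtain r s where det: "c * s - d * r \<noteq> 0" using complete_to_invertible2[OF cd] by blast
    have "coords x y (const c * z' + const d * w') (const r * z' + const s * w')"
      by (rule coords_change34[OF co det])
    then have "coords x y (const c * z' + const d * w' + const a * x + const b * y) (const r * z' + const s * w')"
      by (rule coords_shear)
    moreover have "const c * z' + const d * w' + const a * x + const b * y = z" unfolding exp by (simp add: add_ac)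
    ultimately obtain w where co2: "coords x y z w" by auto
    note lin = x(1) y(1) z(1)
    have lw: "linform w" using co2 by (simp add: coords_def)
    have ind3: "a = 0 \<and> b = 0 \<and> c = 0" if "const a * x^2 + const b * y^2 + const c * z^2 = 0" for a b c
    proof -
      have "a * (ev x v)^2 + b * (ev y v)^2 + c * (ev z v)^2 = 0" for v
        using arg_cong[OF that, of "\<lambda>p. ev p v"] by simp
      then have *: "a * r^2 + b * s^2 + c * t^2 = 0" for r s t
        using coords_point[OF co2, of r s t 0] by metis
      show ?thesis using *[of 1 0 0] *[of 0 1 0] *[of 0 0 1] by simp
    qed
    obtain p where p: "p \<in> V" "ind4 (x^2) (y^2) (z^2) p"
      by (rule V_extend_three[OF x(3) y(3) z(3) ind3])
    obtain e where e: "ev x e = 0" "ev y e = 0" "ev z e = 0" "ev w e = 1"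
      by (rule coords_point[OF co2])
    note hp = hom_V[OF p(1)]
    have gen: "polar p v e = 0" if nz: "ev x v * (ev y v * ev z v) \<noteq> 0" for v
    proof -
      obtain q where q: "q \<in> V" "q \<noteq> 0" "\<And>w. polar q v w = 0" using singular_quadric[of v] by blast
      obtain a b c d where exp: "q = const a * x^2 + const b * y^2 + const c * z^2 + const d * p"
        by (rule V_spanned[OF x(3) y(3) z(3) p q(1)])
      have de: "d * polar p v e = 0"
        using q(3)[of e] unfolding exp by (simp add: polar_square lin e)
      have "d \<noteq> 0"
      proof
        assume d: "d = 0"
        have "a * (ev x v * ev x w') + b * (ev y v * ev y w') + c * (ev z v * ev z w') = 0" for w'
          using q(3)[of w'] unfolding exp d by (simp add: polar_square lin mult.left_commute[of _ 2] distrib_left[symmetric] del: distrib_left_numeral)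
        then have *: "a * (ev x v * r) + b * (ev y v * s) + c * (ev z v * t) = 0" for r s t
          using coords_point[OF co2, of r s t 0] by metis
        have "a = 0" "b = 0" "c = 0" using *[of 1 0 0] *[of 0 1 0] *[of 0 0 1] nz by simp_all
        then show False using q(2) unfolding exp d by simp
      qed
      then show ?thesis using de by simp
    qed
    have pe: "polar p v e = 0" for v
    proof -
      obtain v' where v': "ev x v' = 1" "ev y v' = 1" "ev z v' = 1" "ev w v' = 0" by (rule coords_point[OF co2])
      show ?thesis
        by (rule line_poly_dense[of "\<lambda>v. ev x v * (ev y v * ev z v)" "\<lambda>v. polar p v e" v'])
          (use lin v' gen hp in \<open>auto intro!: line_poly_mult line_poly_linform line_poly_polar\<close>)
    qed
    show ?thesis
    proof (rule classified_vertex[OF co2, of e])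
      fix q u assume "q \<in> V"
      obtain a b c d where exp: "q = const a * x^2 + const b * y^2 + const c * z^2 + const d * p"
        by (rule V_spanned[OF x(3) y(3) z(3) p \<open>q \<in> V\<close>])
      show "polar q u e = 0" unfolding exp by (simp add: polar_square lin e pe)
    qed (use e in simp_all)
  qed
qed

subsection \<open>General singular members of rank two\<close>

text \<open>Let $u$ be a point of the line $a=b=0$. Then \<open>F v\<close> is singular at $u$, so it is the singular quadric of
  $u$ as well, and $s(u)$ lies on the same line. Orthogonality of $u$ and $s(u)$ for $cd$ means that $s(u)$
  is proportional to $(c(u),-d(u))$ in the coordinates $c,d$ of the line. Orthogonality for \<open>q\<close> then says
  that $r_3c^2-r_4d^2$ vanishes on the line.\<close>

lemma no_squares_on_fibre:
  assumes lp: "line_poly \<omega>"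
    and F: "\<And>v. \<omega> v \<noteq> 0 \<Longrightarrow> F v \<in> V \<and> F v \<noteq> 0 \<and> (\<forall>w. polar (F v) v w = 0) \<and> (\<forall>w. polar (F v) (s v) w = 0)"
    and unique: "\<And>v q. \<omega> v \<noteq> 0 \<Longrightarrow> q \<in> V \<Longrightarrow> (\<forall>w. polar q v w = 0) \<Longrightarrow> \<exists>t. q = const t * F v"
    and fibre: "\<And>v q. \<omega> v \<noteq> 0 \<Longrightarrow> q \<in> V \<Longrightarrow> polar q v (s v) = 0"
    and indep: "\<And>v a b. \<omega> v \<noteq> 0 \<Longrightarrow> a *s v + b *s s v = 0 \<Longrightarrow> a = 0 \<and> b = 0"
    and v: "\<omega> v \<noteq> 0" and Fv: "F v = a * b" and co: "coords a b c d" and cd: "c * d \<in> V"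
    and av: "ev a v = 0" "ev b v = 0"
    and q: "q \<in> V" "q = const r1 * a^2 + const r2 * b^2 + const r3 * c^2 + const r4 * d^2
       + const r5 * (a * b) + const r6 * (a * c) + const r7 * (a * d)
       + const r8 * (b * c) + const r9 * (b * d) + const r0 * (c * d)"
  shows "r3 = 0 \<and> r4 = 0"
proof -
  have lin: "linform a" "linform b" "linform c" "linform d" using co by (simp_all add: coords_def)
  have rel: "r3 * (ev c u)^2 - r4 * (ev d u)^2 = 0" if u: "\<omega> u \<noteq> 0" "ev a u = 0" "ev b u = 0" for u
  proof -
    have "\<forall>w. polar (F v) u w = 0" unfolding Fv using u by (simp add: polar_mult lin)
    then obtain t where t: "F v = const t * F u" using unique[OF u(1)] F[OF v] by blast
    have "polar (F v) (s u) w = 0" for w unfolding t using F[OF u(1)] by simp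
    then have *: "ev a (s u) * ev b w + ev a w * ev b (s u) = 0" for w
      unfolding Fv by (simp add: polar_mult lin)
    obtain w1 where w1: "ev a w1 = 0" "ev b w1 = 1" "ev c w1 = 0" "ev d w1 = 0" by (rule coords_point[OF co])
    obtain w2 where w2: "ev a w2 = 1" "ev b w2 = 0" "ev c w2 = 0" "ev d w2 = 0" by (rule coords_point[OF co])
    have s0: "ev a (s u) = 0" "ev b (s u) = 0" using *[of w1] *[of w2] w1 w2 by simp_all
    have "s u \<noteq> 0"
      using indep[OF u(1), of 0 1] by auto
    moreover have "ev x 0 = 0" if "linform x" for x :: "'k pol4"
      using ev_linform_scale[OF that, of 0 0] by simp
    ultimately have s1: "ev c (s u) \<noteq> 0 \<or> ev d (s u) \<noteq> 0"
      using coords_point_eq[OF co, of "s u" 0] s0 lin by auto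
    have 1: "ev c u * ev d (s u) + ev c (s u) * ev d u = 0"
      using fibre[OF u(1) cd] by (simp add: polar_mult lin)
    have pq: "polar q u (s u) = 2 * (r3 * (ev c u * ev c (s u)) + r4 * (ev d u * ev d (s u))) + r0 * (ev c u * ev d (s u) + ev c (s u) * ev d u)"
      unfolding q(2) by (simp add: polar_mult polar_square lin s0 u)
    have "2 * (r3 * (ev c u * ev c (s u)) + r4 * (ev d u * ev d (s u))) = 0"
      using fibre[OF u(1) q(1)] unfolding pq 1 by (simp only: mult_zero_right add_0_right)
    then have 2: "r3 * (ev c u * ev c (s u)) + r4 * (ev d u * ev d (s u)) = 0" by (metis mult_eq_0_iff zero_neq_numeral)
    have "ev c (s u) * (r3 * (ev c u)^2 - r4 * (ev d u)^2) = 0" "ev d (s u) * (r3 * (ev c u)^2 - r4 * (ev d u)^2) = 0"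
      using 1 2 by algebra+
    then show ?thesis using s1 by (metis mult_eq_0_iff)
  qed
  have rel': "r3 * (ev c u)^2 - r4 * (ev d u)^2 = 0" if u: "ev a u = 0" "ev b u = 0" for u
  proof -
    obtain P where P: "\<And>t. \<omega> (v + t *s (u - v)) = poly P t" using line_polyE[OF lp] by blast
    have "line_poly (\<lambda>u. r3 * (ev c u * ev c u) - r4 * (ev d u * ev d u))"
      by (intro line_poly_diff line_poly_mult line_poly_const line_poly_linform lin)
    then obtain Q where Q: "\<And>t. r3 * (ev c (v + t *s (u - v)) * ev c (v + t *s (u - v))) - r4 * (ev d (v + t *s (u - v)) * ev d (v + t *s (u - v))) = poly Q t"
      using line_polyE by blast
    have "Q = 0"
    proof (rule poly_zero_cofinite[of P 0])
      show "poly P 0 \<noteq> 0" using P[of 0] v by simp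
      fix t assume "poly P t \<noteq> 0"
      with P[of t] have "\<omega> (v + t *s (u - v)) \<noteq> 0" by simp
      moreover have "ev a (v + t *s (u - v)) = 0" "ev b (v + t *s (u - v)) = 0"
        by (simp_all add: ev_linform_add ev_linform_scale ev_linform_diff lin u av)
      ultimately show "poly Q t = 0"
        using rel unfolding Q[symmetric] by (simp add: power2_eq_square)
    qed
    then show ?thesis using Q[of 1] by (simp add: power2_eq_square)
  qed
  obtain u1 where "ev a u1 = 0" "ev b u1 = 0" "ev c u1 = 1" "ev d u1 = 0" by (rule coords_point[OF co])
  moreover obtain u2 where "ev a u2 = 0" "ev b u2 = 0" "ev c u2 = 0" "ev d u2 = 1" by (rule coords_point[OF co])
  ultimately show ?thesis using rel'[of u1] rel'[of u2] by simp
qed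

text \<open>The quadric is singular along the line spanned by \<open>v\<close> and \<open>s\<close>, so in adapted coordinates it is a
  binary form in the two coordinates that vanish on this line. Its factors are independent because the
  rank is not one.\<close>

lemma split_rank_two:
  assumes Fv: "Fv \<in> V" "\<And>w. polar Fv v w = 0" "\<And>w. polar Fv s w = 0"
    and minor: "polar Fv w1 w3 * polar Fv w2 w4 - polar Fv w1 w4 * polar Fv w2 w3 \<noteq> 0"
    and indep: "\<And>a b. a *s v + b *s s = 0 \<Longrightarrow> a = 0 \<and> b = 0"
  obtains a b where "linform a" "linform b" "a \<noteq> 0" "Fv = a * b"
    "\<And>u. ev a u = 0 \<and> ev b u = 0 \<longleftrightarrow> (\<exists>r t. u = r *s v + t *s s)"
proof -
  obtain c d where ind: "\<And>p q r t. p *s v + q *s s + r *s c + t *s d = 0 \<Longrightarrow> p = 0 \<and> q = 0 \<and> r = 0 \<and> t = 0"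
    using extend_independent_vectors[of v s, OF indep] by blast
  obtain z w x y where co0: "coords z w x y" and zv: "ev z v = 1" "ev z s = 0" and wv: "ev w v = 0" "ev w s = 1"
    and xv: "ev x v = 0" "ev x s = 0" and yv: "ev y v = 0" "ev y s = 0"
    by (rule dual_coords[OF ind]) blast
  have co: "coords x y z w"
    by (rule coords_swap23[OF coords_swap12[OF coords_swap34[OF coords_swap23[OF co0]]]])
  have lin: "linform x" "linform y" "linform z" "linform w" using co by (simp_all add: coords_def)
  have vanish: "ev x u = 0 \<and> ev y u = 0 \<longleftrightarrow> (\<exists>r t. u = r *s v + t *s s)" for u
  proof
    assume u: "ev x u = 0 \<and> ev y u = 0"
    have "u = ev z u *s v + ev w u *s s"
      by (rule coords_point_eq[OF co]) (simp_all add: ev_linform_add ev_linform_scale lin u zv wv xv yv)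
    then show "\<exists>r t. u = r *s v + t *s s" by blast
  next
    assume "\<exists>r t. u = r *s v + t *s s"
    then show "ev x u = 0 \<and> ev y u = 0"
      by (auto simp: ev_linform_add ev_linform_scale lin xv yv)
  qed
  obtain A B C D E G H J K L where exp: "Fv = const A * x^2 + const B * y^2 + const C * z^2 + const D * w^2
       + const E * (x * y) + const G * (x * z) + const H * (x * w)
       + const J * (y * z) + const K * (y * w) + const L * (z * w)"
    by (rule coords_quadric_expansion[OF co hom_V[OF Fv(1)]])
  have 1: "2 * C * ev z u + G * ev x u + J * ev y u + L * ev w u = 0" for u
    using Fv(2)[of u] unfolding exp by (simp add: polar_mult polar_square lin xv yv zv wv) (simp add: algebra_simps)
  have 2: "2 * D * ev w u + H * ev x u + K * ev y u + L * ev z u = 0" for u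
    using Fv(3)[of u] unfolding exp by (simp add: polar_mult polar_square lin xv yv zv wv) (simp add: algebra_simps)
  have 1: "2 * C * t3 + G * t1 + J * t2 + L * t4 = 0" and 2: "2 * D * t4 + H * t1 + K * t2 + L * t3 = 0" for t1 t2 t3 t4
    using coords_point[OF co, of t1 t2 t3 t4] 1 2 by metis+
  have "C = 0" "G = 0" "J = 0" "L = 0" "D = 0" "H = 0" "K = 0"
    using 1[of 0 0 1 0] 1[of 1 0 0 0] 1[of 0 1 0 0] 1[of 0 0 0 1] 2[of 0 0 0 1] 2[of 1 0 0 0] 2[of 0 1 0 0] 2[of 0 0 1 0] by simp_all
  then have F: "Fv = const A * x^2 + const E * (x * y) + const B * y^2" unfolding exp by simp
  have "A \<noteq> 0 \<or> E \<noteq> 0 \<or> B \<noteq> 0" using minor unfolding F by (auto simp: polar_mult polar_square lin)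
  then show thesis
  proof (cases rule: binary_form_cases)
    case (product p q r t)
    let ?a = "const p * x + const q * y" and ?b = "const r * x + const t * y"
    have co': "coords ?a ?b z w" by (rule coords_change2[OF co product(1)])
    have zero: "ev ?a u = 0 \<and> ev ?b u = 0 \<longleftrightarrow> ev x u = 0 \<and> ev y u = 0" for u
    proof
      assume *: "ev ?a u = 0 \<and> ev ?b u = 0"
      have "(p * t - q * r) * ev x u = t * ev ?a u - q * ev ?b u" "(p * t - q * r) * ev y u = p * ev ?b u - r * ev ?a u"
        by (simp_all add: algebra_simps)
      with * have "(p * t - q * r) * ev x u = 0" "(p * t - q * r) * ev y u = 0" by simp_all
      with product(1) show "ev x u = 0 \<and> ev y u = 0" by (simp only: mult_eq_0_iff simp_thms)
    qed simp
    have Fab: "Fv = ?a * ?b" unfolding F by (simp add: product(2-4) ring_simps)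
    have a0: "?a \<noteq> 0"
    proof
      assume "?a = 0"
      then have "const 1 * ?a + const 0 * ?b + const 0 * z + const 0 * w = 0" by simp
      then show False using co' ind4D[of ?a ?b z w 1 0 0 0] by (simp add: coords_def)
    qed
    have linab: "linform ?a" "linform ?b" using lin by blast+
    show thesis
      by (rule that[OF linab a0 Fab]) (unfold zero, rule vanish)
  next
    case (square k p q)
    let ?l = "const p * x + const q * y"
    have ll: "linform ?l" using lin by blast
    have Fl: "Fv = const k * ?l^2" unfolding F by (simp add: square(3-5) ring_simps)
    have "polar Fv u u' = k * (2 * (ev ?l u * ev ?l u'))" for u u'
      unfolding Fl by (simp only: polar_linear polar_square[OF ll])
    then show thesis using minor by (simp add: mult_ac)
  qed
qed

text \<open>The fibres of the rational map defined by \<open>V\<close> are the lines $\langle v, s(v)\rangle$. If two of them do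
  not meet, then the two corresponding products of linear forms give coordinates in which no member of
  \<open>V\<close> contains a square. Otherwise the lines meet pairwise. The lines that do not lie in the plane
  spanned by two fixed ones all pass through their common point $e$, and then $e$ is a multiple of
  $s(v)$ for general $v$, hence orthogonal to every point for all members of \<open>V\<close>.\<close>

theorem classified_degenerate: classified
proof -
  obtain \<omega> F and s :: "'k^4 \<Rightarrow> 'k^4" where lp: "line_poly \<omega>" and nz: "\<exists>v. \<omega> v \<noteq> 0"
    and lpF': "\<forall>w w'. line_poly (\<lambda>v. polar (F v) w w')"
    and F': "\<forall>v. \<omega> v \<noteq> 0 \<longrightarrow> F v \<in> V \<and> F v \<noteq> 0 \<and> (\<forall>w. polar (F v) v w = 0) \<and> (\<forall>w. polar (F v) (s v) w = 0)"
    and unique': "\<forall>v q. \<omega> v \<noteq> 0 \<longrightarrow> q \<in> V \<longrightarrow> (\<forall>w. polar q v w = 0) \<longrightarrow> (\<exists>t. q = const t * F v)"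
    and fibre': "\<forall>v q. \<omega> v \<noteq> 0 \<longrightarrow> q \<in> V \<longrightarrow> polar q v (s v) = 0"
    and indep': "\<forall>v a b. \<omega> v \<noteq> 0 \<longrightarrow> a *s v + b *s s v = 0 \<longrightarrow> a = 0 \<and> b = 0"
    by (rule generic_singular_quadric)
  have lpF: "line_poly (\<lambda>v. polar (F v) w w')" for w w' using lpF' by blast
  have F: "F v \<in> V \<and> F v \<noteq> 0 \<and> (\<forall>w. polar (F v) v w = 0) \<and> (\<forall>w. polar (F v) (s v) w = 0)" if "\<omega> v \<noteq> 0" for v
    using F' that by blast
  have unique: "\<exists>t. q = const t * F v" if "\<omega> v \<noteq> 0" "q \<in> V" "\<forall>w. polar q v w = 0" for v q
    using unique' that by blast
  have fibre: "polar q v (s v) = 0" if "\<omega> v \<noteq> 0" "q \<in> V" for v q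
    using fibre' that by blast
  have indep: "a = 0 \<and> b = 0" if "\<omega> v \<noteq> 0" "a *s v + b *s s v = 0" for v a b
    using indep' that by blast
  show ?thesis
  proof (cases "\<exists>v w1 w2 w3 w4. \<omega> v \<noteq> 0 \<and> polar (F v) w1 w3 * polar (F v) w2 w4 - polar (F v) w1 w4 * polar (F v) w2 w3 \<noteq> 0")
    case False
    obtain v0 where v0: "\<omega> v0 \<noteq> 0" using nz by blast
    show ?thesis
    proof (rule classified_squares[OF lp v0])
      fix v assume v: "\<omega> v \<noteq> 0"
      have rank: "polar (F v) w1 w3 * polar (F v) w2 w4 = polar (F v) w1 w4 * polar (F v) w2 w3" for w1 w2 w3 w4
        using False v right_minus_eq by blast
      obtain l where "linform l" "l \<noteq> 0" "l^2 \<in> V" "\<And>v'. (\<forall>w. polar (F v) v' w = 0) \<Longrightarrow> ev l v' = 0"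
        using rank_one_square[of "F v", OF _ _ rank] F[OF v] by blast
      then show "\<exists>l. linform l \<and> l \<noteq> 0 \<and> l^2 \<in> V \<and> ev l v = 0" using F[OF v] by blast
    qed
  next
    case True
    then obtain v1 w1 w2 w3 w4 where v1: "\<omega> v1 \<noteq> 0" "polar (F v1) w1 w3 * polar (F v1) w2 w4 - polar (F v1) w1 w4 * polar (F v1) w2 w3 \<noteq> 0"
      by blast
    define \<omega>2 where "\<omega>2 v = \<omega> v * (polar (F v) w1 w3 * polar (F v) w2 w4 - polar (F v) w1 w4 * polar (F v) w2 w3)" for v
    have lp2: "line_poly \<omega>2" unfolding \<omega>2_def by (intro line_poly_mult line_poly_diff lp lpF)
    have v1': "\<omega>2 v1 \<noteq> 0" using v1 by (simp add: \<omega>2_def)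
    have \<omega>: "\<omega> v \<noteq> 0" if "\<omega>2 v \<noteq> 0" for v using that by (auto simp: \<omega>2_def)
    define L where "L v u \<longleftrightarrow> (\<exists>r t. u = r *s v + t *s s v)" for v u
    have split: "\<exists>a b. linform a \<and> linform b \<and> a \<noteq> 0 \<and> F v = a * b \<and> (\<forall>u. ev a u = 0 \<and> ev b u = 0 \<longleftrightarrow> L v u)"
      if v: "\<omega>2 v \<noteq> 0" for v
    proof -
      have minor: "polar (F v) w1 w3 * polar (F v) w2 w4 - polar (F v) w1 w4 * polar (F v) w2 w3 \<noteq> 0"
        using v by (auto simp: \<omega>2_def)
      show ?thesis
        by (rule split_rank_two[OF _ _ _ minor, of v "s v"])
          (use F[OF \<omega>[OF v]] indep[OF \<omega>[OF v]] in \<open>auto simp: L_def\<close>)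
    qed
    have Lv: "L v v" "L v (s v)" for v
      unfolding L_def by (rule exI[of _ 1], rule exI[of _ 0], simp) (rule exI[of _ 0], rule exI[of _ 1], simp)
    show ?thesis
    proof (cases "\<exists>v v' a b a' b'. \<omega>2 v \<noteq> 0 \<and> \<omega>2 v' \<noteq> 0 \<and> F v = a * b \<and> F v' = a' * b' \<and>
        (\<forall>u. ev a u = 0 \<and> ev b u = 0 \<longleftrightarrow> L v u) \<and> (\<forall>u. ev a' u = 0 \<and> ev b' u = 0 \<longleftrightarrow> L v' u) \<and> coords a b a' b'")
      case True
      then obtain v v' a b a' b' where v: "\<omega>2 v \<noteq> 0" "\<omega>2 v' \<noteq> 0" and Fv: "F v = a * b" "F v' = a' * b'"
        and Lab: "\<forall>u. ev a u = 0 \<and> ev b u = 0 \<longleftrightarrow> L v u" "\<forall>u. ev a' u = 0 \<and> ev b' u = 0 \<longleftrightarrow> L v' u"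
        and co: "coords a b a' b'" by blast
      have co': "coords a' b' a b"
        by (rule coords_swap23[OF coords_swap12[OF coords_swap34[OF coords_swap23[OF co]]]])
      have ab: "a * b \<in> V" "a' * b' \<in> V" using F \<omega> v unfolding Fv[symmetric] by blast+
      show ?thesis
      proof (rule classified_two_pairs[OF co ab _ singular_quadric])
        fix q assume q: "q \<in> V"
        obtain r1 r2 r3 r4 r5 r6 r7 r8 r9 r0 where exp: "q = const r1 * a^2 + const r2 * b^2 + const r3 * a'^2 + const r4 * b'^2
            + const r5 * (a * b) + const r6 * (a * a') + const r7 * (a * b')
            + const r8 * (b * a') + const r9 * (b * b') + const r0 * (a' * b')"
          by (rule coords_quadric_expansion[OF co hom_V[OF q]])
        have r34: "r3 = 0 \<and> r4 = 0"
          by (rule no_squares_on_fibre[OF lp F unique fibre indep \<omega>[OF v(1)] Fv(1) co ab(2) _ _ q exp])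
            (use Lab(1) Lv in blast)+
        have exp': "q = const r3 * a'^2 + const r4 * b'^2 + const r1 * a^2 + const r2 * b^2
            + const r0 * (a' * b') + const r6 * (a' * a) + const r8 * (a' * b)
            + const r7 * (b' * a) + const r9 * (b' * b) + const r5 * (a * b)"
          unfolding exp by (simp add: algebra_simps)
        have r12: "r1 = 0 \<and> r2 = 0"
          by (rule no_squares_on_fibre[OF lp F unique fibre indep \<omega>[OF v(2)] Fv(2) co' ab(1) _ _ q exp'])
            (use Lab(2) Lv in blast)+
        have "q = const r5 * (a * b) + const r6 * (a * a') + const r7 * (a * b')
            + const r8 * (b * a') + const r9 * (b * b') + const r0 * (a' * b')"
          unfolding exp using r12 r34 by simp
        then show "\<exists>e f g h i j. q = const e * (a * b) + const f * (a * a') + const g * (a * b')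
            + const h * (b * a') + const i * (b * b') + const j * (a' * b')" by blast
      qed
    next
      case False
      have meet: "\<exists>e. e \<noteq> 0 \<and> L v e \<and> L v' e" if v: "\<omega>2 v \<noteq> 0" "\<omega>2 v' \<noteq> 0" for v v'
      proof -
        obtain a b where ab: "linform a" "linform b" "F v = a * b" "\<forall>u. ev a u = 0 \<and> ev b u = 0 \<longleftrightarrow> L v u"
          using split[OF v(1)] by blast
        obtain a' b' where ab': "linform a'" "linform b'" "F v' = a' * b'" "\<forall>u. ev a' u = 0 \<and> ev b' u = 0 \<longleftrightarrow> L v' u"
          using split[OF v(2)] by blast
        have "\<not> coords a b a' b'" using False v ab ab' by blast
        then obtain e where "e \<noteq> 0" "ev a e = 0" "ev b e = 0" "ev a' e = 0" "ev b' e = 0"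
          by (rule common_zero_of_dependent_forms[OF ab(1,2) ab'(1,2)])
        then show ?thesis using ab(4) ab'(4) by blast
      qed
      obtain a1 where a1: "linform a1" "a1 \<noteq> 0" "\<And>u. L v1 u \<Longrightarrow> ev a1 u = 0"
        using split[OF v1'] by blast
      obtain u1 where "ev a1 u1 \<noteq> 0" by (rule linform_nonzero_ev[OF a1(1,2)])
      then obtain v2 where v2: "\<omega>2 v2 \<noteq> 0" "ev a1 v2 \<noteq> 0"
        using line_poly_common_nonzero[OF lp2 line_poly_linform[OF a1(1)] v1'] by blast
      obtain e where e: "e \<noteq> 0" "L v1 e" "L v2 e" using meet[OF v1' v2(1)] by blast
      \<comment> \<open>Both lines are spanned by the common point and one further point.\<close>
      obtain x1 where x1: "\<And>u. L v1 u \<Longrightarrow> \<exists>r t. u = r *s e + t *s x1" "L v1 x1"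
        and ex1: "\<And>r t. r *s e + t *s x1 = 0 \<Longrightarrow> r = 0 \<and> t = 0"
      proof -
        obtain p q where pq: "e = p *s v1 + q *s s v1" using e(2) by (auto simp: L_def)
        have ind: "r = 0 \<and> t = 0" if "r *s v1 + t *s s v1 = 0" for r t using indep[OF v1(1) that] .
        show thesis
        proof (cases "q = 0")
          case True
          then have p: "p \<noteq> 0" using e(1) pq by auto
          show thesis
          proof (rule that[of "s v1"])
            fix u assume "L v1 u"
            then obtain r t where "u = r *s v1 + t *s s v1" by (auto simp: L_def)
            then have "u = (r / p) *s e + t *s s v1" using True p pq by (simp add: vec_eq_iff)
            then show "\<exists>r t. u = r *s e + t *s s v1" by blast
          next
            fix r t assume "r *s e + t *s s v1 = 0"
            then have "(r * p) *s v1 + t *s s v1 = 0" using True pq by (simp add: vec_eq_iff algebra_simps)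
            from ind[OF this] show "r = 0 \<and> t = 0" using p by simp
          qed (rule Lv)
        next
          case False
          show thesis
          proof (rule that[of v1])
            fix u assume "L v1 u"
            then obtain r t where "u = r *s v1 + t *s s v1" by (auto simp: L_def)
            then have "u = (t / q) *s e + (r - t * p / q) *s v1" using False pq by (simp add: vec_eq_iff field_simps)
            then show "\<exists>r t. u = r *s e + t *s v1" by blast
          next
            fix r t assume "r *s e + t *s v1 = 0"
            then have "(r * p + t) *s v1 + (r * q) *s s v1 = 0" using pq by (simp add: vec_eq_iff algebra_simps)
            from ind[OF this] show "r = 0 \<and> t = 0" using False by auto
          qed (rule Lv)
        qed
      qed
      have x2: "\<exists>r t. u = r *s e + t *s v2" if Lu: "L v2 u" for u
      proof -
        obtain p q where pq: "e = p *s v2 + q *s s v2" using e(3) by (auto simp: L_def)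
        have q: "q \<noteq> 0"
        proof
          assume q: "q = 0"
          have "ev a1 e = p * ev a1 v2" unfolding pq q by (simp add: ev_linform_scale[OF a1(1)])
          then have "p = 0" using a1(3)[OF e(2)] v2(2) by simp
          then show False using e(1) pq q by simp
        qed
        obtain r t where "u = r *s v2 + t *s s v2" using Lu by (auto simp: L_def)
        then have "u = (t / q) *s e + (r - t * p / q) *s v2" using q pq by (simp add: vec_eq_iff field_simps)
        then show ?thesis by blast
      qed
      obtain y where y: "\<And>p q r. y \<noteq> p *s e + q *s x1 + r *s v2" using vector_outside_span3[of e x1 v2] by blast
      have ind4: "p = 0 \<and> q = 0 \<and> r = 0 \<and> t = 0" if eq: "p *s e + q *s x1 + r *s v2 + t *s y = 0" for p q r t
      proof -
        have t: "t = 0"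
        proof (rule ccontr)
          assume "t \<noteq> 0"
          from vector_combination_eq_0D[OF eq this]
          have "y = (- inverse t * p) *s e + (- inverse t * q) *s x1 + (- inverse t * r) *s v2"
            by (simp add: vec_eq_iff algebra_simps)
          then show False using y by blast
        qed
        have "ev a1 (p *s e + q *s x1 + r *s v2) = r * ev a1 v2"
          using a1(3)[OF e(2)] a1(3)[OF x1(2)] by (simp add: ev_linform_add[OF a1(1)] ev_linform_scale[OF a1(1)])
        moreover have "ev a1 (p *s e + q *s x1 + r *s v2) = 0 * ev a1 e"
          using eq t ev_linform_scale[OF a1(1), of 0 e] by simp
        ultimately have r: "r = 0" using v2(2) by simp
        from eq t r have "p *s e + q *s x1 = 0" by simp
        from ex1[OF this] r t show ?thesis by simp
      qed
      obtain h where h: "linform h" "ev h e = 0" "ev h x1 = 0" "ev h v2 = 0" "ev h y = 1"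
        by (rule dual_coords[OF ind4]) (auto simp: coords_def)
      \<comment> \<open>The equation \<open>h\<close> defines the plane spanned by the two lines.\<close>
      have through: "L v e" if v: "\<omega>2 v \<noteq> 0" "ev h v \<noteq> 0" for v
      proof -
        obtain e1 where e1: "e1 \<noteq> 0" "L v e1" "L v1 e1" using meet[OF v(1) v1'] by blast
        obtain e2 where e2: "e2 \<noteq> 0" "L v e2" "L v2 e2" using meet[OF v(1) v2(1)] by blast
        obtain \<alpha> \<beta> where ab: "e1 = \<alpha> *s e + \<beta> *s x1" using x1(1)[OF e1(3)] by blast
        obtain \<gamma> \<delta> where gd: "e2 = \<gamma> *s e + \<delta> *s v2" using x2[OF e2(3)] by blast
        obtain r t where rt: "e1 = r *s v + t *s s v" using e1(2) by (auto simp: L_def)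
        obtain r' t' where rt': "e2 = r' *s v + t' *s s v" using e2(2) by (auto simp: L_def)
        have h1: "r * ev h v + t * ev h (s v) = 0"
          using arg_cong[OF rt, of "ev h"] h unfolding ab by (simp add: ev_linform_add[OF h(1)] ev_linform_scale[OF h(1)])
        have h2: "r' * ev h v + t' * ev h (s v) = 0"
          using arg_cong[OF rt', of "ev h"] h unfolding gd by (simp add: ev_linform_add[OF h(1)] ev_linform_scale[OF h(1)])
        have t': "t' \<noteq> 0"
        proof
          assume "t' = 0"
          then have "r' = 0" using h2 v(2) by simp
          then show False using e2(1) rt' \<open>t' = 0\<close> by simp
        qed
        have "(t' * r - t * r') * ev h v = 0"
          using h1 h2 by algebra
        then have "t' * r - t * r' = 0" using v(2) by simp
        then have "t' *s e1 = t *s e2"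
          unfolding rt rt' by (simp add: vec_eq_iff algebra_simps)
        then have "(t' * \<alpha> - t * \<gamma>) *s e + (t' * \<beta>) *s x1 + (- t * \<delta>) *s v2 + 0 *s y = 0"
          unfolding ab gd by (simp add: vec_eq_iff algebra_simps)
        from ind4[OF this] t' have "\<beta> = 0" by simp
        then have "e1 = \<alpha> *s e" using ab by simp
        moreover from this e1(1) have "\<alpha> \<noteq> 0" by auto
        ultimately have "e = (r / \<alpha>) *s v + (t / \<alpha>) *s s v"
          using rt by (simp add: vec_eq_iff field_simps)
        then show ?thesis by (auto simp: L_def)
      qed
      have hF1: "homogeneous 2 (F v1)" using F[OF v1(1)] hom_V by blast
      have F1e: "polar (F v1) w e = 0" for w
      proof -
        obtain p q where pq: "e = p *s v1 + q *s s v1" using e(2) by (auto simp: L_def)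
        show ?thesis unfolding pq using F[OF v1(1)]
          by (simp add: polar_bilinear[OF hF1] polar_commute[of "F v1" w])
      qed
      \<comment> \<open>At points where \<open>F v1\<close> does not vanish, \<open>e\<close> has no component along \<open>v\<close>.\<close>
      have ker: "polar q v e = 0" if v: "\<omega>2 v * ev h v * polar (F v1) v v \<noteq> 0" and q: "q \<in> V" for v q
      proof -
        have v': "\<omega>2 v \<noteq> 0" "ev h v \<noteq> 0" "polar (F v1) v v \<noteq> 0" using v by auto
        obtain r t where rt: "e = r *s v + t *s s v" using through[OF v'(1,2)] by (auto simp: L_def)
        have "r * polar (F v1) v v = 0"
          using F1e[of v] fibre[OF \<omega>[OF v'(1)], of "F v1"] F[OF v1(1)] unfolding rt
          by (simp add: polar_bilinear[OF hF1])
        then have "r = 0" using v'(3) by simp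
        then show ?thesis
          unfolding rt using fibre[OF \<omega>[OF v'(1)] q] polar_bilinear(4)[OF hom_V[OF q], of v t "s v"] by simp
      qed
      obtain u where u: "\<omega>2 u * ev h u \<noteq> 0"
        using line_poly_common_nonzero[OF lp2 line_poly_linform[OF h(1)] v1', of y] h(5) by (metis mult_eq_0_iff zero_neq_one)
      obtain u' where u': "polar (F v1) u' u' \<noteq> 0"
      proof -
        have "\<exists>u. ev (F v1) u \<noteq> 0"
          using F[OF v1(1)] quadric_eqI[OF hF1 homogeneous_0] by fastforce
        then show thesis using that by (auto simp: polar_self[OF hF1])
      qed
      have lp3: "line_poly (\<lambda>v. \<omega>2 v * ev h v)" by (intro line_poly_mult lp2 line_poly_linform h(1))
      obtain u'' where u'': "\<omega>2 u'' * ev h u'' \<noteq> 0" "polar (F v1) u'' u'' \<noteq> 0"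
        by (rule line_poly_common_nonzero[OF lp3 line_poly_polar(2)[OF hF1] u u'])
      have lp4: "line_poly (\<lambda>v. \<omega>2 v * ev h v * polar (F v1) v v)"
        by (rule line_poly_mult[OF lp3 line_poly_polar(2)[OF hF1]])
      show ?thesis
      proof (rule classified_common_kernel[OF e(1)])
        fix q v assume q: "q \<in> V"
        show "polar q v e = 0"
          by (rule line_poly_dense[OF lp4 line_poly_polar(1)[OF hom_V[OF q]], of u''])
            (use u'' ker q in auto)
      qed
    qed
  qed
qed

end

section \<open>Lexicographic leading terms of quadrics\<close>

lemma expo_less:
  "a < a' \<Longrightarrow> expo a b c d < expo a' b' c' d'"
  "b < b' \<Longrightarrow> expo a b c d < expo a b' c' d'"
proof -
  have order: "(0::4) < 2" "(0::4) < 3" "(1::4) < 3"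
    using less_trans[OF index_order(1,2)] less_trans[OF less_trans[OF index_order(1,2)] index_order(3)]
      less_trans[OF index_order(2,3)] by simp_all
  have no: "\<not> j < 0" for j :: 4
    by (rule index_cases[of j])
      (simp_all only: less_irrefl less_not_sym[OF index_order(1)] less_not_sym[OF order(1)]
        less_not_sym[OF order(2)] not_False_eq_True)
  have one': "j = 0 \<or> \<not> j < 1" for j :: 4
    by (rule index_cases[of j])
      (simp_all only: less_irrefl less_not_sym[OF index_order(2)] less_not_sym[OF order(3)]
        not_False_eq_True simp_thms)
  have one: "Poly_Mapping.lookup (expo a b c d) j = Poly_Mapping.lookup (expo a b' c' d') j" if "j < 1" for j
  proof -
    have "j = 0" using one'[of j] that by blast
    then show ?thesis by simp
  qed
  show "a < a' \<Longrightarrow> expo a b c d < expo a' b' c' d'"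
    unfolding exponent_order_lex by (rule exI[of _ 0]) (simp add: no)
  show "b < b' \<Longrightarrow> expo a b c d < expo a b' c' d'"
    unfolding exponent_order_lex by (rule exI[of _ 1], intro conjI allI impI) (simp, rule one)
qed

text \<open>An ideal generated by monomials contains only multiples of these monomials among its monomials.\<close>

lemma monomial_in_initial_ideal:
  assumes "Poly_Mapping.single m 1 \<in> initial_ideal A"
  obtains p d where "p \<in> A" "p \<noteq> 0" "m = Max (Poly_Mapping.keys p) + d"
proof -
  have "\<forall>m\<in>Poly_Mapping.keys x. \<exists>p\<in>A. p \<noteq> 0 \<and> (\<exists>d. m = Max (Poly_Mapping.keys p) + d)"
    if "x \<in> initial_ideal A" for x
    using that[unfolded initial_ideal_def]
  proof (induction rule: ideal_gen_induct)
    case zero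
    show ?case by simp
  next
    case (step r l q)
    from step.hyps(1) obtain p where p: "l = lead_monomial p" "p \<in> A" "p \<noteq> 0" by blast
    show ?case
    proof
      fix m assume "m \<in> Poly_Mapping.keys (r * l + q)"
      from subsetD[OF keys_add this]
      consider "m \<in> Poly_Mapping.keys (r * l)" | "m \<in> Poly_Mapping.keys q" by (elim UnE)
      then show "\<exists>p\<in>A. p \<noteq> 0 \<and> (\<exists>d. m = Max (Poly_Mapping.keys p) + d)"
      proof cases
        case 1
        from subsetD[OF keys_mult 1] obtain a b where ab: "m = a + b" "b \<in> Poly_Mapping.keys l"
          by (elim CollectE exE conjE)
        then have "m = Max (Poly_Mapping.keys p) + a"
          by (simp add: p(1) lead_monomial_def add.commute)
        then show ?thesis using p by blast
      next
        case 2
        then show ?thesis using step.IH by blast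
      qed
    qed
  qed
  from this[OF assms] show thesis using that by auto
qed

lemma lookup_mult_hom2:
  fixes r h :: "'k::field pol4"
  assumes h: "homogeneous 2 h" and n: "mdeg n \<le> 2"
  shows "Poly_Mapping.lookup (r * h) n = Poly_Mapping.lookup r 0 * Poly_Mapping.lookup h n"
proof -
  define r' where "r' = r - const (Poly_Mapping.lookup r 0)"
  have r: "r = const (Poly_Mapping.lookup r 0) + r'" by (simp add: r'_def)
  have "n \<notin> Poly_Mapping.keys (r' * h)"
  proof
    assume "n \<in> Poly_Mapping.keys (r' * h)"
    from subsetD[OF keys_mult this]
    obtain a b where ab: "n = a + b" "a \<in> Poly_Mapping.keys r'" "b \<in> Poly_Mapping.keys h"
      by (elim CollectE exE conjE)
    have "mdeg b = 2" using h ab(3) by (simp add: homogeneous_def)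
    then have "mdeg a = 0" using n unfolding ab(1) mdeg_add by simp
    then have "a = 0" by (intro poly_mapping_eqI) simp
    then show False using ab(2) by (simp add: r'_def in_keys_iff lookup_minus const_def)
  qed
  then have "Poly_Mapping.lookup (r' * h) n = 0" by (simp add: in_keys_iff)
  then show ?thesis
    by (subst r) (simp add: distrib_right lookup_add lookup_scale)
qed

lemma quadric_coefficients:
  fixes p :: "'k::field_char_0 pol4"
  assumes "homogeneous 2 p"
  shows "polar p (axis 0 1) (axis 0 1) = 2 * Poly_Mapping.lookup p (expo 2 0 0 0)"
    "polar p (axis 0 1) (axis 1 1) = Poly_Mapping.lookup p (expo 1 1 0 0)"
    "polar p (axis 0 1) (axis 2 1) = Poly_Mapping.lookup p (expo 1 0 1 0)"
    "polar p (axis 0 1) (axis 3 1) = Poly_Mapping.lookup p (expo 1 0 0 1)"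
proof -
  obtain a b c d e f g h i j where p: "p = const a * x1^2 + const b * x2^2 + const c * x3^2 + const d * x4^2
       + const e * (x1 * x2) + const f * (x1 * x3) + const g * (x1 * x4)
       + const h * (x2 * x3) + const i * (x2 * x4) + const j * (x3 * x4)"
    by (rule quadric_expansion[OF assms])
  have m: "p = const a * mon 2 0 0 0 + const b * mon 0 2 0 0 + const c * mon 0 0 2 0 + const d * mon 0 0 0 2
       + const e * mon 1 1 0 0 + const f * mon 1 0 1 0 + const g * mon 1 0 0 1
       + const h * mon 0 1 1 0 + const i * mon 0 1 0 1 + const j * mon 0 0 1 1"
    unfolding p by (simp add: mon_eq)
  have "Poly_Mapping.lookup p (expo 2 0 0 0) = a" "Poly_Mapping.lookup p (expo 1 1 0 0) = e"
    "Poly_Mapping.lookup p (expo 1 0 1 0) = f" "Poly_Mapping.lookup p (expo 1 0 0 1) = g"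
    unfolding m by (simp_all add: lookup_add lookup_scale lookup_mon)
  moreover have "polar p (axis 0 1) (axis 0 1) = 2 * a" "polar p (axis 0 1) (axis 1 1) = e"
    "polar p (axis 0 1) (axis 2 1) = f" "polar p (axis 0 1) (axis 3 1) = g"
    unfolding p by (simp_all add: polar_mult polar_square axis_def)
  ultimately show "polar p (axis 0 1) (axis 0 1) = 2 * Poly_Mapping.lookup p (expo 2 0 0 0)"
    "polar p (axis 0 1) (axis 1 1) = Poly_Mapping.lookup p (expo 1 1 0 0)"
    "polar p (axis 0 1) (axis 2 1) = Poly_Mapping.lookup p (expo 1 0 1 0)"
    "polar p (axis 0 1) (axis 3 1) = Poly_Mapping.lookup p (expo 1 0 0 1)"
    by simp_all
qed

lemma axis_vector_matrix: "axis i 1 v* (g :: 'k::field^4^4) = g $ i"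
  by (rule index_cases[of i]) (simp_all add: vec_eq_iff vector_matrix_mult_def sum_index axis_def)

lemma polar_lin_subst: "polar (lin_subst g q) v w = polar q (v v* g) (w v* g)"
  by (simp add: polar_def ev_lin_subst vector_matrix_left_distrib)

context four_quadrics
begin

text \<open>In degree at most two only the constant terms of the multipliers contribute.\<close>

lemma low_degree_part:
  fixes g :: "'k^4^4"
  assumes g: "invertible g" and "p \<in> gl_image g I"
  obtains q where "q \<in> V" "\<forall>n. mdeg n \<le> 2 \<longrightarrow> Poly_Mapping.lookup p n = Poly_Mapping.lookup (lin_subst g q) n"
proof -
  have "p \<in> ideal_gen (lin_subst g ` range f)"
    using assms(2) unfolding I_def lin_subst_ideal_gen[OF g] .
  then have "\<exists>q\<in>V. \<forall>n. mdeg n \<le> 2 \<longrightarrow> Poly_Mapping.lookup p n = Poly_Mapping.lookup (lin_subst g q) n"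
  proof (induction rule: ideal_gen_induct)
    case zero
    show ?case by (rule bexI[of _ 0]) auto
  next
    case (step r h p)
    then obtain i where h: "h = lin_subst g (f i)" by blast
    obtain q where q: "q \<in> V" "\<forall>n. mdeg n \<le> 2 \<longrightarrow> Poly_Mapping.lookup p n = Poly_Mapping.lookup (lin_subst g q) n"
      using step.IH by blast
    have "homogeneous 2 h" unfolding h by (rule homogeneous_lin_subst[OF hom_f])
    then show ?case
      by (intro bexI[of _ "const (Poly_Mapping.lookup r 0) * f i + q"])
        (use q(2) in \<open>auto simp: lookup_add lookup_scale lookup_mult_hom2 h intro!: q(1) f_in_V\<close>)
  qed
  then show thesis using that by blast
qed

text \<open>The leading monomial that divides \<open>m\<close> has degree two as well, because the ideal contains nothing of
  lower degree. So it is \<open>m\<close> itself, and the degree two part of the polynomial has the same leading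
  monomial.\<close>

lemma leading_quadric:
  fixes g :: "'k^4^4"
  assumes g: "invertible g" and m: "mdeg m = 2" and "Poly_Mapping.single m 1 \<in> initial_ideal (gl_image g I)"
  obtains q where "q \<in> V" "Poly_Mapping.lookup (lin_subst g q) m \<noteq> 0"
    "\<forall>n. m < n \<longrightarrow> Poly_Mapping.lookup (lin_subst g q) n = 0"
proof -
  obtain p d where p: "p \<in> gl_image g I" "p \<noteq> 0" "m = Max (Poly_Mapping.keys p) + d"
    by (rule monomial_in_initial_ideal[OF assms(3)])
  obtain q where q: "q \<in> V" "\<forall>n. mdeg n \<le> 2 \<longrightarrow> Poly_Mapping.lookup p n = Poly_Mapping.lookup (lin_subst g q) n"
    by (rule low_degree_part[OF g p(1)])
  have hom: "homogeneous 2 (lin_subst g q)"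
    by (rule homogeneous_lin_subst[OF hom_V[OF q(1)]])
  let ?k = "Max (Poly_Mapping.keys p)"
  have "?k \<in> Poly_Mapping.keys p" using p(2) by (intro Max_in) auto
  then have k: "Poly_Mapping.lookup p ?k \<noteq> 0" by (simp add: in_keys_iff)
  have deg: "mdeg ?k + mdeg d = 2" using m unfolding p(3) mdeg_add .
  then have k': "Poly_Mapping.lookup (lin_subst g q) ?k \<noteq> 0" using k q(2) by auto
  then have "mdeg ?k = 2" using hom by (simp add: homogeneous_def in_keys_iff)
  then have "mdeg d = 0" using deg by simp
  then have "d = 0" by (intro poly_mapping_eqI) simp
  then have mk: "m = ?k" using p(3) by simp
  have "Poly_Mapping.lookup (lin_subst g q) n = 0" if n: "m < n" for n
  proof (cases "mdeg n \<le> 2")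
    case True
    have "n \<notin> Poly_Mapping.keys p"
    proof
      assume "n \<in> Poly_Mapping.keys p"
      then have "n \<le> ?k" by simp
      then show False using n unfolding mk by simp
    qed
    then show ?thesis using q(2) True by (simp add: in_keys_iff)
  next
    case False
    then have "n \<notin> Poly_Mapping.keys (lin_subst g q)" using hom by (auto simp: homogeneous_def)
    then show ?thesis by (simp add: in_keys_iff)
  qed
  then show thesis using that[OF q(1)] k' unfolding mk[symmetric] by blast
qed

text \<open>All quadratic monomials divisible by $x_1$ are larger than $x_2^2$. A quadric with leading monomial
  $x_2^2$ is therefore free of $x_1$, that is, singular at the first unit vector.\<close>

lemma vertex_of_leading_square:
  fixes g :: "'k^4^4"
  assumes g: "invertible g" and q: "q \<in> V"
    and lead: "Poly_Mapping.lookup (lin_subst g q) (expo 0 2 0 0) \<noteq> 0"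
      "\<forall>n. expo 0 2 0 0 < n \<longrightarrow> Poly_Mapping.lookup (lin_subst g q) n = 0"
  shows "q \<noteq> 0" "polar (lin_subst g q) (axis 0 1) w = 0" "polar q (g $ 0) w = 0"
proof -
  show "q \<noteq> 0" using lead(1) by auto
  have hom: "homogeneous 2 (lin_subst g q)" by (rule homogeneous_lin_subst[OF hom_V[OF q]])
  have "Poly_Mapping.lookup (lin_subst g q) (expo (Suc n) b c d) = 0" for n b c d
    using lead(2) expo_less(1)[of 0 "Suc n" 2 0 0 b c d] by blast
  from this[of 1 0 0 0] this[of 0 1 0 0] this[of 0 0 1 0] this[of 0 0 0 1]
  have "polar (lin_subst g q) (axis 0 1) (axis j 1) = 0" for j
    by (rule_tac index_cases[of j]) (simp_all add: quadric_coefficients[OF hom] numeral_2_eq_2)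
  then show *: "polar (lin_subst g q) (axis 0 1) w = 0" for w
    by (subst polar_expansion[OF hom]) simp
  obtain h where h: "h ** g = mat 1" using g by (auto simp: invertible_def)
  have "polar q (g $ 0) ((w v* h) v* g) = 0"
    using *[of "w v* h"] by (simp add: polar_lin_subst axis_vector_matrix)
  then show "polar q (g $ 0) w = 0"
    by (simp add: vector_matrix_mul_assoc h)
qed

lemma singular_row:
  fixes g :: "'k^4^4"
  assumes g: "invertible g" and x: "x2^2 \<in> initial_ideal (gl_image g I)"
  shows "det (polar_matrix (g $ 0)) = 0"
proof -
  have m: "Poly_Mapping.single (expo 0 2 0 0) 1 \<in> initial_ideal (gl_image g I)"
    using x by (simp add: mon_def[symmetric] mon_eq)
  obtain q where q: "q \<in> V" "Poly_Mapping.lookup (lin_subst g q) (expo 0 2 0 0) \<noteq> 0"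
    "\<forall>n. expo 0 2 0 0 < n \<longrightarrow> Poly_Mapping.lookup (lin_subst g q) n = 0"
    by (rule leading_quadric[OF g _ m]) simp_all
  show ?thesis
    unfolding det_polar_matrix_eq_0_iff
    using q(1) vertex_of_leading_square[OF g q] by blast
qed

text \<open>The coefficients at $x_1^2,x_1x_2,x_1x_3$ form a triangular system on the three quadrics with these
  leading monomials, so no combination of them is singular at the first unit vector.\<close>

lemma rank_three_row:
  fixes g :: "'k^4^4"
  assumes g: "invertible g" and x: "{x1^2, x1 * x2, x1 * x3, x2^2} \<subseteq> initial_ideal (gl_image g I)"
  shows "\<exists>c0. \<forall>c. (\<forall>w. polar (comb c) (g $ 0) w = 0) \<longrightarrow> (\<exists>t. c = t *s c0)"
proof -
  have m: "Poly_Mapping.single (expo 2 0 0 0) 1 \<in> initial_ideal (gl_image g I)"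
    "Poly_Mapping.single (expo 1 1 0 0) 1 \<in> initial_ideal (gl_image g I)"
    "Poly_Mapping.single (expo 1 0 1 0) 1 \<in> initial_ideal (gl_image g I)"
    "Poly_Mapping.single (expo 0 2 0 0) 1 \<in> initial_ideal (gl_image g I)"
    using x by (simp_all add: mon_def[symmetric] mon_eq)
  obtain q1 where q1: "q1 \<in> V" "Poly_Mapping.lookup (lin_subst g q1) (expo 2 0 0 0) \<noteq> 0"
    by (rule leading_quadric[OF g _ m(1)]) simp_all
  obtain q2 where q2: "q2 \<in> V" "Poly_Mapping.lookup (lin_subst g q2) (expo 1 1 0 0) \<noteq> 0"
    "\<forall>n. expo 1 1 0 0 < n \<longrightarrow> Poly_Mapping.lookup (lin_subst g q2) n = 0"
    by (rule leading_quadric[OF g _ m(2)]) simp_all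
  obtain q3 where q3: "q3 \<in> V" "Poly_Mapping.lookup (lin_subst g q3) (expo 1 0 1 0) \<noteq> 0"
    "\<forall>n. expo 1 0 1 0 < n \<longrightarrow> Poly_Mapping.lookup (lin_subst g q3) n = 0"
    by (rule leading_quadric[OF g _ m(3)]) simp_all
  obtain q0 where q0: "q0 \<in> V" "Poly_Mapping.lookup (lin_subst g q0) (expo 0 2 0 0) \<noteq> 0"
    "\<forall>n. expo 0 2 0 0 < n \<longrightarrow> Poly_Mapping.lookup (lin_subst g q0) n = 0"
    by (rule leading_quadric[OF g _ m(4)]) simp_all
  define \<phi> where "\<phi> j q = polar (lin_subst g q) (axis 0 1) (axis j 1)" for j q
  have lin: "\<phi> j (const a * q1 + const b * q2 + const c * q3 + const d * q0)
      = a * \<phi> j q1 + b * \<phi> j q2 + c * \<phi> j q3 + d * \<phi> j q0" for j a b c d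
    by (simp add: \<phi>_def)
  note coeff = quadric_coefficients[OF homogeneous_lin_subst[OF hom_V]]
  have z: "\<phi> 0 q1 \<noteq> 0" "\<phi> 0 q2 = 0" "\<phi> 1 q2 \<noteq> 0" "\<phi> 0 q3 = 0" "\<phi> 1 q3 = 0" "\<phi> 2 q3 \<noteq> 0"
    using q1 q2 q3 expo_less(1)[of 1 2 1 0 0 0 0 0] expo_less(1)[of 1 2 0 1 0 0 0 0] expo_less(2)[of 0 1 1 1 0 0 0]
    by (simp_all add: \<phi>_def coeff)
  have z0: "\<phi> j q0 = 0" for j
    unfolding \<phi>_def by (rule vertex_of_leading_square(2)[OF g q0])
  have zero: "a = 0 \<and> b = 0 \<and> c = 0" if "\<And>j. \<phi> j (const a * q1 + const b * q2 + const c * q3 + const d * q0) = 0" for a b c d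
    using that[of 0] that[of 1] that[of 2] z z0 unfolding lin by simp
  have ind': "a = 0 \<and> b = 0 \<and> c = 0 \<and> d = 0"
    if eq: "const a * q1 + const b * q2 + const c * q3 + const d * q0 = 0" for a b c d
  proof -
    have abc: "a = 0 \<and> b = 0 \<and> c = 0"
      by (rule zero[of a b c d], unfold eq) (simp add: \<phi>_def)
    then have "const d * q0 = 0" using eq by simp
    then have "d = 0"
      using vertex_of_leading_square(1)[OF g q0] pvs.scale_eq_0_iff by blast
    with abc show ?thesis by simp
  qed
  have ind: "ind4 q1 q2 q3 q0"
    by (rule ind4I) (use ind' in blast)+
  obtain c0 where c0: "q0 = comb c0" using q0(1) by (auto simp: V_def)
  show ?thesis
  proof (rule exI[of _ c0], intro allI impI)
    fix c assume c: "\<forall>w. polar (comb c) (g $ 0) w = 0"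
    obtain a1 a2 a3 a0 where e: "comb c = const a1 * q1 + const a2 * q2 + const a3 * q3 + const a0 * q0"
      by (rule V_spanned[OF q1(1) q2(1) q3(1) q0(1) ind comb_in_V])
    have "a1 = 0 \<and> a2 = 0 \<and> a3 = 0"
      by (rule zero[of a1 a2 a3 a0], unfold e[symmetric])
        (simp add: \<phi>_def polar_lin_subst axis_vector_matrix c)
    then have "comb c = comb (a0 *s c0)" using e by (simp add: c0 comb_scale)
    then have "comb (c - a0 *s c0) = 0"
      using comb_add[of "c - a0 *s c0" "a0 *s c0"] by simp
    then have "c = a0 *s c0" by (simp add: comb_eq_0_iff)
    then show "\<exists>t. c = t *s c0" ..
  qed
qed

end

section \<open>From the generic initial ideal to degenerate quadrics\<close>

lemma line_poly_power: "line_poly g \<Longrightarrow> line_poly (\<lambda>v. g v ^ n)"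
  by (induction n) auto

lemma line_poly_mp_eval:
  "(\<And>x. line_poly (\<lambda>v. a v x)) \<Longrightarrow> line_poly (\<lambda>v. mp_eval id (a v) p)"
  unfolding mp_eval_def
  by (intro line_poly_sum line_poly_mult line_poly_prod line_poly_power line_poly_const)

lemma line_poly_coordinate: "line_poly (\<lambda>v. v $ j)"
  using line_poly_linform[OF linform_var[of j]] by simp

text \<open>By minimality the generators are linearly independent, since a relation expresses one of them by the
  others.\<close>

lemma four_quadrics_of_min_gen:
  fixes I0 :: "('k::{alg_closed_field, field_char_0}) pol4 set"
  assumes "min_gen_by_four_quadrics I0"
  obtains f :: "4 \<Rightarrow> 'k pol4" where "four_quadrics f" "ideal_gen (range f) = I0"
proof -
  obtain F where F: "card F = 4" "\<forall>f\<in>F. homogeneous 2 f" "ideal_gen F = I0" "\<And>G. G \<subset> F \<Longrightarrow> ideal_gen G \<noteq> I0"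
    using assms unfolding min_gen_by_four_quadrics_def minimally_generates_def by blast
  have "finite F" using F(1) card.infinite by fastforce
  then obtain f where f: "bij_betw f (UNIV :: 4 set) F"
    using finite_same_card_bij[of "UNIV :: 4 set" F] F(1) by auto
  have range: "range f = F" using f by (rule bij_betw_imp_surj_on)
  have "four_quadrics f"
  proof
    show "homogeneous 2 (f i)" for i using F(2) range by blast
    fix c :: "'k^4" assume sum: "(\<Sum>i\<in>UNIV. const (c $ i) * f i) = 0"
    show "c = 0"
    proof (rule ccontr)
      assume "c \<noteq> 0"
      then obtain k where k: "c $ k \<noteq> 0" by (auto simp: vec_eq_iff)
      define G where "G = F - {f k}"
      have GF: "G \<subset> F" unfolding G_def range[symmetric] by blast
      have fG: "f i \<in> G" if "i \<noteq> k" for i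
        using that bij_betw_imp_inj_on[OF f] range[symmetric] by (simp add: G_def inj_eq)
      have "const (c $ k) * f k = 0 - (\<Sum>i\<in>UNIV - {k}. const (c $ i) * f i)"
        using sum sum.remove[of UNIV k "\<lambda>i. const (c $ i) * f i"] by (simp add: eq_neg_iff_add_eq_0)
      also have "\<dots> \<in> ideal_gen G"
        by (intro ideal_gen_diff ideal_gen_0 ideal_gen_sum ideal_gen_mult ideal_gen_base fG) simp
      finally have "const (inverse (c $ k)) * (const (c $ k) * f k) \<in> ideal_gen G"
        by (rule ideal_gen_mult)
      then have "f k \<in> ideal_gen G"
        using k by (simp add: mult.assoc[symmetric] const_mult[symmetric])
      then have "f i \<in> ideal_gen G" for i by (cases "i = k") (simp_all add: fG ideal_gen_base)
      then have "F \<subseteq> ideal_gen G" unfolding range[symmetric] by (rule image_subsetI)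
      moreover have "G \<subseteq> ideal_gen F" using GF by (auto intro: ideal_gen_base)
      ultimately have "ideal_gen G = I0" unfolding F(3)[symmetric] by (intro ideal_gen_eqI)
      with F(4)[OF GF] show False ..
    qed
  qed
  then show thesis by (rule that) (simp only: range F(3))
qed

text \<open>The Jacobian matrix is singular at the first row of every matrix in the open set. Replacing the first
  row of a fixed matrix in the open set by a general vector gives a matrix in the open set again, so
  the Jacobian determinant vanishes at general vectors and hence everywhere.\<close>

lemma degenerate_of_gin:
  assumes f: "four_quadrics f" and gin: "is_gin (ideal_gen (range f)) J"
    and J: "{x1^2, x1 * x2, x1 * x3, x2^2} \<subseteq> J"
  shows "degenerate_quadrics f"
proof -
  interpret four_quadrics f by (rule f)
  obtain S and U :: "('a^4^4) set" where U: "U = {g. invertible g \<and> \<not> (\<forall>p\<in>S. mp_eval id (\<lambda>(i, j). g $ i $ j) p = 0)}"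
    and nU: "U \<noteq> {}" and UJ: "\<forall>g\<in>U. initial_ideal (gl_image g I) = J"
    using gin unfolding is_gin_def zariski_open_GL4_def I_def by blast
  obtain g0 where g0: "g0 \<in> U" using nU by blast
  then obtain p where inv: "invertible g0" and p: "p \<in> S" "mp_eval id (\<lambda>(i, j). g0 $ i $ j) p \<noteq> 0"
    unfolding U by blast
  define R :: "'a^4 \<Rightarrow> 'a^4^4" where "R v = (\<chi> i. if i = 0 then v else g0 $ i)" for v
  have R: "R v $ 0 = v" "R (g0 $ 0) = g0" for v by (simp_all add: R_def vec_eq_iff)
  have R_poly: "line_poly (\<lambda>v. R v $ i $ j)" for i j
    by (cases "i = 0") (simp_all add: R_def line_poly_coordinate line_poly_const)
  let ?w = "\<lambda>v. mp_eval id (\<lambda>(i, j). R v $ i $ j) p * det (R v)"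
  have w_poly: "line_poly ?w"
    by (intro line_poly_mult line_poly_mp_eval line_poly_det) (auto simp: R_poly)
  have d_poly: "line_poly (\<lambda>v. det (polar_matrix v))"
    by (intro line_poly_det line_poly_polar_matrix)
  have w0: "?w (g0 $ 0) \<noteq> 0" using inv p(2) by (simp add: R invertible_det_nz)
  have wd: "det (polar_matrix v) = 0" if w: "?w v \<noteq> 0" for v
  proof -
    have "R v \<in> U" unfolding U using w p(1) by (auto simp: invertible_det_nz)
    then show ?thesis
      using singular_row[of "R v"] J UJ by (auto simp: U R)
  qed
  have "det (polar_matrix v) = 0" for v
    by (rule line_poly_dense[OF w_poly d_poly w0 wd])
  moreover have "\<exists>c0. \<forall>c. (\<forall>w. polar (comb c) (g0 $ 0) w = 0) \<longrightarrow> (\<exists>t. c = t *s c0)"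
    by (rule rank_three_row[OF inv]) (use UJ g0 J in blast)
  ultimately show ?thesis by unfold_locales blast+
qed

section \<open>The classification\<close>

theorem theorem3p3:
  fixes I J :: "('k :: {alg_closed_field, field_char_0}) pol4 set"
  assumes "min_gen_by_four_quadrics I"
    and "is_gin I J"
    and "{x1^2, x1 * x2, x1 * x3, x2^2} \<subseteq> J"
  shows "(lin_equiv I ideal_i \<or> lin_equiv I ideal_ii \<or> lin_equiv I ideal_iii \<or>
          lin_equiv I ideal_iv \<or> lin_equiv I ideal_v \<or> lin_equiv I ideal_vi \<or>
          lin_equiv I ideal_vii \<or>
          (\<exists>q\<in>{x3 * x4, x3^2 + x2 * x4, x3^2}. lin_equiv I (ideal_viii q)) \<or>
          lin_equiv I ideal_ix \<or> lin_equiv I ideal_x)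
       \<and> (lin_equiv I ideal_ii \<or> lin_equiv I ideal_iii \<or> lin_equiv I ideal_iv \<or>
          (\<exists>q\<in>{x3 * x4, x3^2 + x2 * x4, x3^2}. lin_equiv I (ideal_viii q)) \<longrightarrow>
          hilbert_fun I 0 = 1 \<and> hilbert_fun I 1 = 4 \<and> (\<forall>j\<ge>2. hilbert_fun I j = 6))
       \<and> (lin_equiv I ideal_v \<or> lin_equiv I ideal_vi \<longrightarrow>
          hilbert_fun I 0 = 1 \<and> hilbert_fun I 1 = 4 \<and> (\<forall>j\<ge>2. hilbert_fun I j = j + 4))
       \<and> (lin_equiv I ideal_i \<or> lin_equiv I ideal_vii \<or> lin_equiv I ideal_ix \<or>
          lin_equiv I ideal_x \<longrightarrow>
          hilbert_fun I 0 = 1 \<and> (\<forall>j\<ge>1. hilbert_fun I j = 2 * j + 2))"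
proof -
  obtain f :: "4 \<Rightarrow> 'k pol4" where f: "four_quadrics f" and I: "ideal_gen (range f) = I"
    by (rule four_quadrics_of_min_gen[OF assms(1)])
  interpret degenerate_quadrics f
    by (rule degenerate_of_gin[OF f _ assms(3)]) (unfold I, rule assms(2))
  note classes = classified_degenerate[unfolded classified_def I_def I]
  note at_1 = hilbert_ii(2) hilbert_iii(2) hilbert_iv(2) hilbert_v(2) hilbert_vi(2)
    hilbert_viii_xy(2) hilbert_viii_cone(2) hilbert_viii_sq(2)
  show ?thesis
  proof (intro conjI impI)
    show "lin_equiv I ideal_i \<or> lin_equiv I ideal_ii \<or> lin_equiv I ideal_iii \<or>
          lin_equiv I ideal_iv \<or> lin_equiv I ideal_v \<or> lin_equiv I ideal_vi \<or>
          lin_equiv I ideal_vii \<or>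
          (\<exists>q\<in>{x3 * x4, x3^2 + x2 * x4, x3^2}. lin_equiv I (ideal_viii q)) \<or>
          lin_equiv I ideal_ix \<or> lin_equiv I ideal_x" by (rule classes)
  qed (auto simp: hilbert_fun_lin_equiv hilbert_i hilbert_ii hilbert_iii hilbert_iv hilbert_v hilbert_vi
      hilbert_vii hilbert_viii_xy hilbert_viii_cone hilbert_viii_sq hilbert_ix hilbert_x at_1[unfolded One_nat_def])
qed

end
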